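(* Let $G$ be a connected complex reductive group, $T\subset G$ a maximal torus, $\lambda:\mathbb C^*\to T$ a cocharacter, and $\rho:G\to GL(V_\rho)$ a finite-dimensional complex representation with weight decomposition $V_\rho=\bigoplus_{\mu\in X^*(T)}V_\mu$; put $k_\mu=\langle\mu,\lambda\rangle\in\mathbb Z$. Let $X=\mathbb{CP}^3$, let $Q\subset X$ be a smooth quadric with defining section $q\in H^0(X,\mathcal O_X(2))$, and $U=X\setminus Q$. Let $\mathcal P_\lambda$ be the sourced Ward principal $G$-bundle of type $\lambda$ on the gluing groupoid of $(X,Q)$. Then the associated vector bundle $\mathcal P_\lambda\times_GV_\rho$ is exactly the weight-decomposed bundle $E_{\lambda,\rho}$ on the gluing groupoid whose restrictions to the two sheets are $$E_{\lambda,\rho,+}=X_+\times V_\rho,\qquad E_{\lambda,\rho,-}=\bigoplus_\mu\mathcal O_X(-2k_\mu)\otimes V_\mu,$$ and which over $U$ is glued weight-by-weight by multiplication by $$q^{-k_\mu}:\mathcal O_X|_U\otimes V_\mu\longrightarrow\mathcal O_X(-2k_\mu)|_U\otimes V_\mu .$$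
   Context: Let $X_+,X_-$ be two copies of $X$. The gluing groupoid of $(X,Q)$ has unit space $X_+\sqcup X_-$ and, besides identities, exactly the arrows $p_+\leftrightarrow p_-$ for $p\in U$. A principal (resp. vector) bundle on it is a pair of principal (resp. vector) bundles on $X_+$ and $X_-$ together with an isomorphism between them over $U$; isomorphisms of such data are pairs of isomorphisms compatible with the gluings. Sourced Ward principal bundle: put $\mathcal L_Q=\mathcal O_X(-Q)\cong\mathcal O_X(-2)$, with associated principal $\mathbb C^*$-bundle $\mathcal L_Q^\times$. Then $\mathcal P_\lambda$ consists of $P_{\lambda,+}=X_+\times G$ and $P_{\lambda,-}=\mathcal L_Q^\times\times_{\mathbb C^*,\lambda}G$ (where $t\in\mathbb C^*$ acts on $G$ by left multiplication by $\lambda(t)$, so $[\ell t,g]=[\ell,\lambda(t)g]$), glued over $U$ by the trivialization of $P_{\lambda,-}|_U$ coming from the nowhere-vanishing section $q^{-1}$ of $\mathcal L_Q|_U$, i.e. $(p,g)\mapsto[q(p)^{-1},g]$. The associated-bundle convention is that a $\mathbb C^*$-weight $k$ produces the line factor $\mathcal L_Q^{k}$. $T$ acts on $V_\mu$ by the character $\mu$, and $\langle\mu,\lambda\rangle$ is the integer with $\mu(\lambda(t))=t^{\langle\mu,\lambda\rangle}$. *)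

theory Defs
  imports "HOL-Analysis.Analysis"
begin

section \<open>Linear algebraic groups over the complex numbers\<close>

text \<open>Linear algebraic groups are Zariski closed subgroups of some \<open>GL\<^sub>n\<close>, i.e. sets of invertible
  complex matrices. All rings of regular functions that occur below are generated by finitely many
  explicit functions.\<close>

inductive_set function_algebra :: "('a \<Rightarrow> complex) set \<Rightarrow> ('a \<Rightarrow> complex) set"
  for S :: "('a \<Rightarrow> complex) set" where
  gen: "f \<in> S \<Longrightarrow> f \<in> function_algebra S"
| const: "(\<lambda>_. c) \<in> function_algebra S"
| add: "f \<in> function_algebra S \<Longrightarrow> g \<in> function_algebra S \<Longrightarrow> (\<lambda>x. f x + g x) \<in> function_algebra S"
| mult: "f \<in> function_algebra S \<Longrightarrow> g \<in> function_algebra S \<Longrightarrow> (\<lambda>x. f x * g x) \<in> function_algebra S"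

definition regular_on :: "('a \<Rightarrow> complex) set \<Rightarrow> 'a set \<Rightarrow> ('a \<Rightarrow> complex) \<Rightarrow> bool" where
  "regular_on S D f \<longleftrightarrow> (\<exists>h \<in> function_algebra S. \<forall>x\<in>D. f x = h x)"

text \<open>Coordinate rings of \<open>GL\<^sub>n\<close>, of \<open>\<complex>\<^sup>*\<close> and of the split torus \<open>(\<complex>\<^sup>*)\<^sup>r\<close>; a point of the latter
  is a sequence of nonzero numbers that is 1 from position r on.\<close>

definition GL_gens :: "(complex^'n^'n \<Rightarrow> complex) set" where
  "GL_gens = {f. \<exists>i j. f = (\<lambda>A. A $ i $ j)} \<union> {\<lambda>A. inverse (det A)}"

definition Cstar_gens :: "(complex \<Rightarrow> complex) set" where
  "Cstar_gens = {\<lambda>t. t, inverse}"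

definition split_torus :: "nat \<Rightarrow> (nat \<Rightarrow> complex) set" where
  "split_torus r = {t. \<forall>i. t i \<noteq> 0 \<and> (r \<le> i \<longrightarrow> t i = 1)}"

definition split_torus_gens :: "nat \<Rightarrow> ((nat \<Rightarrow> complex) \<Rightarrow> complex) set" where
  "split_torus_gens r = (\<Union>i<r. {\<lambda>t. t i, \<lambda>t. inverse (t i)})"

definition GL :: "(complex^'n^'n) set" where
  "GL = {A. invertible A}"

definition zariski_closed :: "(complex^'n^'n) set \<Rightarrow> bool" where
  "zariski_closed Z \<longleftrightarrow>
     (\<exists>F \<subseteq> function_algebra GL_gens. Z = {A \<in> GL. \<forall>f\<in>F. f A = 0})"

definition zariski_connected :: "(complex^'n^'n) set \<Rightarrow> bool" where
  "zariski_connected Z \<longleftrightarrow> Z \<noteq> {} \<and>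
     \<not> (\<exists>Z1 Z2. zariski_closed Z1 \<and> zariski_closed Z2 \<and> Z1 \<noteq> {} \<and> Z2 \<noteq> {} \<and>
          Z1 \<inter> Z2 = {} \<and> Z1 \<union> Z2 = Z)"

definition algebraic_group :: "(complex^'n^'n) set \<Rightarrow> bool" where
  "algebraic_group G \<longleftrightarrow> zariski_closed G \<and> mat 1 \<in> G \<and>
     (\<forall>A\<in>G. \<forall>B\<in>G. A ** B \<in> G) \<and> (\<forall>A\<in>G. matrix_inv A \<in> G)"

text \<open>The iterated product is spelled out because \<open>^\<close> on \<^typ>\<open>complex^'n^'n\<close> is the componentwise
  power.\<close>

definition unipotent :: "complex^'n^'n \<Rightarrow> bool" where
  "unipotent A \<longleftrightarrow> (\<exists>k. (((**) (A - mat 1)) ^^ k) (mat 1) = 0)"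

definition connected_reductive_group :: "(complex^'n^'n) set \<Rightarrow> bool" where
  "connected_reductive_group G \<longleftrightarrow> algebraic_group G \<and> zariski_connected G \<and>
     (\<forall>N. algebraic_group N \<and> N \<subseteq> G \<and> zariski_connected N \<and>
          (\<forall>g\<in>G. \<forall>a\<in>N. g ** a ** matrix_inv g \<in> N) \<and> (\<forall>a\<in>N. unipotent a)
        \<longrightarrow> N = {mat 1})"

definition torus :: "(complex^'n^'n) set \<Rightarrow> bool" where
  "torus T \<longleftrightarrow> algebraic_group T \<and>
     (\<exists>r \<phi>. bij_betw \<phi> (split_torus r) T \<and>
        (\<forall>s\<in>split_torus r. \<forall>t\<in>split_torus r. \<phi> (\<lambda>i. s i * t i) = \<phi> s ** \<phi> t) \<and>
        (\<forall>i j. regular_on (split_torus_gens r) (split_torus r) (\<lambda>t. \<phi> t $ i $ j)) \<and>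
        (\<forall>i<r. regular_on GL_gens T (\<lambda>A. inv_into (split_torus r) \<phi> A i)))"

definition maximal_torus :: "(complex^'n^'n) set \<Rightarrow> (complex^'n^'n) set \<Rightarrow> bool" where
  "maximal_torus G T \<longleftrightarrow> torus T \<and> T \<subseteq> G \<and> (\<forall>T'. torus T' \<and> T \<subseteq> T' \<and> T' \<subseteq> G \<longrightarrow> T' = T)"

definition cocharacter :: "(complex^'n^'n) set \<Rightarrow> (complex \<Rightarrow> complex^'n^'n) \<Rightarrow> bool" where
  "cocharacter T lam \<longleftrightarrow> (\<forall>t. t \<noteq> 0 \<longrightarrow> lam t \<in> T) \<and>
     (\<forall>s t. s \<noteq> 0 \<longrightarrow> t \<noteq> 0 \<longrightarrow> lam (s * t) = lam s ** lam t) \<and>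
     (\<forall>i j. regular_on Cstar_gens (- {0}) (\<lambda>t. lam t $ i $ j))"

text \<open>\<open>X\<^sup>*(T)\<close>; characters are extensional so that they are determined by their values on T.\<close>

definition characters :: "(complex^'n^'n) set \<Rightarrow> (complex^'n^'n \<Rightarrow> complex) set" where
  "characters T = {\<mu> \<in> extensional T. (\<forall>a\<in>T. \<mu> a \<noteq> 0) \<and>
     (\<forall>a\<in>T. \<forall>b\<in>T. \<mu> (a ** b) = \<mu> a * \<mu> b) \<and> regular_on GL_gens T \<mu>}"

definition pairing :: "(complex^'n^'n \<Rightarrow> complex) \<Rightarrow> (complex \<Rightarrow> complex^'n^'n) \<Rightarrow> int" where
  "pairing \<mu> lam = (THE k. \<forall>t. t \<noteq> 0 \<longrightarrow> \<mu> (lam t) = t powi k)"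

definition linear_functional ::
  "(complex \<Rightarrow> 'v \<Rightarrow> 'v) \<Rightarrow> ('v::ab_group_add \<Rightarrow> complex) \<Rightarrow> bool" where
  "linear_functional smul \<phi> \<longleftrightarrow> Vector_Spaces.linear smul (*) \<phi>"

definition rational_representation ::
  "(complex^'n^'n) set \<Rightarrow> (complex \<Rightarrow> 'v \<Rightarrow> 'v) \<Rightarrow> (complex^'n^'n \<Rightarrow> 'v::ab_group_add \<Rightarrow> 'v) \<Rightarrow> bool"
  where
  "rational_representation G smul \<rho> \<longleftrightarrow>
     (\<forall>g\<in>G. Vector_Spaces.linear smul smul (\<rho> g)) \<and> \<rho> (mat 1) = id \<and>
     (\<forall>g\<in>G. \<forall>h\<in>G. \<rho> (g ** h) = \<rho> g \<circ> \<rho> h) \<and>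
     (\<forall>\<phi> v. linear_functional smul \<phi> \<longrightarrow> regular_on GL_gens G (\<lambda>g. \<phi> (\<rho> g v)))"

definition weight_space ::
  "(complex^'n^'n) set \<Rightarrow> (complex \<Rightarrow> 'v \<Rightarrow> 'v) \<Rightarrow> (complex^'n^'n \<Rightarrow> 'v::ab_group_add \<Rightarrow> 'v) \<Rightarrow>
     (complex^'n^'n \<Rightarrow> complex) \<Rightarrow> 'v set" where
  "weight_space T smul \<rho> \<mu> = {v. \<forall>a\<in>T. \<rho> a v = smul (\<mu> a) v}"

definition weights ::
  "(complex^'n^'n) set \<Rightarrow> (complex \<Rightarrow> 'v \<Rightarrow> 'v) \<Rightarrow> (complex^'n^'n \<Rightarrow> 'v::ab_group_add \<Rightarrow> 'v) \<Rightarrow>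
     (complex^'n^'n \<Rightarrow> complex) set" where
  "weights T smul \<rho> = {\<mu> \<in> characters T. weight_space T smul \<rho> \<mu> \<noteq> {0}}"

definition weight_components ::
  "(complex^'n^'n) set \<Rightarrow> (complex \<Rightarrow> 'v \<Rightarrow> 'v) \<Rightarrow> (complex^'n^'n \<Rightarrow> 'v::ab_group_add \<Rightarrow> 'v) \<Rightarrow>
     'v \<Rightarrow> (complex^'n^'n \<Rightarrow> complex) \<Rightarrow> 'v" where
  "weight_components T smul \<rho> v =
     (THE c. c \<in> (\<Pi>\<^sub>E \<mu>\<in>weights T smul \<rho>. weight_space T smul \<rho> \<mu>) \<and>
        v = (\<Sum>\<mu>\<in>weights T smul \<rho>. c \<mu>))"


section \<open>Projective three-space\<close>

text \<open>A point of \<open>\<complex>\<P>\<^sup>3\<close> is a line through the origin of \<open>\<complex>\<^sup>4\<close> with the origin removed, i.e. the set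
  of all its homogeneous coordinate vectors. The union of a set of points is therefore its
  preimage in \<open>\<complex>\<^sup>4 - 0\<close>, and openness and holomorphy are those of the quotient map.\<close>

type_synonym point = "(complex^4) set"

definition hline :: "complex^4 \<Rightarrow> point" where
  "hline x = {t *s x | t. t \<noteq> 0}"

definition CP3 :: "point set" where
  "CP3 = hline ` (- {0})"

definition cp3_open :: "point set \<Rightarrow> bool" where
  "cp3_open W \<longleftrightarrow> W \<subseteq> CP3 \<and> open (\<Union>W)"

definition holo_on :: "(complex^'n \<Rightarrow> complex) \<Rightarrow> (complex^'n) set \<Rightarrow> bool" where
  "holo_on f S \<longleftrightarrow> (\<forall>x\<in>S. \<exists>f'. (f has_derivative f') (at x) \<and> (\<forall>c v. f' (c *s v) = c * f' v))"

definition cp3_holo :: "point set \<Rightarrow> (point \<Rightarrow> complex) \<Rightarrow> bool" where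
  "cp3_holo W f \<longleftrightarrow> holo_on (\<lambda>x. f (hline x)) (\<Union>W)"

definition holo_vec ::
  "(complex \<Rightarrow> 'v \<Rightarrow> 'v) \<Rightarrow> point set \<Rightarrow> (point \<Rightarrow> 'v::ab_group_add) \<Rightarrow> bool" where
  "holo_vec smul W f \<longleftrightarrow> (\<forall>\<phi>. linear_functional smul \<phi> \<longrightarrow> cp3_holo W (\<lambda>p. \<phi> (f p)))"

definition holo_group ::
  "(complex^'n^'n) set \<Rightarrow> point set \<Rightarrow> (point \<Rightarrow> complex^'n^'n) \<Rightarrow> bool" where
  "holo_group G W g \<longleftrightarrow> (\<forall>p\<in>W. g p \<in> G) \<and> (\<forall>i j. cp3_holo W (\<lambda>p. g p $ i $ j))"


section \<open>Holomorphic vector bundles\<close>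

text \<open>A bundle is given by its fibres (with their operations) and by its sheaf of holomorphic
  sections: \<open>vsec E W s\<close> says that s is a holomorphic section of E over the open set W. Values of s
  outside W are irrelevant. Local triviality identifies E over a neighbourhood with
  \<open>W \<times> \<complex>\<^sup>r\<close>, linearly on fibres and compatibly with holomorphic sections; this makes the fibres
  vector spaces and the total space a complex manifold.\<close>

record 'e vbundle =
  vfib :: "point \<Rightarrow> 'e set"
  vzero :: "point \<Rightarrow> 'e"
  vadd :: "point \<Rightarrow> 'e \<Rightarrow> 'e \<Rightarrow> 'e"
  vscl :: "point \<Rightarrow> complex \<Rightarrow> 'e \<Rightarrow> 'e"
  vsec :: "point set \<Rightarrow> (point \<Rightarrow> 'e) \<Rightarrow> bool"

definition local_condition :: "(point set \<Rightarrow> (point \<Rightarrow> 'e) \<Rightarrow> bool) \<Rightarrow> bool" where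
  "local_condition S \<longleftrightarrow> (\<forall>W s. cp3_open W \<longrightarrow>
     (S W s \<longleftrightarrow> (\<forall>p\<in>W. \<exists>W'. cp3_open W' \<and> p \<in> W' \<and> W' \<subseteq> W \<and> S W' s)))"

definition local_trivialization ::
  "'e vbundle \<Rightarrow> point set \<Rightarrow> nat \<Rightarrow> (point \<Rightarrow> 'e \<Rightarrow> nat \<Rightarrow> complex) \<Rightarrow> bool" where
  "local_trivialization E W r \<tau> \<longleftrightarrow>
     (\<forall>p\<in>W. bij_betw (\<tau> p) (vfib E p) {c. \<forall>i\<ge>r. c i = 0} \<and>
        vzero E p \<in> vfib E p \<and> \<tau> p (vzero E p) = (\<lambda>i. 0) \<and>
        (\<forall>a\<in>vfib E p. \<forall>b\<in>vfib E p. vadd E p a b \<in> vfib E p \<and>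
           \<tau> p (vadd E p a b) = (\<lambda>i. \<tau> p a i + \<tau> p b i)) \<and>
        (\<forall>t. \<forall>a\<in>vfib E p. vscl E p t a \<in> vfib E p \<and>
           \<tau> p (vscl E p t a) = (\<lambda>i. t * \<tau> p a i))) \<and>
     (\<forall>W' s. cp3_open W' \<and> W' \<subseteq> W \<longrightarrow>
        (vsec E W' s \<longleftrightarrow>
           (\<forall>p\<in>W'. s p \<in> vfib E p) \<and> (\<forall>i<r. cp3_holo W' (\<lambda>p. \<tau> p (s p) i))))"

definition vector_bundle :: "'e vbundle \<Rightarrow> bool" where
  "vector_bundle E \<longleftrightarrow> local_condition (vsec E) \<and>
     (\<forall>p\<in>CP3. \<exists>W r \<tau>. cp3_open W \<and> p \<in> W \<and> local_trivialization E W r \<tau>)"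

definition vb_iso ::
  "point set \<Rightarrow> 'e vbundle \<Rightarrow> 'f vbundle \<Rightarrow> (point \<Rightarrow> 'e \<Rightarrow> 'f) \<Rightarrow> bool" where
  "vb_iso B E F \<Phi> \<longleftrightarrow>
     (\<forall>p\<in>B. bij_betw (\<Phi> p) (vfib E p) (vfib F p) \<and>
        (\<forall>a\<in>vfib E p. \<forall>b\<in>vfib E p. \<Phi> p (vadd E p a b) = vadd F p (\<Phi> p a) (\<Phi> p b)) \<and>
        (\<forall>t. \<forall>a\<in>vfib E p. \<Phi> p (vscl E p t a) = vscl F p t (\<Phi> p a))) \<and>
     (\<forall>W s. cp3_open W \<and> W \<subseteq> B \<and> (\<forall>p\<in>W. s p \<in> vfib E p) \<longrightarrow>
        (vsec E W s \<longleftrightarrow> vsec F W (\<lambda>p. \<Phi> p (s p))))"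

definition trivial_vbundle :: "(complex \<Rightarrow> 'v \<Rightarrow> 'v) \<Rightarrow> 'v::ab_group_add vbundle" where
  "trivial_vbundle smul =
     \<lparr> vfib = (\<lambda>p. UNIV), vzero = (\<lambda>p. 0), vadd = (\<lambda>p. (+)), vscl = (\<lambda>p. smul),
       vsec = holo_vec smul \<rparr>"

text \<open>\<open>\<O>(d) \<otimes> F\<close> for a linear subspace F. The fibre of \<open>\<O>(d)\<close> at a line p consists of the functions on
  p minus the origin that are homogeneous of degree d (extended by zero), so that \<open>\<O>(-1)\<close> is
  tautological and a section of \<open>\<O>(d)\<close> is a homogeneous function of degree d on a cone. Tensoring
  with F allows the functions to take values in F.\<close>

definition twisted_fib ::
  "(complex \<Rightarrow> 'v \<Rightarrow> 'v) \<Rightarrow> int \<Rightarrow> 'v::ab_group_add set \<Rightarrow> point \<Rightarrow> (complex^4 \<Rightarrow> 'v) set" where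
  "twisted_fib smul d F p =
     {f. (\<forall>x\<in>p. f x \<in> F \<and> (\<forall>t. t \<noteq> 0 \<longrightarrow> f (t *s x) = smul (t powi d) (f x))) \<and>
         (\<forall>x. x \<notin> p \<longrightarrow> f x = 0)}"

definition twisted_bundle ::
  "(complex \<Rightarrow> 'v \<Rightarrow> 'v) \<Rightarrow> int \<Rightarrow> 'v::ab_group_add set \<Rightarrow> (complex^4 \<Rightarrow> 'v) vbundle" where
  "twisted_bundle smul d F =
     \<lparr> vfib = twisted_fib smul d F,
       vzero = (\<lambda>p x. 0), vadd = (\<lambda>p f g x. f x + g x), vscl = (\<lambda>p t f x. smul t (f x)),
       vsec = (\<lambda>W s. (\<forall>p\<in>W. s p \<in> twisted_fib smul d F p) \<and>
         (\<forall>\<phi>. linear_functional smul \<phi> \<longrightarrow> holo_on (\<lambda>x. \<phi> (s (hline x) x)) (\<Union>W))) \<rparr>"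

definition O_bundle :: "int \<Rightarrow> (complex^4 \<Rightarrow> complex) vbundle" where
  "O_bundle d = twisted_bundle (*) d UNIV"

definition pure_tensor ::
  "(complex \<Rightarrow> 'v \<Rightarrow> 'v) \<Rightarrow> (complex^4 \<Rightarrow> complex) \<Rightarrow> 'v \<Rightarrow> complex^4 \<Rightarrow> 'v" where
  "pure_tensor smul l v = (\<lambda>x. smul (l x) v)"

definition direct_sum :: "'i set \<Rightarrow> ('i \<Rightarrow> 'e vbundle) \<Rightarrow> ('i \<Rightarrow> 'e) vbundle" where
  "direct_sum I E =
     \<lparr> vfib = (\<lambda>p. \<Pi>\<^sub>E i\<in>I. vfib (E i) p), vzero = (\<lambda>p. \<lambda>i\<in>I. vzero (E i) p),
       vadd = (\<lambda>p a b. \<lambda>i\<in>I. vadd (E i) p (a i) (b i)),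
       vscl = (\<lambda>p t a. \<lambda>i\<in>I. vscl (E i) p t (a i)),
       vsec = (\<lambda>W s. (\<forall>p\<in>W. s p \<in> (\<Pi>\<^sub>E i\<in>I. vfib (E i) p)) \<and>
                     (\<forall>i\<in>I. vsec (E i) W (\<lambda>p. s p i))) \<rparr>"


section \<open>Holomorphic principal bundles and associated bundles\<close>

text \<open>Structure groups act on the right. A local holomorphic section is the same as a local
  trivialization: relative to one of them, the others are given by holomorphic maps to the group.\<close>

record ('h, 'e) pbundle =
  pfib :: "point \<Rightarrow> 'e set"
  pact :: "point \<Rightarrow> 'e \<Rightarrow> 'h \<Rightarrow> 'e"
  psec :: "point set \<Rightarrow> (point \<Rightarrow> 'e) \<Rightarrow> bool"

definition principal_bundle ::
  "(complex^'n^'n) set \<Rightarrow> (complex^'n^'n, 'e) pbundle \<Rightarrow> bool" where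
  "principal_bundle G P \<longleftrightarrow> local_condition (psec P) \<and>
     (\<forall>p\<in>CP3. pfib P p \<noteq> {} \<and>
        (\<forall>e\<in>pfib P p. bij_betw (pact P p e) G (pfib P p) \<and> pact P p e (mat 1) = e \<and>
           (\<forall>g\<in>G. \<forall>h\<in>G. pact P p e (g ** h) = pact P p (pact P p e g) h))) \<and>
     (\<forall>p\<in>CP3. \<exists>W e. cp3_open W \<and> p \<in> W \<and> (\<forall>x\<in>W. e x \<in> pfib P x) \<and>
        (\<forall>W' s. cp3_open W' \<and> W' \<subseteq> W \<longrightarrow>
           (psec P W' s \<longleftrightarrow>
              (\<exists>g. holo_group G W' g \<and> (\<forall>x\<in>W'. s x = pact P x (e x) (g x))))))"

definition pb_iso ::
  "(complex^'n^'n) set \<Rightarrow> point set \<Rightarrow> (complex^'n^'n, 'e) pbundle \<Rightarrow>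
     (complex^'n^'n, 'f) pbundle \<Rightarrow> (point \<Rightarrow> 'e \<Rightarrow> 'f) \<Rightarrow> bool" where
  "pb_iso G B P R \<Phi> \<longleftrightarrow>
     (\<forall>p\<in>B. bij_betw (\<Phi> p) (pfib P p) (pfib R p) \<and>
        (\<forall>e\<in>pfib P p. \<forall>g\<in>G. \<Phi> p (pact P p e g) = pact R p (\<Phi> p e) g)) \<and>
     (\<forall>W s. cp3_open W \<and> W \<subseteq> B \<and> (\<forall>p\<in>W. s p \<in> pfib P p) \<longrightarrow>
        (psec P W s \<longleftrightarrow> psec R W (\<lambda>p. \<Phi> p (s p))))"

definition trivial_pbundle :: "(complex^'n^'n) set \<Rightarrow> (complex^'n^'n, complex^'n^'n) pbundle" where
  "trivial_pbundle G = \<lparr> pfib = (\<lambda>p. G), pact = (\<lambda>p. (**)), psec = holo_group G \<rparr>"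

text \<open>The principal \<open>\<complex>\<^sup>*\<close>-bundle \<open>L\<^sup>\<times>\<close> of a line bundle L.\<close>

definition nonzero_vectors :: "'e vbundle \<Rightarrow> (complex, 'e) pbundle" where
  "nonzero_vectors L =
     \<lparr> pfib = (\<lambda>p. vfib L p - {vzero L p}), pact = (\<lambda>p l t. vscl L p t l),
       psec = (\<lambda>W s. vsec L W s \<and> (\<forall>p\<in>W. s p \<in> vfib L p - {vzero L p})) \<rparr>"

text \<open>The associated bundle \<open>P \<times>\<^sub>H F\<close> for a left action of H on F, with \<open>[e h, f] = [e, h f]\<close>.\<close>

definition assoc_rel ::
  "'h set \<Rightarrow> ('h \<Rightarrow> 'f \<Rightarrow> 'f) \<Rightarrow> 'f set \<Rightarrow> ('h, 'e) pbundle \<Rightarrow> point \<Rightarrow>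
     (('e \<times> 'f) \<times> ('e \<times> 'f)) set" where
  "assoc_rel H act F P p =
     {((e, f), (e', f')). e \<in> pfib P p \<and> e' \<in> pfib P p \<and> f \<in> F \<and> f' \<in> F \<and>
        (\<exists>h\<in>H. e = pact P p e' h \<and> f' = act h f)}"

definition assoc_class ::
  "'h set \<Rightarrow> ('h \<Rightarrow> 'f \<Rightarrow> 'f) \<Rightarrow> 'f set \<Rightarrow> ('h, 'e) pbundle \<Rightarrow> point \<Rightarrow> 'e \<Rightarrow> 'f \<Rightarrow> ('e \<times> 'f) set" where
  "assoc_class H act F P p e f = assoc_rel H act F P p `` {(e, f)}"

definition assoc_fib ::
  "'h set \<Rightarrow> ('h \<Rightarrow> 'f \<Rightarrow> 'f) \<Rightarrow> 'f set \<Rightarrow> ('h, 'e) pbundle \<Rightarrow> point \<Rightarrow> ('e \<times> 'f) set set" where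
  "assoc_fib H act F P p = (pfib P p \<times> F) // assoc_rel H act F P p"

text \<open>Holomorphic sections are locally of the form \<open>[e, f]\<close> with e a holomorphic section of P and f a
  holomorphic map to F; the latter notion is the argument \<open>hol\<close>.\<close>

definition assoc_sec ::
  "'h set \<Rightarrow> ('h \<Rightarrow> 'f \<Rightarrow> 'f) \<Rightarrow> 'f set \<Rightarrow> (point set \<Rightarrow> (point \<Rightarrow> 'f) \<Rightarrow> bool) \<Rightarrow>
     ('h, 'e) pbundle \<Rightarrow> point set \<Rightarrow> (point \<Rightarrow> ('e \<times> 'f) set) \<Rightarrow> bool" where
  "assoc_sec H act F hol P W s \<longleftrightarrow>
     (\<forall>p\<in>W. \<exists>W' e f. cp3_open W' \<and> p \<in> W' \<and> W' \<subseteq> W \<and> psec P W' e \<and> hol W' f \<and>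
        (\<forall>x\<in>W'. s x = assoc_class H act F P x (e x) (f x)))"

text \<open>Operations on classes: for \<open>e \<in> P\<^sub>p\<close>, \<open>[e,v] + [e,w] = [e, v + w]\<close> and \<open>t [e,v] = [e, t v]\<close>,
  written as images of representatives.\<close>

definition assoc_vbundle ::
  "(complex^'n^'n) set \<Rightarrow> (complex \<Rightarrow> 'v \<Rightarrow> 'v) \<Rightarrow> (complex^'n^'n \<Rightarrow> 'v::ab_group_add \<Rightarrow> 'v) \<Rightarrow>
     (complex^'n^'n, 'e) pbundle \<Rightarrow> ('e \<times> 'v) set vbundle" where
  "assoc_vbundle G smul \<rho> P =
     \<lparr> vfib = assoc_fib G \<rho> UNIV P,
       vzero = (\<lambda>p. {(e, 0) | e. e \<in> pfib P p}),
       vadd = (\<lambda>p a b. {(e, v + w) | e v w. (e, v) \<in> a \<and> (e, w) \<in> b}),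
       vscl = (\<lambda>p t a. {(e, smul t v) | e v. (e, v) \<in> a}),
       vsec = assoc_sec G \<rho> UNIV (holo_vec smul) P \<rparr>"

text \<open>Extension of the structure group of a \<open>\<complex>\<^sup>*\<close>-bundle P along \<open>\<lambda>\<close>: the G-bundle
  \<open>P \<times>\<^bsub>\<complex>\<^sup>*,\<lambda>\<^esub> G\<close>, where G acts by \<open>[l, a] g = [l, a g]\<close>.\<close>

definition extension_pbundle ::
  "(complex^'n^'n) set \<Rightarrow> (complex \<Rightarrow> complex^'n^'n) \<Rightarrow> (complex, 'e) pbundle \<Rightarrow>
     (complex^'n^'n, ('e \<times> (complex^'n^'n)) set) pbundle" where
  "extension_pbundle G lam P =
     \<lparr> pfib = assoc_fib (- {0}) (\<lambda>t a. lam t ** a) G P,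
       pact = (\<lambda>p c g. (\<lambda>(l, a). (l, a ** g)) ` c),
       psec = assoc_sec (- {0}) (\<lambda>t a. lam t ** a) G (holo_group G) P \<rparr>"


section \<open>Bundles on the gluing groupoid\<close>

text \<open>Bundles on the gluing groupoid of (CP3, Q): one bundle on each sheet and an isomorphism over
  \<open>CP3 - Q\<close> from the plus sheet to the minus sheet.\<close>

record ('e, 'f) glued_vbundle =
  vplus :: "'e vbundle"
  vminus :: "'f vbundle"
  vglue :: "point \<Rightarrow> 'e \<Rightarrow> 'f"

record ('h, 'e, 'f) glued_pbundle =
  pplus :: "('h, 'e) pbundle"
  pminus :: "('h, 'f) pbundle"
  pglue :: "point \<Rightarrow> 'e \<Rightarrow> 'f"

definition glued_vector_bundle :: "point set \<Rightarrow> ('e, 'f) glued_vbundle \<Rightarrow> bool" where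
  "glued_vector_bundle Q E \<longleftrightarrow> vector_bundle (vplus E) \<and> vector_bundle (vminus E) \<and>
     vb_iso (CP3 - Q) (vplus E) (vminus E) (vglue E)"

definition glued_principal_bundle ::
  "(complex^'n^'n) set \<Rightarrow> point set \<Rightarrow> (complex^'n^'n, 'e, 'f) glued_pbundle \<Rightarrow> bool" where
  "glued_principal_bundle G Q P \<longleftrightarrow> principal_bundle G (pplus P) \<and> principal_bundle G (pminus P) \<and>
     pb_iso G (CP3 - Q) (pplus P) (pminus P) (pglue P)"

definition glued_vb_iso ::
  "point set \<Rightarrow> ('e, 'f) glued_vbundle \<Rightarrow> ('a, 'b) glued_vbundle \<Rightarrow>
     (point \<Rightarrow> 'e \<Rightarrow> 'a) \<Rightarrow> (point \<Rightarrow> 'f \<Rightarrow> 'b) \<Rightarrow> bool" where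
  "glued_vb_iso Q E F \<Phi>p \<Phi>m \<longleftrightarrow> glued_vector_bundle Q E \<and> glued_vector_bundle Q F \<and>
     vb_iso CP3 (vplus E) (vplus F) \<Phi>p \<and> vb_iso CP3 (vminus E) (vminus F) \<Phi>m \<and>
     (\<forall>p \<in> CP3 - Q. \<forall>a \<in> vfib (vplus E) p. \<Phi>m p (vglue E p a) = vglue F p (\<Phi>p p a))"

definition assoc_glued ::
  "(complex^'n^'n) set \<Rightarrow> (complex \<Rightarrow> 'v \<Rightarrow> 'v) \<Rightarrow> (complex^'n^'n \<Rightarrow> 'v::ab_group_add \<Rightarrow> 'v) \<Rightarrow>
     (complex^'n^'n, 'e, 'f) glued_pbundle \<Rightarrow> (('e \<times> 'v) set, ('f \<times> 'v) set) glued_vbundle" where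
  "assoc_glued G smul \<rho> P =
     \<lparr> vplus = assoc_vbundle G smul \<rho> (pplus P),
       vminus = assoc_vbundle G smul \<rho> (pminus P),
       vglue = (\<lambda>p c. (\<lambda>(e, v). (pglue P p e, v)) ` c) \<rparr>"


section \<open>The sourced Ward bundle and the weight-decomposed bundle\<close>

text \<open>q is a holomorphic section of \<open>\<O>(2)\<close> with smooth zero scheme Q: the homogeneous function on
  \<open>\<complex>\<^sup>4 - 0\<close> given by q has nonzero differential at each of its zeros.\<close>

definition smooth_quadric :: "point set \<Rightarrow> (point \<Rightarrow> complex^4 \<Rightarrow> complex) \<Rightarrow> bool" where
  "smooth_quadric Q q \<longleftrightarrow> vsec (O_bundle 2) CP3 q \<and>
     Q = {p \<in> CP3. q p = vzero (O_bundle 2) p} \<and>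
     (\<forall>x. x \<noteq> 0 \<and> hline x \<in> Q \<longrightarrow>
        \<not> ((\<lambda>y. q (hline y) y) has_derivative (\<lambda>_. 0)) (at x))"

text \<open>The section \<open>q\<^sup>k\<close> of \<open>\<O>(2k)\<close> over the complement of Q.\<close>

definition section_power ::
  "(point \<Rightarrow> complex^4 \<Rightarrow> complex) \<Rightarrow> int \<Rightarrow> point \<Rightarrow> complex^4 \<Rightarrow> complex" where
  "section_power q k p = (\<lambda>x. if x \<in> p then q p x powi k else 0)"

text \<open>\<open>\<L>\<^sub>Q = \<O>(-Q)\<close>, identified with \<open>\<O>(-2)\<close> by q, so that \<open>q\<^sup>-\<^sup>1\<close> is a section of it.\<close>

definition L_Q :: "(complex^4 \<Rightarrow> complex) vbundle" where
  "L_Q = O_bundle (-2)"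

definition ward_bundle ::
  "(complex^'n^'n) set \<Rightarrow> (complex \<Rightarrow> complex^'n^'n) \<Rightarrow> (point \<Rightarrow> complex^4 \<Rightarrow> complex) \<Rightarrow>
     (complex^'n^'n, complex^'n^'n, ((complex^4 \<Rightarrow> complex) \<times> (complex^'n^'n)) set) glued_pbundle"
  where
  "ward_bundle G lam q =
     \<lparr> pplus = trivial_pbundle G,
       pminus = extension_pbundle G lam (nonzero_vectors L_Q),
       pglue = (\<lambda>p g. assoc_class (- {0}) (\<lambda>t a. lam t ** a) G (nonzero_vectors L_Q) p
                        (section_power q (-1) p) g) \<rparr>"

definition weight_bundle ::
  "(complex^'n^'n) set \<Rightarrow> (complex \<Rightarrow> 'v \<Rightarrow> 'v) \<Rightarrow> (complex^'n^'n \<Rightarrow> 'v::ab_group_add \<Rightarrow> 'v) \<Rightarrow>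
     (complex \<Rightarrow> complex^'n^'n) \<Rightarrow> (point \<Rightarrow> complex^4 \<Rightarrow> complex) \<Rightarrow>
     ('v, (complex^'n^'n \<Rightarrow> complex) \<Rightarrow> complex^4 \<Rightarrow> 'v) glued_vbundle" where
  "weight_bundle T smul \<rho> lam q =
     \<lparr> vplus = trivial_vbundle smul,
       vminus = direct_sum (weights T smul \<rho>)
         (\<lambda>\<mu>. twisted_bundle smul (- 2 * pairing \<mu> lam) (weight_space T smul \<rho> \<mu>)),
       vglue = (\<lambda>p v. \<lambda>\<mu>\<in>weights T smul \<rho>.
         pure_tensor smul (section_power q (- pairing \<mu> lam) p)
           (weight_components T smul \<rho> v \<mu>)) \<rparr>"

end

theory Submission
  imports Defs
begin

text \<open>Regular functions on a torus are spanned by characters, so by linear independence of characters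
  the representation splits as \<open>V = \<Oplus> V\<^sub>\<mu>\<close>. A nowhere vanishing local section l of \<open>L_Q\<close> gives the frame
  \<open>v \<mapsto> [[l, 1], v]\<close> of the associated bundle on the minus sheet and the frame
  \<open>v \<mapsto> \<Sum> l\<^bsup>k\<^esup> \<otimes> v\<^sub>\<mu>\<close>, \<open>k = \<langle>\<mu>, \<lambda>\<rangle>\<close>, of the weight-decomposed one. Replacing l by \<open>l t\<close> changes both by
  \<open>\<rho>(\<lambda>(t))\<close>, which acts on \<open>V\<^sub>\<mu>\<close> as \<open>t\<^bsup>k\<^esup>\<close>; hence matching the frames is independent of l and defines a
  global isomorphism. Over U one may take \<open>l = q\<^sup>-\<^sup>1\<close>, for which the frames are the gluing maps.\<close>

section \<open>Regular functions and characters\<close>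

text \<open>A torus comes with a parametrization of which only the matrix entries are given as
  regular, so pulling a regular function on \<open>T\<close> back to the split torus requires
  recovering the reciprocal of the determinant. After that the coordinate ring is one of Laurent
  polynomials, whose generators are themselves multiplicative. On the bundle side the obstacle is
  that O(-2) is nontrivial, so that \<open>l\<close> exists only locally. The isomorphism on the
  minus sheet is therefore defined fibre by fibre with an arbitrary choice of \<open>l\<close>, and
  its compatibility with holomorphic sections is tested on a cover. Since \<open>vb_iso\<close>
  speaks of sections over arbitrary open sets, sections must be known to restrict and to glue. With
  \<open>V\<close> itself as the model fibre of all four vector bundles, the two gluing maps and the
  two isomorphisms of sheets are all instances of one comparison of frames.\<close>

lemma regular_on_cong:
  "regular_on S D f \<Longrightarrow> (\<And>x. x \<in> D \<Longrightarrow> g x = f x) \<Longrightarrow> regular_on S D g"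
  by (auto simp: regular_on_def)

lemma regular_on_subset: "regular_on S D f \<Longrightarrow> D' \<subseteq> D \<Longrightarrow> regular_on S D' f"
  by (auto simp: regular_on_def)

lemma regular_on_gen: "f \<in> S \<Longrightarrow> regular_on S D f"
  by (auto simp: regular_on_def intro: function_algebra.gen)

lemma regular_on_const: "regular_on S D (\<lambda>_. c)"
  by (auto simp: regular_on_def intro: function_algebra.const)

lemma regular_on_add:
  assumes "regular_on S D f" "regular_on S D g"
  shows "regular_on S D (\<lambda>x. f x + g x)"
proof -
  obtain f' g' where "f' \<in> function_algebra S" "g' \<in> function_algebra S"
      "\<forall>x\<in>D. f x = f' x" "\<forall>x\<in>D. g x = g' x"
    using assms by (auto simp: regular_on_def)
  then show ?thesis
    unfolding regular_on_def by (intro bexI[of _ "\<lambda>x. f' x + g' x"]) (auto intro: function_algebra.add)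
qed

lemma regular_on_mult:
  assumes "regular_on S D f" "regular_on S D g"
  shows "regular_on S D (\<lambda>x. f x * g x)"
proof -
  obtain f' g' where "f' \<in> function_algebra S" "g' \<in> function_algebra S"
      "\<forall>x\<in>D. f x = f' x" "\<forall>x\<in>D. g x = g' x"
    using assms by (auto simp: regular_on_def)
  then show ?thesis
    unfolding regular_on_def by (intro bexI[of _ "\<lambda>x. f' x * g' x"]) (auto intro: function_algebra.mult)
qed

lemma regular_on_sum:
  "(\<And>i. i \<in> I \<Longrightarrow> regular_on S D (f i)) \<Longrightarrow> regular_on S D (\<lambda>x. \<Sum>i\<in>I. f i x)"
  by (induction I rule: infinite_finite_induct) (auto intro: regular_on_const regular_on_add)

lemma regular_on_prod:
  "(\<And>i. i \<in> I \<Longrightarrow> regular_on S D (f i)) \<Longrightarrow> regular_on S D (\<lambda>x. \<Prod>i\<in>I. f i x)"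
  by (induction I rule: infinite_finite_induct) (auto intro: regular_on_const regular_on_mult)

lemma regular_on_det:
  fixes M :: "'a \<Rightarrow> complex^'n^'n"
  assumes "\<And>i j. regular_on S D (\<lambda>x. M x $ i $ j)"
  shows "regular_on S D (\<lambda>x. det (M x))"
  unfolding det_def by (intro regular_on_sum regular_on_mult regular_on_prod regular_on_const assms)

text \<open>Precomposition with \<open>\<psi>\<close> respects constants, sums and products, so
  regularity has to be tested only on the generators in \<open>S'\<close>.\<close>

lemma regular_on_compose:
  assumes f: "regular_on S' D' f" and D: "\<And>x. x \<in> D \<Longrightarrow> \<psi> x \<in> D'"
    and gen: "\<And>s. s \<in> S' \<Longrightarrow> regular_on S D (\<lambda>x. s (\<psi> x))"
  shows "regular_on S D (\<lambda>x. f (\<psi> x))"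
proof -
  obtain h where h: "h \<in> function_algebra S'" "\<forall>x\<in>D'. f x = h x"
    using f by (auto simp: regular_on_def)
  from h(1) have "regular_on S D (\<lambda>x. h (\<psi> x))"
    by induction (auto intro: gen regular_on_const regular_on_add regular_on_mult)
  then show ?thesis
    by (rule regular_on_cong) (use h(2) D in auto)
qed

lemma regular_on_GL_compose:
  fixes \<psi> :: "'a \<Rightarrow> complex^'n^'n"
  assumes "regular_on GL_gens D' f" and "\<And>x. x \<in> D \<Longrightarrow> \<psi> x \<in> D'"
    and "\<And>i j. regular_on S D (\<lambda>x. \<psi> x $ i $ j)"
    and "regular_on S D (\<lambda>x. inverse (det (\<psi> x)))"
  shows "regular_on S D (\<lambda>x. f (\<psi> x))"
  by (rule regular_on_compose[OF assms(1)]) (use assms in \<open>auto simp: GL_gens_def\<close>)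

section \<open>Matrix inversion as a regular map\<close>

lemma det_nonzero_GL: "A \<in> GL \<longleftrightarrow> det A \<noteq> 0"
  by (simp add: GL_def invertible_det_nz)

lemma matrix_inv_GL:
  assumes "A \<in> GL"
  shows "A ** matrix_inv A = mat 1" "matrix_inv A ** A = mat 1"
  using assms someI_ex[of "\<lambda>A'. A ** A' = mat 1 \<and> A' ** A = mat 1"]
  by (auto simp: GL_def invertible_def matrix_inv_def)

text \<open>Cramer's rule for the linear system whose solution is column \<open>j\<close> of the
  inverse. The numerator is a polynomial in the entries of \<open>A\<close>, so the right-hand side
  is visibly regular.\<close>

lemma matrix_inv_entry:
  fixes A :: "complex^'n^'n"
  assumes "A \<in> GL"
  shows "matrix_inv A $ i $ j =
    det (\<chi> a b. if b = i then (if a = j then 1 else 0) else A $ a $ b) * inverse (det A)"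
proof -
  define x where "x = matrix_inv A *v axis j 1"
  have "A *v x = axis j 1"
    using matrix_inv_GL[OF assms] by (simp add: x_def matrix_vector_mul_assoc)
  then have "x = (\<chi> k. det (\<chi> a b. if b = k then axis j 1 $ a else A $ a $ b) / det A)"
    using cramer[of A x "axis j 1"] assms det_nonzero_GL by blast
  then have "x $ i = det (\<chi> a b. if b = i then axis j 1 $ a else A $ a $ b) / det A"
    by simp
  moreover have "x $ i = matrix_inv A $ i $ j"
    by (simp add: x_def matrix_vector_mult_def axis_def if_distrib cong: if_cong)
  moreover have "(\<chi> a b. if b = i then axis j 1 $ a else A $ a $ b) =
      (\<chi> a b. if b = i then (if a = j then 1 else 0) else A $ a $ b)"
    by (simp add: vec_eq_iff axis_def)
  ultimately show ?thesis
    by (simp add: field_simps)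
qed

lemma regular_on_entry: "regular_on GL_gens D (\<lambda>A. A $ i $ j)"
  by (rule regular_on_gen) (auto simp: GL_gens_def)

lemma regular_on_inverse_det: "regular_on GL_gens D (\<lambda>A. inverse (det A))"
  by (rule regular_on_gen) (auto simp: GL_gens_def)

lemma regular_on_matrix_inv_entry: "regular_on GL_gens GL (\<lambda>A. matrix_inv A $ i $ j)"
proof (rule regular_on_cong[OF _ matrix_inv_entry])
  show "regular_on GL_gens GL (\<lambda>A. det (\<chi> a b. if b = i then if a = j then 1 else 0 else A $ a $ b)
      * inverse (det A))"
  proof (intro regular_on_mult regular_on_det regular_on_inverse_det)
    show "regular_on GL_gens GL
        (\<lambda>A. (\<chi> a b. if b = i then if a = j then 1 else 0 else A $ a $ b) $ k $ l)" for k l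
      by (cases "l = i"; cases "k = j") (auto simp: regular_on_entry regular_on_const)
  qed
qed

text \<open>Inversion has regular entries by Cramer's rule, and the remaining generator, the
  reciprocal of the determinant, is turned by inversion into the determinant itself.\<close>

lemma regular_on_matrix_inv:
  assumes f: "regular_on GL_gens D f" and D: "D \<subseteq> GL" "\<And>A. A \<in> D \<Longrightarrow> matrix_inv A \<in> D"
  shows "regular_on GL_gens D (\<lambda>A. f (matrix_inv A))"
proof (rule regular_on_GL_compose[OF f D(2)])
  show "regular_on GL_gens D (\<lambda>x. matrix_inv x $ i $ j)" for i j
    using regular_on_matrix_inv_entry D(1) by (rule regular_on_subset)
  have "inverse (det (matrix_inv A)) = det A" if "A \<in> GL" for A :: "complex^'n^'n"
  proof (rule inverse_unique)
    show "det (matrix_inv A) * det A = 1"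
      by (metis that matrix_inv_GL(2) det_mul det_I)
  qed
  then have "inverse (det (matrix_inv A)) = det A" if "A \<in> D" for A
    using D(1) that by blast
  with regular_on_det[OF regular_on_entry]
  show "regular_on GL_gens D (\<lambda>A. inverse (det (matrix_inv A)))"
    by (rule regular_on_cong)
qed

text \<open>Artin's argument, by induction on \<open>X\<close>. Only a product \<open>m\<close>
  under which \<open>D\<close> is closed enters. The members of \<open>X\<close> are total
  functions, while everything is known on \<open>D\<close> alone; \<open>distinct\<close> bridges
  the two notions of equality.\<close>

lemma characters_independent:
  fixes X :: "('a \<Rightarrow> complex) set"
  assumes "finite X"
    and closed: "\<And>a b. a \<in> D \<Longrightarrow> b \<in> D \<Longrightarrow> m a b \<in> D"
    and "D \<noteq> {}"
    and mult: "\<And>\<xi> a b. \<xi> \<in> X \<Longrightarrow> a \<in> D \<Longrightarrow> b \<in> D \<Longrightarrow> \<xi> (m a b) = \<xi> a * \<xi> b"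
    and nz: "\<And>\<xi> a. \<xi> \<in> X \<Longrightarrow> a \<in> D \<Longrightarrow> \<xi> a \<noteq> 0"
    and distinct: "\<And>\<xi> \<xi>'. \<xi> \<in> X \<Longrightarrow> \<xi>' \<in> X \<Longrightarrow> (\<And>a. a \<in> D \<Longrightarrow> \<xi> a = \<xi>' a) \<Longrightarrow> \<xi> = \<xi>'"
    and zero: "\<And>a. a \<in> D \<Longrightarrow> (\<Sum>\<xi>\<in>X. c \<xi> * \<xi> a) = 0"
    and "\<xi> \<in> X"
  shows "c \<xi> = 0"
  using assms(1) mult nz distinct zero \<open>\<xi> \<in> X\<close>
proof (induction X arbitrary: c \<xi> rule: finite_induct)
  case (insert \<psi> X)
  have c0: "c \<xi> = 0" if "\<xi> \<in> X" for \<xi>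
  proof -
    have "\<exists>b\<in>D. \<xi> b \<noteq> \<psi> b"
      using insert.prems(3)[of \<xi> \<psi>] insert.hyps(2) that by blast
    then obtain b where b: "b \<in> D" "\<xi> b \<noteq> \<psi> b" by blast
    \<comment> \<open>Translating the relation by \<open>b\<close> and subtracting
      \<open>\<psi> b\<close> times the original one cancels the term of \<open>\<psi>\<close> and
      multiplies the coefficient of every other \<open>\<xi>\<close> by
      \<open>\<xi> b - \<psi> b\<close>.\<close>
    have z: "(\<Sum>\<xi>\<in>X. (c \<xi> * (\<xi> b - \<psi> b)) * \<xi> a) = 0" if a: "a \<in> D" for a
    proof -
      have "(\<Sum>\<xi>\<in>insert \<psi> X. c \<xi> * \<xi> (m b a)) - \<psi> b * (\<Sum>\<xi>\<in>insert \<psi> X. c \<xi> * \<xi> a) = 0"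
        using insert.prems(4) closed a b by simp
      moreover have "(\<Sum>\<xi>\<in>insert \<psi> X. c \<xi> * \<xi> (m b a)) = (\<Sum>\<xi>\<in>insert \<psi> X. c \<xi> * (\<xi> b * \<xi> a))"
        using insert.prems(1) a b by (intro sum.cong) auto
      ultimately have "(\<Sum>\<xi>\<in>insert \<psi> X. (c \<xi> * (\<xi> b - \<psi> b)) * \<xi> a) = 0"
        by (simp add: sum_distrib_left sum_subtractf algebra_simps del: sum.insert)
      then show ?thesis
        using insert.hyps by simp
    qed
    have "c \<xi> * (\<xi> b - \<psi> b) = 0"
      by (rule insert.IH[OF _ _ _ z that]) (use insert.prems(1-3) in auto)
    then show ?thesis
      using b by simp
  qed
  obtain a where "a \<in> D" using \<open>D \<noteq> {}\<close> by blast
  then have "c \<psi> * \<psi> a = 0"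
    using insert.prems(4)[of a] insert.hyps c0 by simp
  then have "c \<psi> = 0"
    using insert.prems(2) \<open>a \<in> D\<close> by auto
  then show ?case
    using c0 insert.prems(5) by auto
qed simp

text \<open>The set \<open>C\<close> is a parameter because three kinds of characters occur: those
  of \<open>T\<close>, their counterparts on the split torus, and the integral powers on the nonzero
  complex numbers.\<close>

definition char_span :: "'a set \<Rightarrow> ('a \<Rightarrow> complex) set \<Rightarrow> ('a \<Rightarrow> complex) \<Rightarrow> bool" where
  "char_span D C f \<longleftrightarrow> (\<exists>X c. finite X \<and> X \<subseteq> C \<and> (\<forall>a\<in>D. f a = (\<Sum>\<xi>\<in>X. c \<xi> * \<xi> a)))"

lemma char_span_cong: "char_span D C f \<Longrightarrow> (\<And>a. a \<in> D \<Longrightarrow> g a = f a) \<Longrightarrow> char_span D C g"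
  by (auto simp: char_span_def)

lemma char_span_char: "\<xi> \<in> C \<Longrightarrow> char_span D C (\<lambda>a. c * \<xi> a)"
  unfolding char_span_def by (intro exI[of _ "{\<xi>}"] exI[of _ "\<lambda>_. c"]) auto

lemma char_span_add:
  assumes "char_span D C f" "char_span D C g"
  shows "char_span D C (\<lambda>a. f a + g a)"
proof -
  obtain X c where X: "finite X" "X \<subseteq> C" "\<forall>a\<in>D. f a = (\<Sum>\<xi>\<in>X. c \<xi> * \<xi> a)"
    using assms(1) unfolding char_span_def by blast
  obtain Y d where Y: "finite Y" "Y \<subseteq> C" "\<forall>a\<in>D. g a = (\<Sum>\<xi>\<in>Y. d \<xi> * \<xi> a)"
    using assms(2) unfolding char_span_def by blast
  note * = X Y
  \<comment> \<open>Both families of coefficients are extended by zero to the union of the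
    supports.\<close>
  have "f a + g a = (\<Sum>\<xi>\<in>X \<union> Y. ((if \<xi> \<in> X then c \<xi> else 0) + (if \<xi> \<in> Y then d \<xi> else 0)) * \<xi> a)"
    if "a \<in> D" for a
  proof -
    have "f a = (\<Sum>\<xi>\<in>X \<union> Y. (if \<xi> \<in> X then c \<xi> else 0) * \<xi> a)"
      unfolding *(3)[rule_format, OF that] using *(1,4) by (intro sum.mono_neutral_cong_left) auto
    moreover have "g a = (\<Sum>\<xi>\<in>X \<union> Y. (if \<xi> \<in> Y then d \<xi> else 0) * \<xi> a)"
      unfolding *(6)[rule_format, OF that] using *(1,4) by (intro sum.mono_neutral_cong_left) auto
    ultimately show ?thesis
      by (simp only: sum.distrib distrib_right)
  qed
  with * show ?thesis
    unfolding char_span_def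
    by (intro exI[of _ "X \<union> Y"]
          exI[of _ "\<lambda>\<xi>. (if \<xi> \<in> X then c \<xi> else 0) + (if \<xi> \<in> Y then d \<xi> else 0)"]) blast
qed

lemma char_span_sum:
  "(\<And>i. i \<in> I \<Longrightarrow> char_span D C (f i)) \<Longrightarrow> char_span D C (\<lambda>a. \<Sum>i\<in>I. f i a)"
proof (induction I rule: infinite_finite_induct)
  case empty
  show ?case
    unfolding char_span_def by (intro exI[of _ "{}"]) auto
next
  case (infinite I)
  then show ?case
    unfolding char_span_def by (intro exI[of _ "{}"]) auto
qed (auto intro: char_span_add)

text \<open>Different members of \<open>C'\<close> may pull back to the same member of
  \<open>C\<close>, so the combination is treated as a sum of one-term combinations rather than by
  reindexing its support.\<close>

lemma char_span_bind:
  assumes "char_span D' C' f" "\<And>a. a \<in> D \<Longrightarrow> \<psi> a \<in> D'"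
    and "\<And>\<xi>. \<xi> \<in> C' \<Longrightarrow> \<exists>\<xi>'\<in>C. \<forall>a\<in>D. \<xi>' a = \<xi> (\<psi> a)"
  shows "char_span D C (\<lambda>a. f (\<psi> a))"
proof -
  obtain X c where X: "finite X" "X \<subseteq> C'" "\<forall>a\<in>D'. f a = (\<Sum>\<xi>\<in>X. c \<xi> * \<xi> a)"
    using assms(1) by (auto simp: char_span_def)
  have "char_span D C (\<lambda>a. \<Sum>\<xi>\<in>X. c \<xi> * \<xi> (\<psi> a))"
  proof (rule char_span_sum)
    fix \<xi> assume "\<xi> \<in> X"
    then obtain \<xi>' where "\<xi>' \<in> C" "\<forall>a\<in>D. \<xi>' a = \<xi> (\<psi> a)"
      using assms(3) X(2) by blast
    then show "char_span D C (\<lambda>a. c \<xi> * \<xi> (\<psi> a))"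
      by (intro char_span_cong[OF char_span_char[of \<xi>' C D "c \<xi>"]]) auto
  qed
  then show ?thesis
    by (rule char_span_cong) (use X(3) assms(2) in auto)
qed

lemma char_span_mult:
  assumes f: "char_span D C f" and g: "char_span D C g"
    and C: "\<And>\<xi> \<xi>'. \<xi> \<in> C \<Longrightarrow> \<xi>' \<in> C \<Longrightarrow> \<exists>\<xi>''\<in>C. \<forall>a\<in>D. \<xi>'' a = \<xi> a * \<xi>' a"
  shows "char_span D C (\<lambda>a. f a * g a)"
proof -
  obtain X c where X: "finite X" "X \<subseteq> C" "\<forall>a\<in>D. f a = (\<Sum>\<xi>\<in>X. c \<xi> * \<xi> a)"
    using f unfolding char_span_def by blast
  obtain Y d where Y: "finite Y" "Y \<subseteq> C" "\<forall>a\<in>D. g a = (\<Sum>\<xi>\<in>Y. d \<xi> * \<xi> a)"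
    using g unfolding char_span_def by blast
  note * = X Y
  have "char_span D C (\<lambda>a. \<Sum>\<xi>\<in>X. \<Sum>\<xi>'\<in>Y. (c \<xi> * \<xi> a) * (d \<xi>' * \<xi>' a))"
  proof (intro char_span_sum)
    fix \<xi> \<xi>' assume "\<xi> \<in> X" "\<xi>' \<in> Y"
    then obtain \<xi>'' where "\<xi>'' \<in> C" "\<forall>a\<in>D. \<xi>'' a = \<xi> a * \<xi>' a"
      using * C by blast
    then show "char_span D C (\<lambda>a. c \<xi> * \<xi> a * (d \<xi>' * \<xi>' a))"
      by (intro char_span_cong[OF char_span_char[of \<xi>'' C D "c \<xi> * d \<xi>'"]]) auto
  qed
  then show ?thesis
    by (rule char_span_cong) (use * in \<open>simp add: sum_product\<close>)
qed

text \<open>If \<open>C\<close> is closed under products on \<open>D\<close>, its span is an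
  algebra. It contains the constants through the trivial character, so it suffices that the
  generators lie in \<open>C\<close>.\<close>

lemma char_span_regular:
  assumes "regular_on S D f"
    and C: "\<And>\<xi> \<xi>'. \<xi> \<in> C \<Longrightarrow> \<xi>' \<in> C \<Longrightarrow> \<exists>\<xi>''\<in>C. \<forall>a\<in>D. \<xi>'' a = \<xi> a * \<xi>' a"
    and one: "\<exists>\<xi>\<in>C. \<forall>a\<in>D. \<xi> a = 1"
    and S: "\<And>s. s \<in> S \<Longrightarrow> \<exists>\<xi>\<in>C. \<forall>a\<in>D. \<xi> a = s a"
  shows "char_span D C f"
proof -
  obtain h where h: "h \<in> function_algebra S" "\<forall>x\<in>D. f x = h x"
    using assms(1) by (auto simp: regular_on_def)
  from h(1) have "char_span D C h"
  proof induction
    case (gen s)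
    then obtain \<xi> where "\<xi> \<in> C" "\<forall>a\<in>D. \<xi> a = s a" using S by blast
    then show ?case
      by (intro char_span_cong[OF char_span_char[of \<xi> C D 1]]) auto
  next
    case (const c)
    obtain \<xi> where "\<xi> \<in> C" "\<forall>a\<in>D. \<xi> a = 1" using one by blast
    then show ?case
      by (intro char_span_cong[OF char_span_char[of \<xi> C D c]]) auto
  next
    case (add f g)
    then show ?case by (intro char_span_add)
  next
    case (mult f g)
    then show ?case by (intro char_span_mult C)
  qed
  then show ?thesis
    by (rule char_span_cong) (use h in auto)
qed

section \<open>The character group and the coordinate ring of a torus\<close>

lemma algebraic_group_GL: "algebraic_group G \<Longrightarrow> G \<subseteq> GL"
  by (auto simp: algebraic_group_def zariski_closed_def)

lemma algebraic_group_closed: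
  assumes "algebraic_group G"
  shows "mat 1 \<in> G" "A \<in> G \<Longrightarrow> A' \<in> G \<Longrightarrow> A ** A' \<in> G" "A \<in> G \<Longrightarrow> matrix_inv A \<in> G"
  using assms by (auto simp: algebraic_group_def)

lemma characters_mult:
  assumes "\<mu> \<in> characters T" "\<nu> \<in> characters T" "algebraic_group T"
  shows "(\<lambda>a\<in>T. \<mu> a * \<nu> a) \<in> characters T"
proof -
  have "regular_on GL_gens T (\<lambda>a\<in>T. \<mu> a * \<nu> a)"
    by (rule regular_on_cong[OF regular_on_mult[of _ _ \<mu> \<nu>]]) (use assms in \<open>auto simp: characters_def\<close>)
  then show ?thesis
    using assms by (auto simp: characters_def algebraic_group_closed)
qed

lemma characters_one: "algebraic_group T \<Longrightarrow> (\<lambda>a\<in>T. 1) \<in> characters T"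
  using regular_on_cong[OF regular_on_const[of GL_gens T 1], of "\<lambda>a\<in>T. 1"]
  by (auto simp: characters_def algebraic_group_closed)

text \<open>The reciprocal of \<open>\<mu>\<close> is \<open>\<mu>\<close> composed with matrix
  inversion, which yields its regularity.\<close>

lemma characters_inverse:
  assumes \<mu>: "\<mu> \<in> characters T" and T: "algebraic_group T"
  shows "(\<lambda>a\<in>T. inverse (\<mu> a)) \<in> characters T"
proof -
  have mult: "\<mu> (a ** b) = \<mu> a * \<mu> b" and nz: "\<mu> a \<noteq> 0" if "a \<in> T" "b \<in> T" for a b
    using \<mu> that by (auto simp: characters_def)
  have "\<mu> (mat 1) * \<mu> (mat 1) = \<mu> (mat 1)"
    using mult[of "mat 1" "mat 1"] algebraic_group_closed(1)[OF T] by simp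
  then have one: "\<mu> (mat 1) = 1"
    using nz[of "mat 1"] algebraic_group_closed(1)[OF T] by simp
  have inv: "\<mu> (matrix_inv a) = inverse (\<mu> a)" if "a \<in> T" for a
  proof (rule inverse_unique[symmetric])
    have "a \<in> GL" using algebraic_group_GL[OF T] that by blast
    then show "\<mu> a * \<mu> (matrix_inv a) = 1"
      using mult[OF that algebraic_group_closed(3)[OF T that]] matrix_inv_GL(1)[of a] one by simp
  qed
  have "regular_on GL_gens T (\<lambda>a. \<mu> (matrix_inv a))"
    using \<mu> by (intro regular_on_matrix_inv algebraic_group_GL algebraic_group_closed(3) T)
      (simp_all add: characters_def)
  then have "regular_on GL_gens T (\<lambda>a\<in>T. inverse (\<mu> a))"
    by (rule regular_on_cong) (simp add: inv)
  then show ?thesis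
    using mult nz by (simp add: characters_def algebraic_group_closed[OF T])
qed

text \<open>The coordinate ring has no generator for the determinant's inverse along \<open>\<psi>\<close>; it is recovered as
  the determinant of \<open>\<psi>\<close> at the inverse point.\<close>

lemma regular_on_GL_compose_hom:
  fixes \<psi> :: "'a \<Rightarrow> complex^'n^'n"
  assumes f: "regular_on GL_gens D' f" and D': "\<And>x. x \<in> D \<Longrightarrow> \<psi> x \<in> D'"
    and reg: "\<And>i j. regular_on S D (\<lambda>x. \<psi> x $ i $ j)"
    and inv: "\<And>x. x \<in> D \<Longrightarrow> \<iota> x \<in> D" "\<And>x. x \<in> D \<Longrightarrow> \<psi> (\<iota> x) ** \<psi> x = mat 1"
    and S: "\<And>s. s \<in> S \<Longrightarrow> regular_on S D (\<lambda>x. s (\<iota> x))"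
  shows "regular_on S D (\<lambda>x. f (\<psi> x))"
proof (rule regular_on_GL_compose[OF f D' reg])
  have "inverse (det (\<psi> x)) = det (\<psi> (\<iota> x))" if "x \<in> D" for x
  proof -
    have "det (\<psi> (\<iota> x)) * det (\<psi> x) = 1"
      using inv(2)[OF that] det_mul[of "\<psi> (\<iota> x)" "\<psi> x"] by simp
    then show ?thesis
      by (metis inverse_unique mult.commute)
  qed
  moreover have "regular_on S D (\<lambda>x. det (\<psi> (\<iota> x)))"
    by (rule regular_on_compose[where D' = D and f = "\<lambda>x. det (\<psi> x)"])
      (use inv(1) S in \<open>auto intro: regular_on_det reg\<close>)
  ultimately show "regular_on S D (\<lambda>x. inverse (det (\<psi> x)))"
    by (simp add: regular_on_def)
qed

text \<open>Parametrizations of tori and cocharacters are only required to be multiplicative; this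
  supplies that they preserve the unit.\<close>

lemma GL_idempotent:
  assumes "A ** A = A" "A \<in> GL"
  shows "A = mat 1"
  by (metis assms matrix_inv_GL(2) matrix_mul_assoc matrix_mul_lid)

text \<open>The function is pulled back to the split torus, where the generators of the coordinate
  ring are the coordinates and their reciprocals. The resulting combination is carried back by the
  inverse parametrization \<open>\<psi>\<close>, whose coordinates are regular by the definition of
  a torus.\<close>

lemma torus_regular_char_span:
  fixes T :: "(complex^'n^'n) set"
  assumes T: "torus T" and f: "regular_on GL_gens T f"
  shows "char_span T (characters T) f"
proof -
  have alg: "algebraic_group T"
    using T by (simp add: torus_def)
  obtain r \<phi> where bij: "bij_betw \<phi> (split_torus r) T"
    and hom: "\<And>s t. s \<in> split_torus r \<Longrightarrow> t \<in> split_torus r \<Longrightarrow> \<phi> (\<lambda>i. s i * t i) = \<phi> s ** \<phi> t"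
    and reg: "\<And>i j. regular_on (split_torus_gens r) (split_torus r) (\<lambda>t. \<phi> t $ i $ j)"
    and reg': "\<And>i. i < r \<Longrightarrow> regular_on GL_gens T (\<lambda>A. inv_into (split_torus r) \<phi> A i)"
    using T unfolding torus_def by blast
  define \<psi> where "\<psi> = inv_into (split_torus r) \<phi>"
  have \<psi>: "\<psi> a \<in> split_torus r" "\<phi> (\<psi> a) = a" if "a \<in> T" for a
    using bij that unfolding \<psi>_def
    by (auto simp: bij_betw_def f_inv_into_f intro: inv_into_into)
  have \<phi>: "\<psi> (\<phi> t) = t" "\<phi> t \<in> T" if "t \<in> split_torus r" for t
    using bij that unfolding \<psi>_def by (auto simp: bij_betw_def)
  have \<psi>_mult: "\<psi> (a ** b) = (\<lambda>i. \<psi> a i * \<psi> b i)" if "a \<in> T" "b \<in> T" for a b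
  proof -
    have "(\<lambda>i. \<psi> a i * \<psi> b i) \<in> split_torus r"
      using \<psi>(1)[OF that(1)] \<psi>(1)[OF that(2)] by (auto simp: split_torus_def)
    then show ?thesis
      using \<phi>(1)[of "\<lambda>i. \<psi> a i * \<psi> b i"] hom[of "\<psi> a" "\<psi> b"] \<psi> that by simp
  qed
  have \<phi>1: "\<phi> (\<lambda>_. 1) = mat 1"
  proof (rule GL_idempotent)
    have "(\<lambda>_. 1) \<in> split_torus r" by (simp add: split_torus_def)
    then show "\<phi> (\<lambda>_. 1) ** \<phi> (\<lambda>_. 1) = \<phi> (\<lambda>_. 1)" "\<phi> (\<lambda>_. 1) \<in> GL"
      using hom[of "\<lambda>_. 1" "\<lambda>_. 1"] \<phi>(2) algebraic_group_GL[OF alg] by auto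
  qed
  have f\<phi>: "regular_on (split_torus_gens r) (split_torus r) (\<lambda>t. f (\<phi> t))"
  proof (rule regular_on_GL_compose_hom[OF f \<phi>(2) reg, where \<iota> = "\<lambda>t i. inverse (t i)"])
    fix t assume t: "t \<in> split_torus r"
    then show t': "(\<lambda>i. inverse (t i)) \<in> split_torus r"
      by (simp add: split_torus_def)
    have "(\<lambda>i. inverse (t i) * t i) = (\<lambda>_. 1)"
      using t by (auto simp: split_torus_def)
    then show "\<phi> (\<lambda>i. inverse (t i)) ** \<phi> t = mat 1"
      using hom[OF t' t] \<phi>1 by simp
  next
    fix s assume "s \<in> split_torus_gens r"
    then have "(\<lambda>t. s (\<lambda>i. inverse (t i))) \<in> split_torus_gens r"
      by (fastforce simp: split_torus_gens_def)
    then show "regular_on (split_torus_gens r) (split_torus r) (\<lambda>t. s (\<lambda>i. inverse (t i)))"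
      by (rule regular_on_gen)
  qed
  \<comment> \<open>Functions on the split torus are called characters when their transport to
    \<open>T\<close> is one, so no separate notion of character for the split torus is introduced.
    The restriction to \<open>T\<close> accounts for the extensionality in
    \<open>characters\<close>.\<close>
  define C where "C = {\<xi>. (\<lambda>a\<in>T. \<xi> (\<psi> a)) \<in> characters T}"
  have coord: "(\<lambda>t. t i) \<in> C" if "i < r" for i
  proof -
    have "regular_on GL_gens T (\<lambda>a\<in>T. \<psi> a i)"
      by (rule regular_on_cong[OF reg'[OF that]]) (simp add: \<psi>_def)
    then show ?thesis
      using \<psi>_mult \<psi>(1) by (auto simp: C_def characters_def split_torus_def algebraic_group_closed[OF alg])
  qed
  have C_mult: "(\<lambda>t. \<xi> t * \<xi>' t) \<in> C" if "\<xi> \<in> C" "\<xi>' \<in> C" for \<xi> \<xi>'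
  proof -
    have "(\<lambda>a\<in>T. \<xi> (\<psi> a) * \<xi>' (\<psi> a)) = (\<lambda>a\<in>T. (\<lambda>a\<in>T. \<xi> (\<psi> a)) a * (\<lambda>a\<in>T. \<xi>' (\<psi> a)) a)"
      by auto
    then show ?thesis
      using characters_mult[OF _ _ alg, of "\<lambda>a\<in>T. \<xi> (\<psi> a)" "\<lambda>a\<in>T. \<xi>' (\<psi> a)"] that
      by (simp add: C_def)
  qed
  have coord': "(\<lambda>t. inverse (t i)) \<in> C" if "i < r" for i
  proof -
    have "(\<lambda>a\<in>T. inverse (\<psi> a i)) = (\<lambda>a\<in>T. inverse ((\<lambda>a\<in>T. \<psi> a i) a))"
      by auto
    then show ?thesis
      using characters_inverse[OF _ alg, of "\<lambda>a\<in>T. \<psi> a i"] coord[OF that]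
      by (simp add: C_def)
  qed
  have "char_span (split_torus r) C (\<lambda>t. f (\<phi> t))"
  proof (rule char_span_regular[OF f\<phi>])
    show "\<exists>\<xi>''\<in>C. \<forall>a\<in>split_torus r. \<xi>'' a = \<xi> a * \<xi>' a" if "\<xi> \<in> C" "\<xi>' \<in> C" for \<xi> \<xi>'
      using C_mult[OF that] by (intro bexI[of _ "\<lambda>t. \<xi> t * \<xi>' t"]) auto
    show "\<exists>\<xi>\<in>C. \<forall>a\<in>split_torus r. \<xi> a = 1"
      using characters_one[OF alg] by (intro bexI[of _ "\<lambda>_. 1"]) (auto simp: C_def)
    show "\<exists>\<xi>\<in>C. \<forall>a\<in>split_torus r. \<xi> a = s a" if "s \<in> split_torus_gens r" for s
      using that coord coord' by (intro bexI[of _ s]) (auto simp: split_torus_gens_def)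
  qed
  then have "char_span T (characters T) (\<lambda>a. f (\<phi> (\<psi> a)))"
  proof (rule char_span_bind)
    show "\<exists>\<xi>'\<in>characters T. \<forall>a\<in>T. \<xi>' a = \<xi> (\<psi> a)" if "\<xi> \<in> C" for \<xi>
      using that by (intro bexI[of _ "\<lambda>a\<in>T. \<xi> (\<psi> a)"]) (auto simp: C_def)
  qed (use \<psi> in auto)
  then show ?thesis
    by (rule char_span_cong) (simp add: \<psi>)
qed

section \<open>Cocharacters and the integral pairing\<close>

lemma cocharacter_one:
  assumes "cocharacter T lam" "algebraic_group T"
  shows "lam 1 = mat 1"
proof (rule GL_idempotent)
  have "lam s ** lam t = lam (s * t)" "lam t \<in> T" if "s \<noteq> 0" "t \<noteq> 0" for s t
    using assms(1) that by (simp_all add: cocharacter_def)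
  from this[of 1 1] show "lam 1 ** lam 1 = lam 1" "lam 1 \<in> GL"
    using algebraic_group_GL[OF assms(2)] by auto
qed

text \<open>The powers of 2 are pairwise distinct, so evaluation at this one point determines an
  exponent.\<close>

lemma powi_2_inject:
  assumes "(2::complex) powi k = 2 powi l"
  shows "k = l"
proof -
  have "(of_real (2 powi k) :: complex) = of_real (2 powi l)"
    using assms by simp
  then have "(2::real) powi k = 2 powi l"
    using of_real_eq_iff by blast
  then show ?thesis
    using power_int_strict_increasing[of k l "2::real"] power_int_strict_increasing[of l k "2::real"]
    by (cases k l rule: linorder_cases) auto
qed

text \<open>A Laurent polynomial that is multiplicative must be a monomial: if \<open>f\<close>
  differed from every power, its expansion into powers would be a linear relation between distinct
  characters.\<close>

lemma regular_Cstar_char: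
  assumes f: "regular_on Cstar_gens (- {0}) f"
    and mult: "\<And>s t. s \<noteq> 0 \<Longrightarrow> t \<noteq> 0 \<Longrightarrow> f (s * t) = f s * f t"
    and nz: "\<And>t. t \<noteq> 0 \<Longrightarrow> f t \<noteq> 0"
  shows "\<exists>k. \<forall>t. t \<noteq> 0 \<longrightarrow> f t = t powi k"
proof (rule ccontr)
  assume no: "\<nexists>k. \<forall>t. t \<noteq> 0 \<longrightarrow> f t = t powi k"
  define C :: "(complex \<Rightarrow> complex) set" where "C = {\<xi>. \<exists>k. \<xi> = (\<lambda>t. t powi k)}"
  have "char_span (- {0}) C f"
  proof (rule char_span_regular[OF f])
    fix \<xi> \<xi>' assume "\<xi> \<in> C" "\<xi>' \<in> C"
    then obtain k l where "\<xi> = (\<lambda>t. t powi k)" "\<xi>' = (\<lambda>t. t powi l)" by (auto simp: C_def)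
    then show "\<exists>\<xi>''\<in>C. \<forall>a\<in>- {0}. \<xi>'' a = \<xi> a * \<xi>' a"
      by (intro bexI[of _ "\<lambda>t. t powi (k + l)"]) (auto simp: C_def power_int_add)
  next
    show "\<exists>\<xi>\<in>C. \<forall>a\<in>- {0}. \<xi> a = 1"
      unfolding C_def by (rule bexI[of _ "\<lambda>t. t powi 0"]) (simp, blast)
  next
    fix s assume "s \<in> Cstar_gens"
    then consider "s = (\<lambda>t. t powi 1)" | "s = (\<lambda>t. t powi (-1))"
      by (auto simp: Cstar_gens_def power_int_minus)
    then have "s \<in> C"
      unfolding C_def by cases blast+
    then show "\<exists>\<xi>\<in>C. \<forall>a\<in>- {0}. \<xi> a = s a"
      by blast
  qed
  then obtain X c where X: "finite X" "X \<subseteq> C" "\<And>t. t \<noteq> 0 \<Longrightarrow> f t = (\<Sum>\<xi>\<in>X. c \<xi> * \<xi> t)"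
    by (auto simp: char_span_def)
  have "f \<notin> X"
    using no X(2) by (auto simp: C_def)
  \<comment> \<open>The expansion of \<open>f\<close> is read as a relation on
    \<open>insert f X\<close> in which \<open>f\<close> has the coefficient -1. Independence makes
    this coefficient zero, a contradiction.\<close>
  have "(c(f := -1)) f = 0"
  proof (rule characters_independent[where X = "insert f X" and c = "c(f := -1)" and D = "- {0}" and m = "(*)"])
    fix \<xi> \<xi>' :: "complex \<Rightarrow> complex"
    assume \<xi>: "\<xi> \<in> insert f X" "\<xi>' \<in> insert f X" and eq: "\<And>t. t \<in> - {0} \<Longrightarrow> \<xi> t = \<xi>' t"
    \<comment> \<open>Distinctness has two cases: two powers are told apart at 2, while
      \<open>f\<close> differs from each power at some nonzero point by the assumption
      \<open>no\<close>.\<close>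
    have neq: "\<exists>t\<in>- {0}. f t \<noteq> \<eta> t" if \<eta>: "\<eta> \<in> X" for \<eta>
    proof -
      obtain k where "\<eta> = (\<lambda>t. t powi k)"
        using \<eta> X(2) by (auto simp: C_def)
      then show ?thesis
        using no by auto
    qed
    have "\<xi> = \<xi>'" if C: "\<xi> \<in> C" "\<xi>' \<in> C"
    proof -
      obtain k l where kl: "\<xi> = (\<lambda>t. t powi k)" "\<xi>' = (\<lambda>t. t powi l)"
        using C by (auto simp: C_def)
      have "k = l"
        using eq[of 2] kl by (intro powi_2_inject) simp
      then show ?thesis using kl by simp
    qed
    moreover have "\<xi> = \<xi>' \<or> \<xi> \<in> X \<and> \<xi>' \<in> X"
    proof (cases "\<xi> = f \<longleftrightarrow> \<xi>' = f")
      case True then show ?thesis using \<xi> by auto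
    next
      case False
      then consider "\<xi> = f" "\<xi>' \<in> X" | "\<xi>' = f" "\<xi> \<in> X" using \<xi> by auto
      then show ?thesis
      proof cases
        case 1 then show ?thesis using neq[of \<xi>'] eq by auto
      next
        case 2 then show ?thesis using neq[of \<xi>] eq by auto
      qed
    qed
    ultimately show "\<xi> = \<xi>'" using X(2) by blast
  next
    fix t :: complex assume t: "t \<in> - {0}"
    have "(\<Sum>\<xi>\<in>X. (c(f := - 1)) \<xi> * \<xi> t) = (\<Sum>\<xi>\<in>X. c \<xi> * \<xi> t)"
      using \<open>f \<notin> X\<close> by (intro sum.cong) auto
    then show "(\<Sum>\<xi>\<in>insert f X. (c(f := - 1)) \<xi> * \<xi> t) = 0"
      using X t \<open>f \<notin> X\<close> by simp
  next
    have "(1::complex) \<in> - {0}" by simp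
    then show "- {0::complex} \<noteq> {}" by blast
  next
    show "\<xi> (s * t) = \<xi> s * \<xi> t" if "\<xi> \<in> insert f X" "s \<in> - {0}" "t \<in> - {0}" for \<xi> s t
    proof (cases "\<xi> = f")
      case True
      then show ?thesis using mult that by simp
    next
      case False
      then have "\<xi> \<in> C" using that(1) X(2) by blast
      then show ?thesis by (auto simp: C_def power_int_mult_distrib)
    qed
    show "\<xi> t \<noteq> 0" if "\<xi> \<in> insert f X" "t \<in> - {0}" for \<xi> t
    proof (cases "\<xi> = f")
      case True
      then show ?thesis using nz that by simp
    next
      case False
      then have "\<xi> \<in> C" using that(1) X(2) by blast
      then show ?thesis using that by (auto simp: C_def)
    qed
  qed (simp_all add: X(1))
  then show False by simp
qed

text \<open>Makes the definite description in \<open>pairing\<close> usable: the exponent exists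
  because \<open>\<mu>\<close> composed with \<open>lam\<close> is a regular character of the
  nonzero numbers, and it is unique by evaluation at 2.\<close>

lemma pairing_powi:
  assumes T: "algebraic_group T" and lam: "cocharacter T lam" and \<mu>: "\<mu> \<in> characters T"
    and "t \<noteq> 0"
  shows "\<mu> (lam t) = t powi (pairing \<mu> lam)"
proof -
  have lamT: "lam s \<in> T" if "s \<noteq> 0" for s
    using lam that by (simp add: cocharacter_def)
  have lam_mult: "lam (s * u) = lam s ** lam u" if "s \<noteq> 0" "u \<noteq> 0" for s u
    using lam that by (simp add: cocharacter_def)
  have reg: "regular_on Cstar_gens (- {0}) (\<lambda>t. \<mu> (lam t))"
  proof (rule regular_on_GL_compose_hom[where D' = T and \<iota> = inverse])
    show "regular_on GL_gens T \<mu>" using \<mu> by (simp add: characters_def)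
    show "lam (inverse s) ** lam s = mat 1" if "s \<in> - {0}" for s
      using lam_mult[of "inverse s" s] cocharacter_one[OF lam T] that by simp
    show "regular_on Cstar_gens (- {0}) (\<lambda>x. s (inverse x))" if "s \<in> Cstar_gens" for s
      using that by (auto simp: Cstar_gens_def regular_on_gen)
  qed (use lam in \<open>auto simp: cocharacter_def\<close>)
  have "\<exists>k. \<forall>s. s \<noteq> 0 \<longrightarrow> \<mu> (lam s) = s powi k"
    by (rule regular_Cstar_char[OF reg]) (use \<mu> lamT lam_mult in \<open>auto simp: characters_def\<close>)
  moreover have "k = l"
    if k: "\<forall>s::complex. s \<noteq> 0 \<longrightarrow> \<mu> (lam s) = s powi k" and l: "\<forall>s. s \<noteq> 0 \<longrightarrow> \<mu> (lam s) = s powi l" for k l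
    using k[rule_format, of 2] l[rule_format, of 2] by (intro powi_2_inject) simp
  ultimately have "\<exists>!k. \<forall>s. s \<noteq> 0 \<longrightarrow> \<mu> (lam s) = s powi k"
    by blast
  from theI'[OF this] show ?thesis
    using \<open>t \<noteq> 0\<close> by (simp add: pairing_def)
qed

section \<open>Weight decomposition\<close>

text \<open>Collects the restriction of the representation to \<open>T\<close>, the data from which
  the weights are obtained.\<close>

locale torus_rep = finite_dimensional_vector_space smul B
  for smul :: "complex \<Rightarrow> 'v::ab_group_add \<Rightarrow> 'v" and B :: "'v set" +
  fixes T :: "(complex^'n^'n) set" and \<rho> :: "complex^'n^'n \<Rightarrow> 'v \<Rightarrow> 'v"
  assumes torus: "torus T"
    and linear_rho: "a \<in> T \<Longrightarrow> Vector_Spaces.linear smul smul (\<rho> a)"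
    and rho_one: "\<rho> (mat 1) v = v"
    and rho_mult: "a \<in> T \<Longrightarrow> b \<in> T \<Longrightarrow> \<rho> (a ** b) v = \<rho> a (\<rho> b v)"
    and rho_regular: "linear_functional smul \<phi> \<Longrightarrow> regular_on GL_gens T (\<lambda>a. \<phi> (\<rho> a v))"

section \<open>Coordinates and linear functionals\<close>

context finite_dimensional_vector_space
begin

lemma basis_expansion: "v = (\<Sum>b\<in>Basis. scale (representation Basis v b) b)"
  by (rule sum_representation_eq[symmetric]) (auto simp: independent_Basis span_Basis finite_Basis)

end

context
  fixes smul :: "complex \<Rightarrow> 'v::ab_group_add \<Rightarrow> 'v" and B :: "'v set"
  assumes fd: "finite_dimensional_vector_space smul B"
begin

interpretation finite_dimensional_vector_space smul B by (rule fd)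

lemma linear_functional_coord: "linear_functional smul (\<lambda>v. representation B v b)"
  unfolding linear_functional_def
  by (intro linear_representation) (auto simp: independent_Basis span_Basis)

lemma linear_functional_iff:
  "linear_functional smul \<phi> \<longleftrightarrow>
     (\<forall>v w. \<phi> (v + w) = \<phi> v + \<phi> w) \<and> (\<forall>t v. \<phi> (smul t v) = t * \<phi> v)"
proof -
  have "vector_space smul" by unfold_locales
  moreover have "vector_space ((*) :: complex \<Rightarrow> _)"
    by unfold_locales (auto simp: algebra_simps)
  ultimately show ?thesis
    by (simp add: linear_functional_def Vector_Spaces.linear_def module_hom_iff module_iff_vector_space)
qed

lemma linear_functional_add: "linear_functional smul \<phi> \<Longrightarrow> \<phi> (v + w) = \<phi> v + \<phi> w"
  and linear_functional_scale: "linear_functional smul \<phi> \<Longrightarrow> \<phi> (smul t v) = t * \<phi> v"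
  by (simp_all add: linear_functional_iff)

lemma linear_functional_0: "linear_functional smul \<phi> \<Longrightarrow> \<phi> 0 = 0"
  using linear_functional_scale[of \<phi> 0 0] by simp

lemma linear_functional_sum: "linear_functional smul \<phi> \<Longrightarrow> \<phi> (\<Sum>i\<in>I. f i) = (\<Sum>i\<in>I. \<phi> (f i))"
  by (induction I rule: infinite_finite_induct) (auto simp: linear_functional_add linear_functional_0)

lemma functional_expansion:
  assumes "linear_functional smul \<phi>"
  shows "\<phi> v = (\<Sum>b\<in>B. representation B v b * \<phi> b)"
  by (subst basis_expansion[of v]) (simp add: linear_functional_sum linear_functional_scale assms)

lemma functionals_separate:
  assumes "\<And>\<phi>. linear_functional smul \<phi> \<Longrightarrow> \<phi> v = 0"
  shows "v = 0"
  using basis_expansion[of v] assms[OF linear_functional_coord] by simp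

end

section \<open>Weight spaces of the torus representation\<close>

context torus_rep
begin

lemmas fdvs = finite_dimensional_vector_space_axioms

lemma algebraic: "algebraic_group T"
  using torus by (simp add: torus_def)

lemma rho_add: "a \<in> T \<Longrightarrow> \<rho> a (v + w) = \<rho> a v + \<rho> a w"
  and rho_scale: "a \<in> T \<Longrightarrow> \<rho> a (smul t v) = smul t (\<rho> a v)"
  using linear_rho[of a] by (simp_all add: Vector_Spaces.linear_def module_hom_iff)

lemma rho_0: "a \<in> T \<Longrightarrow> \<rho> a 0 = 0"
  using rho_scale[of a 0 0] by simp

lemma rho_sum: "a \<in> T \<Longrightarrow> \<rho> a (\<Sum>i\<in>I. f i) = (\<Sum>i\<in>I. \<rho> a (f i))"
  by (induction I rule: infinite_finite_induct) (auto simp: rho_add rho_0)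

text \<open>Every linear functional reduces the claim to the independence of the scalar characters,
  and functionals separate vectors. The family \<open>w\<close> is arbitrary and need not consist of
  weight vectors; this freedom is used to prove that certain vectors are weight vectors.\<close>

lemma weight_vectors_independent:
  assumes "finite X" "X \<subseteq> characters T" "\<xi> \<in> X"
    and zero: "\<And>a. a \<in> T \<Longrightarrow> (\<Sum>\<xi>\<in>X. smul (\<xi> a) (w \<xi>)) = 0"
  shows "w \<xi> = 0"
proof (rule functionals_separate[OF fdvs])
  fix \<phi> assume \<phi>: "linear_functional smul \<phi>"
  show "\<phi> (w \<xi>) = 0"
  proof (rule characters_independent[OF assms(1) _ _ _ _ _ _ assms(3), where D = T and m = "(**)"])
    fix a assume "a \<in> T"
    then have "\<phi> (\<Sum>\<xi>\<in>X. smul (\<xi> a) (w \<xi>)) = 0"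
      using zero linear_functional_0[OF fdvs \<phi>] by simp
    then show "(\<Sum>\<xi>\<in>X. \<phi> (w \<xi>) * \<xi> a) = 0"
      by (simp add: linear_functional_sum[OF fdvs \<phi>] linear_functional_scale[OF fdvs \<phi>] mult.commute)
  next
    fix \<xi> \<xi>' assume "\<xi> \<in> X" "\<xi>' \<in> X" and eq: "\<And>a. a \<in> T \<Longrightarrow> \<xi> a = \<xi>' a"
    then have "\<xi> \<in> extensional T" "\<xi>' \<in> extensional T"
      using assms(2) by (auto simp: characters_def)
    then show "\<xi> = \<xi>'"
      using eq by (rule extensionalityI)
  next
    show "T \<noteq> {}" using algebraic_group_closed(1)[OF algebraic] by blast
  qed (use assms(2) algebraic_group_closed(2)[OF algebraic] in \<open>auto simp: characters_def\<close>)
qed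

lemma character_mult: "\<xi> \<in> characters T \<Longrightarrow> a \<in> T \<Longrightarrow> b \<in> T \<Longrightarrow> \<xi> (a ** b) = \<xi> a * \<xi> b"
  by (simp add: characters_def)

lemma character_one: "\<xi> \<in> characters T \<Longrightarrow> \<xi> (mat 1) = 1"
proof -
  assume \<xi>: "\<xi> \<in> characters T"
  have "mat 1 \<in> T" using algebraic_group_closed(1)[OF algebraic] .
  then have "\<xi> (mat 1 ** mat 1) = \<xi> (mat 1) * \<xi> (mat 1)" "\<xi> (mat 1) \<noteq> 0"
    using \<xi> unfolding characters_def by blast+
  then show ?thesis by simp
qed

text \<open>The matrix coefficients of \<open>\<rho>\<close> on \<open>T\<close> in the basis
  \<open>B\<close> are regular, hence combinations of characters. Collecting the coefficients of a
  fixed \<open>\<xi>\<close> over all matrix positions gives the operator \<open>P \<xi>\<close>,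
  which will turn out to map into the weight space of \<open>\<xi>\<close>.\<close>

lemma spectral_expansion:
  "\<exists>X P. finite X \<and> X \<subseteq> characters T \<and>
    (\<forall>a\<in>T. \<forall>v. \<rho> a v = (\<Sum>\<xi>\<in>X. smul (\<xi> a) (P \<xi> v)))"
proof -
  have "\<forall>p. \<exists>Zd. finite (fst Zd) \<and> fst Zd \<subseteq> characters T \<and>
      (\<forall>a\<in>T. representation B (\<rho> a (fst p)) (snd p) = (\<Sum>\<xi>\<in>fst Zd. snd Zd \<xi> * \<xi> a))"
    using torus_regular_char_span[OF torus rho_regular[OF linear_functional_coord[OF fdvs]]]
    unfolding char_span_def by simp
  \<comment> \<open>One choice for all pairs of vectors at once; each value packs the finite support
    together with the coefficients.\<close>
  from choice[OF this] obtain Zd where Zd: "\<forall>p. finite (fst (Zd p)) \<and> fst (Zd p) \<subseteq> characters T \<and>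
      (\<forall>a\<in>T. representation B (\<rho> a (fst p)) (snd p) = (\<Sum>\<xi>\<in>fst (Zd p). snd (Zd p) \<xi> * \<xi> a))" ..
  define Z d where "Z b b' = fst (Zd (b, b'))" and "d b b' = snd (Zd (b, b'))" for b b'
  have Z: "finite (Z b b')" "Z b b' \<subseteq> characters T"
      "a \<in> T \<Longrightarrow> representation B (\<rho> a b) b' = (\<Sum>\<xi>\<in>Z b b'. d b b' \<xi> * \<xi> a)" for a b b'
    using Zd[rule_format, of "(b, b')"] by (simp_all add: Z_def d_def)
  define X where "X = (\<Union>b\<in>B. \<Union>b'\<in>B. Z b b')"
  \<comment> \<open>Extension by zero lets all matrix positions be expanded over the common support
    \<open>X\<close>.\<close>
  define c where "c b b' \<xi> = (if \<xi> \<in> Z b b' then d b b' \<xi> else 0)" for b b' \<xi>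
  define P where "P \<xi> v = (\<Sum>b\<in>B. \<Sum>b'\<in>B. smul (representation B v b * c b b' \<xi>) b')" for \<xi> v
  have finX: "finite X"
    using Z(1) finite_Basis by (simp add: X_def)
  have c: "representation B (\<rho> a b) b' = (\<Sum>\<xi>\<in>X. c b b' \<xi> * \<xi> a)"
    if "a \<in> T" "b \<in> B" "b' \<in> B" for a b b'
    unfolding Z(3)[OF that(1)] c_def using that finX
    by (intro sum.mono_neutral_cong_left) (auto simp: X_def)
  have "\<rho> a v = (\<Sum>\<xi>\<in>X. smul (\<xi> a) (P \<xi> v))" if a: "a \<in> T" for a v
  proof -
    have "\<rho> a v = (\<Sum>b\<in>B. smul (representation B v b) (\<rho> a b))"
      by (subst basis_expansion[of v]) (simp add: rho_sum rho_scale a)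
    also have "\<dots> = (\<Sum>b\<in>B. smul (representation B v b)
        (\<Sum>b'\<in>B. smul (\<Sum>\<xi>\<in>X. c b b' \<xi> * \<xi> a) b'))"
    proof (rule sum.cong[OF refl])
      fix b assume "b \<in> B"
      have "\<rho> a b = (\<Sum>b'\<in>B. smul (representation B (\<rho> a b) b') b')"
        by (rule basis_expansion)
      also have "\<dots> = (\<Sum>b'\<in>B. smul (\<Sum>\<xi>\<in>X. c b b' \<xi> * \<xi> a) b')"
        using c a \<open>b \<in> B\<close> by simp
      finally show "smul (representation B v b) (\<rho> a b) =
          smul (representation B v b) (\<Sum>b'\<in>B. smul (\<Sum>\<xi>\<in>X. c b b' \<xi> * \<xi> a) b')"
        by simp
    qed
    also have "\<dots> = (\<Sum>b\<in>B. \<Sum>b'\<in>B. \<Sum>\<xi>\<in>X. smul (\<xi> a) (smul (representation B v b * c b b' \<xi>) b'))"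
      unfolding scale_sum_right scale_sum_left scale_scale by (simp only: mult_ac)
    also have "\<dots> = (\<Sum>\<xi>\<in>X. \<Sum>b\<in>B. \<Sum>b'\<in>B. smul (\<xi> a) (smul (representation B v b * c b b' \<xi>) b'))"
      by (subst sum.swap[of _ B X], rule sum.cong[OF refl], rule sum.swap)
    also have "\<dots> = (\<Sum>\<xi>\<in>X. smul (\<xi> a) (P \<xi> v))"
      by (simp add: P_def scale_sum_right)
    finally show ?thesis .
  qed
  moreover have "X \<subseteq> characters T"
    using Z(2) by (auto simp: X_def)
  ultimately show ?thesis
    using finX by blast
qed

lemma weight_space_0: "0 \<in> weight_space T smul \<rho> \<mu>"
  and weight_space_add: "v \<in> weight_space T smul \<rho> \<mu> \<Longrightarrow> w \<in> weight_space T smul \<rho> \<mu> \<Longrightarrow>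
    v + w \<in> weight_space T smul \<rho> \<mu>"
  and weight_space_scale: "v \<in> weight_space T smul \<rho> \<mu> \<Longrightarrow> smul t v \<in> weight_space T smul \<rho> \<mu>"
  by (auto simp: weight_space_def rho_0 rho_add rho_scale scale_right_distrib mult.commute)

lemma weights_characters: "weights T smul \<rho> \<subseteq> characters T"
  by (auto simp: weights_def)

text \<open>In the expansion of \<open>\<rho> a v\<close> the coefficients of the characters are
  weight vectors, and at the unit matrix the expansion reads as a decomposition of \<open>v\<close>.
  Every weight already occurs among the finitely many characters in \<open>X\<close>, which gives
  finiteness.\<close>

lemma
  shows finite_weights: "finite (weights T smul \<rho>)"
    and weight_decomposition_exists: "\<exists>c. (\<forall>\<mu>\<in>weights T smul \<rho>. c \<mu> \<in> weight_space T smul \<rho> \<mu>) \<and>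
      v = (\<Sum>\<mu>\<in>weights T smul \<rho>. c \<mu>)"
proof -
  obtain X P where X: "finite X" "X \<subseteq> characters T"
    and P': "\<forall>a\<in>T. \<forall>v. \<rho> a v = (\<Sum>\<xi>\<in>X. smul (\<xi> a) (P \<xi> v))"
    using spectral_expansion by blast
  note P = P'[rule_format]
  have PW: "P \<xi> v \<in> weight_space T smul \<rho> \<xi>" if "\<xi> \<in> X" for \<xi> v
    unfolding weight_space_def
  proof (intro CollectI ballI)
    fix s assume s: "s \<in> T"
    \<comment> \<open>For fixed \<open>s\<close>, the expansion of \<open>\<rho> (s ** a) v\<close>
      is computed in two ways and the coefficients of the characters of \<open>a\<close> are
      compared.\<close>
    have "smul (\<xi> s) (P \<xi> v) - \<rho> s (P \<xi> v) = 0"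
    proof (rule weight_vectors_independent[OF X that])
      fix a assume a: "a \<in> T"
      have "(\<Sum>\<xi>\<in>X. smul (\<xi> a) (smul (\<xi> s) (P \<xi> v))) = (\<Sum>\<xi>\<in>X. smul (\<xi> (s ** a)) (P \<xi> v))"
      proof (rule sum.cong[OF refl])
        fix \<xi> assume "\<xi> \<in> X"
        then have "\<xi> (s ** a) = \<xi> s * \<xi> a"
          using character_mult[OF subsetD[OF X(2)] s a] by blast
        then show "smul (\<xi> a) (smul (\<xi> s) (P \<xi> v)) = smul (\<xi> (s ** a)) (P \<xi> v)"
          by (simp add: mult.commute)
      qed
      also have "\<dots> = \<rho> s (\<rho> a v)"
        unfolding rho_mult[OF s a, symmetric]
        by (rule P[OF algebraic_group_closed(2)[OF algebraic s a], symmetric])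
      also have "\<dots> = (\<Sum>\<xi>\<in>X. smul (\<xi> a) (\<rho> s (P \<xi> v)))"
        by (simp add: P[OF a] rho_sum rho_scale s)
      finally show "(\<Sum>\<xi>\<in>X. smul (\<xi> a) (smul (\<xi> s) (P \<xi> v) - \<rho> s (P \<xi> v))) = 0"
        by (simp add: scale_right_diff_distrib sum_subtractf)
    qed
    then show "\<rho> s (P \<xi> v) = smul (\<xi> s) (P \<xi> v)"
      by simp
  qed
  have sub: "weights T smul \<rho> \<subseteq> X"
  proof (rule subsetI, rule ccontr)
    fix \<nu> assume \<nu>: "\<nu> \<in> weights T smul \<rho>" "\<nu> \<notin> X"
    then have "weight_space T smul \<rho> \<nu> \<noteq> {0}"
      by (simp add: weights_def)
    then obtain v where v: "v \<noteq> 0" "v \<in> weight_space T smul \<rho> \<nu>"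
      using weight_space_0[of \<nu>] by blast
    \<comment> \<open>A weight vector \<open>v\<close> of a weight outside \<open>X\<close> has the
      expansion of \<open>\<rho> a v\<close> over \<open>X\<close> and also equals
      \<open>\<nu> a\<close> times itself there; the difference is a relation with coefficient
      \<open>- v\<close> at \<open>\<nu>\<close>.\<close>
    define w where "w \<xi> = (if \<xi> = \<nu> then - v else P \<xi> v)" for \<xi>
    have "w \<nu> = 0"
    proof (rule weight_vectors_independent[of "insert \<nu> X"])
      fix a assume a: "a \<in> T"
      have "(\<Sum>\<xi>\<in>X. smul (\<xi> a) (w \<xi>)) = \<rho> a v"
        unfolding P[OF a] using \<nu>(2) by (intro sum.cong) (auto simp: w_def)
      also have "\<dots> = smul (\<nu> a) v"
        using v(2) a by (simp add: weight_space_def)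
      finally show "(\<Sum>\<xi>\<in>insert \<nu> X. smul (\<xi> a) (w \<xi>)) = 0"
        using \<nu>(2) X(1) by (simp add: w_def[of \<nu>])
    qed (use X \<nu>(1) weights_characters in auto)
    then show False
      using v(1) by (simp add: w_def)
  qed
  then show "finite (weights T smul \<rho>)"
    using X(1) finite_subset by blast
  have "v = (\<Sum>\<xi>\<in>X. smul (\<xi> (mat 1)) (P \<xi> v))"
    unfolding P[OF algebraic_group_closed(1)[OF algebraic], symmetric] rho_one ..
  also have "\<dots> = (\<Sum>\<xi>\<in>X. P \<xi> v)"
  proof (rule sum.cong[OF refl])
    show "smul (\<xi> (mat 1)) (P \<xi> v) = P \<xi> v" if "\<xi> \<in> X" for \<xi>
      using character_one[OF subsetD[OF X(2) that]] by simp
  qed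
  \<comment> \<open>A character in \<open>X\<close> that is not a weight has zero weight space, so
    its term vanishes.\<close>
  also have "\<dots> = (\<Sum>\<xi>\<in>weights T smul \<rho>. P \<xi> v)"
  proof (rule sum.mono_neutral_right[OF X(1) sub])
    show "\<forall>\<xi>\<in>X - weights T smul \<rho>. P \<xi> v = 0"
    proof
      fix \<xi> assume \<xi>: "\<xi> \<in> X - weights T smul \<rho>"
      then have "weight_space T smul \<rho> \<xi> = {0}"
        using X(2) by (auto simp: weights_def)
      then show "P \<xi> v = 0"
        using PW[of \<xi> v] \<xi> by simp
    qed
  qed
  finally show "\<exists>c. (\<forall>\<mu>\<in>weights T smul \<rho>. c \<mu> \<in> weight_space T smul \<rho> \<mu>) \<and>
      v = (\<Sum>\<mu>\<in>weights T smul \<rho>. c \<mu>)"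
    using PW sub by (intro exI[of _ "\<lambda>\<xi>. P \<xi> v"]) auto
qed

text \<open>Applying \<open>\<rho> a\<close> to both decompositions multiplies the terms by
  \<open>\<mu> a\<close>, so the differences \<open>c \<mu> - d \<mu>\<close> satisfy a relation
  with character coefficients.\<close>

lemma weight_decomposition_unique:
  assumes "\<And>\<mu>. \<mu> \<in> weights T smul \<rho> \<Longrightarrow> c \<mu> \<in> weight_space T smul \<rho> \<mu>"
    and "\<And>\<mu>. \<mu> \<in> weights T smul \<rho> \<Longrightarrow> d \<mu> \<in> weight_space T smul \<rho> \<mu>"
    and eq: "(\<Sum>\<mu>\<in>weights T smul \<rho>. c \<mu>) = (\<Sum>\<mu>\<in>weights T smul \<rho>. d \<mu>)"
    and "\<mu> \<in> weights T smul \<rho>"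
  shows "c \<mu> = d \<mu>"
proof -
  have "c \<mu> - d \<mu> = 0"
  proof (rule weight_vectors_independent[OF finite_weights weights_characters assms(4)])
    fix a assume a: "a \<in> T"
    have "(\<Sum>\<mu>\<in>weights T smul \<rho>. smul (\<mu> a) (c \<mu>)) = \<rho> a (\<Sum>\<mu>\<in>weights T smul \<rho>. c \<mu>)"
      unfolding rho_sum[OF a] using assms(1) a by (intro sum.cong) (auto simp: weight_space_def)
    also have "\<dots> = (\<Sum>\<mu>\<in>weights T smul \<rho>. smul (\<mu> a) (d \<mu>))"
      unfolding eq rho_sum[OF a] using assms(2) a by (intro sum.cong) (auto simp: weight_space_def)
    finally show "(\<Sum>\<mu>\<in>weights T smul \<rho>. smul (\<mu> a) (c \<mu> - d \<mu>)) = 0"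
      by (simp add: scale_right_diff_distrib sum_subtractf)
  qed
  then show ?thesis by simp
qed

text \<open>Discharges the definite description in \<open>weight_components\<close>. The components
  are unique as values on the weights; the extensional product makes them unique as a
  function.\<close>

lemma
  shows weight_components_in: "\<mu> \<in> weights T smul \<rho> \<Longrightarrow>
      weight_components T smul \<rho> v \<mu> \<in> weight_space T smul \<rho> \<mu>"
    and weight_components_sum: "(\<Sum>\<mu>\<in>weights T smul \<rho>. weight_components T smul \<rho> v \<mu>) = v"
proof -
  define S where "S c \<longleftrightarrow> c \<in> (\<Pi>\<^sub>E \<mu>\<in>weights T smul \<rho>. weight_space T smul \<rho> \<mu>) \<and>
      v = (\<Sum>\<mu>\<in>weights T smul \<rho>. c \<mu>)" for c
  have S: "c \<mu> \<in> weight_space T smul \<rho> \<mu>" "(\<Sum>\<mu>\<in>weights T smul \<rho>. c \<mu>) = v"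
    if "S c" "\<mu> \<in> weights T smul \<rho>" for c \<mu>
    using that unfolding S_def by (auto dest: PiE_mem)
  obtain c where c: "\<forall>\<mu>\<in>weights T smul \<rho>. c \<mu> \<in> weight_space T smul \<rho> \<mu>"
      "v = (\<Sum>\<mu>\<in>weights T smul \<rho>. c \<mu>)"
    using weight_decomposition_exists by blast
  have ex: "S (restrict c (weights T smul \<rho>))"
    unfolding S_def c(2) using c(1) by simp
  have uniq: "d = d'" if d: "S d" "S d'" for d d'
  proof (rule PiE_ext)
    show "d \<in> (\<Pi>\<^sub>E \<mu>\<in>weights T smul \<rho>. weight_space T smul \<rho> \<mu>)"
      "d' \<in> (\<Pi>\<^sub>E \<mu>\<in>weights T smul \<rho>. weight_space T smul \<rho> \<mu>)"
      using d by (simp_all add: S_def)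
    fix \<mu> assume \<mu>: "\<mu> \<in> weights T smul \<rho>"
    show "d \<mu> = d' \<mu>"
      by (rule weight_decomposition_unique[OF S(1)[OF d(1)] S(1)[OF d(2)] _ \<mu>])
         (simp_all only: S(2)[OF d(1) \<mu>] S(2)[OF d(2) \<mu>])
  qed
  have "\<exists>!c. S c" by (rule ex1I[of S, OF ex]) (rule uniq[OF _ ex])
  then have "S (THE c. S c)" by (rule theI')
  then have *: "S (weight_components T smul \<rho> v)"
    by (simp only: weight_components_def S_def)
  then show "(\<Sum>\<mu>\<in>weights T smul \<rho>. weight_components T smul \<rho> v \<mu>) = v"
    unfolding S_def by (elim conjE) (rule sym)
  show "weight_components T smul \<rho> v \<mu> \<in> weight_space T smul \<rho> \<mu>" if "\<mu> \<in> weights T smul \<rho>"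
    using S(1)[OF * that] .
qed

lemma weight_components_eqI:
  assumes "\<And>\<mu>. \<mu> \<in> weights T smul \<rho> \<Longrightarrow> c \<mu> \<in> weight_space T smul \<rho> \<mu>"
    and "(\<Sum>\<mu>\<in>weights T smul \<rho>. c \<mu>) = v" and "\<mu> \<in> weights T smul \<rho>"
  shows "weight_components T smul \<rho> v \<mu> = c \<mu>"
  by (rule weight_decomposition_unique[where c = "weight_components T smul \<rho> v" and d = c])
     (use assms in \<open>auto simp: weight_components_sum weight_components_in\<close>)

lemma weight_components_add: "\<mu> \<in> weights T smul \<rho> \<Longrightarrow> weight_components T smul \<rho> (v + w) \<mu> =
    weight_components T smul \<rho> v \<mu> + weight_components T smul \<rho> w \<mu>"
  by (rule weight_components_eqI[where
        c = "\<lambda>\<mu>. weight_components T smul \<rho> v \<mu> + weight_components T smul \<rho> w \<mu>"])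
     (auto simp: weight_components_in weight_components_sum weight_space_add sum.distrib)

lemma weight_components_scale: "\<mu> \<in> weights T smul \<rho> \<Longrightarrow> weight_components T smul \<rho> (smul t v) \<mu> =
    smul t (weight_components T smul \<rho> v \<mu>)"
  by (rule weight_components_eqI[where c = "\<lambda>\<mu>. smul t (weight_components T smul \<rho> v \<mu>)"])
     (auto simp: weight_components_in weight_components_sum weight_space_scale simp flip: scale_sum_right)

lemma weight_components_rho:
  assumes "\<mu> \<in> weights T smul \<rho>" "a \<in> T"
  shows "weight_components T smul \<rho> (\<rho> a v) \<mu> = smul (\<mu> a) (weight_components T smul \<rho> v \<mu>)"
proof (rule weight_components_eqI[OF _ _ assms(1),
      where c = "\<lambda>\<mu>. smul (\<mu> a) (weight_components T smul \<rho> v \<mu>)"])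
  have "\<rho> a v = \<rho> a (\<Sum>\<mu>\<in>weights T smul \<rho>. weight_components T smul \<rho> v \<mu>)"
    by (simp add: weight_components_sum)
  also have "\<dots> = (\<Sum>\<mu>\<in>weights T smul \<rho>. smul (\<mu> a) (weight_components T smul \<rho> v \<mu>))"
    unfolding rho_sum[OF assms(2)]
  proof (rule sum.cong[OF refl])
    show "\<rho> a (weight_components T smul \<rho> v \<mu>) = smul (\<mu> a) (weight_components T smul \<rho> v \<mu>)"
      if "\<mu> \<in> weights T smul \<rho>" for \<mu>
      using weight_components_in[OF that, of v] assms(2) by (simp add: weight_space_def)
  qed
  finally show "(\<Sum>\<mu>\<in>weights T smul \<rho>. smul (\<mu> a) (weight_components T smul \<rho> v \<mu>)) = \<rho> a v" ..
qed (rule weight_space_scale[OF weight_components_in])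

end

section \<open>Holomorphic functions on projective space\<close>

lemma holo_on_const: "holo_on (\<lambda>_. c) S"
  unfolding holo_on_def by (intro ballI exI[of _ "\<lambda>_. 0"]) auto

lemma holo_on_add:
  assumes "holo_on f S" "holo_on g S"
  shows "holo_on (\<lambda>x. f x + g x) S"
  unfolding holo_on_def
proof
  fix x assume "x \<in> S"
  then obtain f' g' where "(f has_derivative f') (at x)" "\<forall>c v. f' (c *s v) = c * f' v"
      "(g has_derivative g') (at x)" "\<forall>c v. g' (c *s v) = c * g' v"
    using assms unfolding holo_on_def by fastforce
  then show "\<exists>h'. ((\<lambda>x. f x + g x) has_derivative h') (at x) \<and> (\<forall>c v. h' (c *s v) = c * h' v)"
    by (intro exI[of _ "\<lambda>h. f' h + g' h"] conjI has_derivative_add) (auto simp: algebra_simps)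
qed

lemma holo_on_mult:
  assumes "holo_on f S" "holo_on g S"
  shows "holo_on (\<lambda>x. f x * g x) S"
  unfolding holo_on_def
proof
  fix x assume "x \<in> S"
  then obtain f' g' where "(f has_derivative f') (at x)" "\<forall>c v. f' (c *s v) = c * f' v"
      "(g has_derivative g') (at x)" "\<forall>c v. g' (c *s v) = c * g' v"
    using assms unfolding holo_on_def by fastforce
  then show "\<exists>h'. ((\<lambda>x. f x * g x) has_derivative h') (at x) \<and> (\<forall>c v. h' (c *s v) = c * h' v)"
    by (intro exI[of _ "\<lambda>h. f x * g' h + f' h * g x"] conjI has_derivative_mult)
       (auto simp: algebra_simps)
qed

lemma holo_on_inverse:
  assumes "holo_on f S" "\<And>x. x \<in> S \<Longrightarrow> f x \<noteq> 0"
  shows "holo_on (\<lambda>x. inverse (f x)) S"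
  unfolding holo_on_def
proof
  fix x assume x: "x \<in> S"
  then obtain f' where "(f has_derivative f') (at x)" "\<forall>c v. f' (c *s v) = c * f' v"
    using assms unfolding holo_on_def by blast
  then have "((\<lambda>x. inverse (f x)) has_derivative (\<lambda>h. - (inverse (f x) * f' h * inverse (f x)))) (at x)"
      "\<forall>c v. - (inverse (f x) * f' (c *s v) * inverse (f x)) = c * - (inverse (f x) * f' v * inverse (f x))"
    using Deriv.has_derivative_inverse[of f x f' UNIV] assms(2)[OF x] by auto
  then show "\<exists>h'. ((\<lambda>x. inverse (f x)) has_derivative h') (at x) \<and> (\<forall>c v. h' (c *s v) = c * h' v)"
    by blast
qed

lemma holo_on_coord: "holo_on (\<lambda>x. x $ i) S"
  unfolding holo_on_def
  by (intro ballI exI[of _ "\<lambda>x. x $ i"])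
     (auto intro: bounded_linear_imp_has_derivative bounded_linear_vec_nth)

lemma holo_on_sum: "(\<And>i. i \<in> I \<Longrightarrow> holo_on (f i) S) \<Longrightarrow> holo_on (\<lambda>x. \<Sum>i\<in>I. f i x) S"
  by (induction I rule: infinite_finite_induct) (auto intro: holo_on_const holo_on_add)

lemma holo_on_power: "holo_on f S \<Longrightarrow> holo_on (\<lambda>x. f x ^ n) S"
  by (induction n) (auto intro: holo_on_const holo_on_mult)

lemma holo_on_power_int:
  assumes "holo_on f S" "\<And>x. x \<in> S \<Longrightarrow> f x \<noteq> 0"
  shows "holo_on (\<lambda>x. f x powi k) S"
proof (cases "k \<ge> 0")
  case True
  then show ?thesis
    using assms by (simp add: power_int_def holo_on_power)
next
  case False
  then show ?thesis
    using assms by (simp add: power_int_def holo_on_power holo_on_inverse)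
qed

lemma holo_on_subset: "holo_on f S \<Longrightarrow> S' \<subseteq> S \<Longrightarrow> holo_on f S'"
  by (auto simp: holo_on_def)

lemma holo_on_cong:
  assumes "open S" "holo_on f S" "\<And>x. x \<in> S \<Longrightarrow> g x = f x"
  shows "holo_on g S"
  unfolding holo_on_def
proof
  fix x assume x: "x \<in> S"
  then obtain f' where f': "(f has_derivative f') (at x)" "\<forall>c v. f' (c *s v) = c * f' v"
    using assms(2) unfolding holo_on_def by blast
  have "(g has_derivative f') (at x)"
    by (rule has_derivative_transform_within_open[OF f'(1) assms(1) x]) (use assms(3) in auto)
  then show "\<exists>f'. (g has_derivative f') (at x) \<and> (\<forall>c v. f' (c *s v) = c * f' v)"
    using f'(2) by blast
qed

lemma holo_on_continuous: "holo_on f S \<Longrightarrow> continuous_on S f"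
  unfolding holo_on_def
  by (meson continuous_at_imp_continuous_on has_derivative_continuous)

section \<open>Points and open sets of projective space\<close>

lemma hline_mem: "y \<in> hline x \<longleftrightarrow> (\<exists>t. t \<noteq> 0 \<and> y = t *s x)"
  by (auto simp: hline_def)

lemma hline_self: "x \<in> hline x"
  unfolding hline_mem by (rule exI[of _ 1]) simp

lemma hline_scale:
  assumes "t \<noteq> 0"
  shows "hline (t *s x) = hline x"
proof -
  have "s *s x \<in> hline (t *s x)" "s *s (t *s x) \<in> hline x" if "s \<noteq> 0" for s
    using that assms unfolding hline_mem
    by (intro exI[of _ "s / t"] exI[of _ "s * t"]; simp add: vector_smult_assoc)+
  then show ?thesis
    unfolding hline_def by blast
qed

lemma hline_eq:
  assumes "p \<in> CP3" "x \<in> p"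
  shows "hline x = p"
proof -
  obtain y where y: "p = hline y" using assms(1) by (auto simp: CP3_def)
  then obtain t where "t \<noteq> 0" "x = t *s y" using assms(2) hline_mem by blast
  then show ?thesis using y hline_scale by simp
qed

lemma CP3_nonzero: "p \<in> CP3 \<Longrightarrow> x \<in> p \<Longrightarrow> x \<noteq> 0"
  by (auto simp: CP3_def hline_mem)

lemma CP3_scale: "p \<in> CP3 \<Longrightarrow> x \<in> p \<Longrightarrow> t \<noteq> 0 \<Longrightarrow> t *s x \<in> p"
  using hline_eq[of p x] hline_mem by blast

lemma CP3_obtain:
  assumes "p \<in> CP3"
  obtains x where "x \<in> p"
  using assms hline_self by (auto simp: CP3_def)

lemma CP3_scale_obtain:
  assumes "p \<in> CP3" "x \<in> p" "y \<in> p"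
  obtains t where "t \<noteq> 0" "y = t *s x"
  using assms hline_eq[of p x] hline_mem[of y x] by blast

lemma hline_CP3: "x \<noteq> 0 \<Longrightarrow> hline x \<in> CP3"
  by (auto simp: CP3_def)

lemma Union_points: "W \<subseteq> CP3 \<Longrightarrow> x \<in> \<Union>W \<longleftrightarrow> x \<noteq> 0 \<and> hline x \<in> W"
  using hline_eq CP3_nonzero hline_self by blast

lemma cp3_openD: "cp3_open W \<Longrightarrow> W \<subseteq> CP3" "cp3_open W \<Longrightarrow> open (\<Union>W)"
  by (auto simp: cp3_open_def)

lemma cp3_open_hline: "cp3_open W \<Longrightarrow> x \<in> \<Union>W \<Longrightarrow> hline x \<in> W"
  using Union_points cp3_openD(1) by blast

lemma cp3_openI:
  assumes "W \<subseteq> CP3" "open {x. x \<noteq> 0 \<and> hline x \<in> W}"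
  shows "cp3_open W"
proof -
  have "\<Union>W = {x. x \<noteq> 0 \<and> hline x \<in> W}"
    using Union_points[OF assms(1)] by blast
  then show ?thesis
    using assms by (simp add: cp3_open_def)
qed

lemma cp3_open_Int:
  assumes "cp3_open W" "cp3_open W'"
  shows "cp3_open (W \<inter> W')"
proof (rule cp3_openI)
  show "W \<inter> W' \<subseteq> CP3" using cp3_openD assms by blast
  have "{x. x \<noteq> 0 \<and> hline x \<in> W \<inter> W'} = \<Union>W \<inter> \<Union>W'"
    using Union_points[OF cp3_openD(1)[OF assms(1)]] Union_points[OF cp3_openD(1)[OF assms(2)]] by blast
  then show "open {x. x \<noteq> 0 \<and> hline x \<in> W \<inter> W'}"
    using cp3_openD(2) assms by auto
qed

lemma cp3_open_CP3: "cp3_open CP3"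
proof (rule cp3_openI)
  have "{x. x \<noteq> 0 \<and> hline x \<in> CP3} = - {0}"
    by (auto simp: hline_CP3)
  then show "open {x. x \<noteq> 0 \<and> hline x \<in> CP3}"
    by (simp add: open_Compl)
qed simp

section \<open>Holomorphic maps to scalars, groups and vectors\<close>

lemma cp3_holo_const: "cp3_holo W (\<lambda>_. c)"
  by (simp add: cp3_holo_def holo_on_const)

lemma cp3_holo_add: "cp3_holo W f \<Longrightarrow> cp3_holo W g \<Longrightarrow> cp3_holo W (\<lambda>p. f p + g p)"
  by (simp add: cp3_holo_def holo_on_add)

lemma cp3_holo_mult: "cp3_holo W f \<Longrightarrow> cp3_holo W g \<Longrightarrow> cp3_holo W (\<lambda>p. f p * g p)"
  by (simp add: cp3_holo_def holo_on_mult)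

lemma cp3_holo_sum: "(\<And>i. i \<in> I \<Longrightarrow> cp3_holo W (f i)) \<Longrightarrow> cp3_holo W (\<lambda>p. \<Sum>i\<in>I. f i p)"
  by (simp add: cp3_holo_def holo_on_sum)

lemma cp3_holo_prod: "(\<And>i. i \<in> I \<Longrightarrow> cp3_holo W (f i)) \<Longrightarrow> cp3_holo W (\<lambda>p. \<Prod>i\<in>I. f i p)"
  by (induction I rule: infinite_finite_induct) (auto intro: cp3_holo_const cp3_holo_mult)

lemma cp3_holo_inverse:
  assumes "cp3_open W" "cp3_holo W f" "\<And>p. p \<in> W \<Longrightarrow> f p \<noteq> 0"
  shows "cp3_holo W (\<lambda>p. inverse (f p))"
  unfolding cp3_holo_def
  by (rule holo_on_inverse) (use assms cp3_open_hline[OF assms(1)] in \<open>simp_all add: cp3_holo_def\<close>)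

lemma cp3_holo_subset: "cp3_holo W f \<Longrightarrow> W' \<subseteq> W \<Longrightarrow> cp3_holo W' f"
  unfolding cp3_holo_def by (erule holo_on_subset) blast

lemma cp3_holo_cong:
  assumes "cp3_open W" "cp3_holo W f" "\<And>p. p \<in> W \<Longrightarrow> g p = f p"
  shows "cp3_holo W g"
  using assms(2) unfolding cp3_holo_def
  by (rule holo_on_cong[OF cp3_openD(2)[OF assms(1)]])
     (use assms(3) cp3_open_hline[OF assms(1)] in blast)

text \<open>Holomorphy asks at each point for a derivative in the full space, which does not refer
  to the domain; a cover by arbitrary sets therefore suffices.\<close>

lemma cp3_holo_local:
  assumes "\<And>p. p \<in> W \<Longrightarrow> \<exists>W'. p \<in> W' \<and> cp3_holo W' f"
  shows "cp3_holo W f"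
  unfolding cp3_holo_def holo_on_def
proof
  fix x assume "x \<in> \<Union>W"
  then obtain p W' where "x \<in> p" "p \<in> W'" "cp3_holo W' f"
    using assms by blast
  then show "\<exists>f'. ((\<lambda>x. f (hline x)) has_derivative f') (at x) \<and> (\<forall>c v. f' (c *s v) = c * f' v)"
    unfolding cp3_holo_def holo_on_def by blast
qed

lemma cp3_holo_regular:
  assumes f: "regular_on S D f" and W: "cp3_open W" and g: "\<And>p. p \<in> W \<Longrightarrow> g p \<in> D"
    and gen: "\<And>s. s \<in> S \<Longrightarrow> cp3_holo W (\<lambda>p. s (g p))"
  shows "cp3_holo W (\<lambda>p. f (g p))"
proof -
  obtain h where h: "h \<in> function_algebra S" "\<forall>x\<in>D. f x = h x"
    using f by (auto simp: regular_on_def)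
  from h(1) have "cp3_holo W (\<lambda>p. h (g p))"
    by induction (auto intro: gen cp3_holo_const cp3_holo_add cp3_holo_mult)
  then show ?thesis
    by (rule cp3_holo_cong[OF W]) (use h(2) g in auto)
qed

lemma cp3_holo_det:
  fixes M :: "point \<Rightarrow> complex^'n^'n"
  shows "(\<And>i j. cp3_holo W (\<lambda>p. M p $ i $ j)) \<Longrightarrow> cp3_holo W (\<lambda>p. det (M p))"
  unfolding det_def by (intro cp3_holo_sum cp3_holo_mult cp3_holo_prod cp3_holo_const)

text \<open>\<open>holo_group\<close> controls the matrix entries only. The other generator, the
  reciprocal of the determinant, is holomorphic because the determinant has no zero on
  \<open>GL\<close>.\<close>

lemma cp3_holo_group_regular:
  assumes f: "regular_on GL_gens G f" and W: "cp3_open W" and g: "holo_group G W g" and G: "G \<subseteq> GL"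
  shows "cp3_holo W (\<lambda>p. f (g p))"
proof (rule cp3_holo_regular[OF f W])
  show "g p \<in> G" if "p \<in> W" for p
    using g that by (simp add: holo_group_def)
  fix s :: "complex^'a^'a \<Rightarrow> complex" assume "s \<in> GL_gens"
  then consider i j where "s = (\<lambda>A. A $ i $ j)" | "s = (\<lambda>A. inverse (det A))"
    by (auto simp: GL_gens_def)
  then show "cp3_holo W (\<lambda>p. s (g p))"
  proof cases
    case 1
    then show ?thesis using g by (simp add: holo_group_def)
  next
    case 2
    have "cp3_holo W (\<lambda>p. det (g p))"
      using g by (intro cp3_holo_det) (simp add: holo_group_def)
    moreover have "det (g p) \<noteq> 0" if "p \<in> W" for p
      using g G that det_nonzero_GL[of "g p"] by (auto simp: holo_group_def)
    ultimately show ?thesis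
      unfolding 2 by (intro cp3_holo_inverse W) auto
  qed
qed

text \<open>The counterpart of \<open>holo_group\<close> for the nonzero complex numbers, which are
  not given as a matrix group here.\<close>

definition holo_Cstar :: "point set \<Rightarrow> (point \<Rightarrow> complex) \<Rightarrow> bool" where
  "holo_Cstar W t \<longleftrightarrow> (\<forall>p\<in>W. t p \<noteq> 0) \<and> cp3_holo W t"

lemma holo_group_cochar:
  assumes lam: "cocharacter T lam" and "T \<subseteq> G" and t: "holo_Cstar W t" and W: "cp3_open W"
  shows "holo_group G W (\<lambda>p. lam (t p))"
  unfolding holo_group_def
proof (intro conjI allI ballI)
  show "lam (t p) \<in> G" if "p \<in> W" for p
    using assms that unfolding holo_Cstar_def cocharacter_def by blast
  fix i j
  show "cp3_holo W (\<lambda>p. lam (t p) $ i $ j)"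
  proof (rule cp3_holo_regular[where f = "\<lambda>t. lam t $ i $ j" and g = t and D = "- {0}" and S = Cstar_gens])
    show "regular_on Cstar_gens (- {0}) (\<lambda>t. lam t $ i $ j)"
      using lam by (simp add: cocharacter_def)
    show "cp3_holo W (\<lambda>p. s (t p))" if "s \<in> Cstar_gens" for s
      using that t cp3_holo_inverse[OF W, of t] by (auto simp: Cstar_gens_def holo_Cstar_def)
  qed (use W t in \<open>auto simp: holo_Cstar_def\<close>)
qed

lemma holo_group_mult:
  assumes "holo_group G W g" "holo_group G W h" "\<And>a b. a \<in> G \<Longrightarrow> b \<in> G \<Longrightarrow> a ** b \<in> G"
  shows "holo_group G W (\<lambda>p. g p ** h p)"
  using assms unfolding holo_group_def matrix_matrix_mult_def
  by (simp add: cp3_holo_sum cp3_holo_mult)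

lemma holo_group_const: "a \<in> G \<Longrightarrow> holo_group G W (\<lambda>_. a)"
  by (simp add: holo_group_def cp3_holo_const)

lemma holo_group_local:
  assumes "cp3_open W"
    and "\<And>p. p \<in> W \<Longrightarrow> \<exists>W' h. cp3_open W' \<and> p \<in> W' \<and> W' \<subseteq> W \<and> holo_group G W' h \<and> (\<forall>x\<in>W'. g x = h x)"
  shows "holo_group G W g"
  unfolding holo_group_def
proof (intro conjI ballI allI)
  show "g p \<in> G" if "p \<in> W" for p
    using assms(2)[OF that] unfolding holo_group_def by fastforce
  fix i j
  show "cp3_holo W (\<lambda>p. g p $ i $ j)"
  proof (rule cp3_holo_local)
    fix p assume "p \<in> W"
    then obtain W' h where W': "cp3_open W'" "p \<in> W'" "holo_group G W' h" "\<forall>x\<in>W'. g x = h x"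
      using assms(2) by blast
    have "cp3_holo W' (\<lambda>p. g p $ i $ j)"
      by (rule cp3_holo_cong[OF W'(1), of "\<lambda>p. h p $ i $ j"])
         (use W' in \<open>auto simp: holo_group_def\<close>)
    then show "\<exists>W'. p \<in> W' \<and> cp3_holo W' (\<lambda>p. g p $ i $ j)"
      using W'(2) by blast
  qed
qed

lemma holo_group_subset: "holo_group G W g \<Longrightarrow> W' \<subseteq> W \<Longrightarrow> holo_group G W' g"
  unfolding holo_group_def by (blast intro: cp3_holo_subset)

lemma holo_vec_local:
  assumes "cp3_open W"
    and "\<And>p. p \<in> W \<Longrightarrow> \<exists>W' h. cp3_open W' \<and> p \<in> W' \<and> W' \<subseteq> W \<and> holo_vec smul W' h \<and> (\<forall>x\<in>W'. g x = h x)"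
  shows "holo_vec smul W g"
  unfolding holo_vec_def
proof (intro allI impI, rule cp3_holo_local)
  fix \<phi> p assume \<phi>: "linear_functional smul \<phi>" and "p \<in> W"
  then obtain W' h where W': "cp3_open W'" "p \<in> W'" "holo_vec smul W' h" "\<forall>x\<in>W'. g x = h x"
    using assms(2) by blast
  have "cp3_holo W' (\<lambda>p. \<phi> (g p))"
    by (rule cp3_holo_cong[OF W'(1), of "\<lambda>p. \<phi> (h p)"]) (use W' \<phi> in \<open>auto simp: holo_vec_def\<close>)
  then show "\<exists>W'. p \<in> W' \<and> cp3_holo W' (\<lambda>p. \<phi> (g p))"
    using W'(2) by blast
qed

lemma holo_vec_subset: "holo_vec smul W f \<Longrightarrow> W' \<subseteq> W \<Longrightarrow> holo_vec smul W' f"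
  unfolding holo_vec_def by (blast intro: cp3_holo_subset)

lemma holo_vec_cong:
  assumes "cp3_open W" "holo_vec smul W f" "\<And>p. p \<in> W \<Longrightarrow> g p = f p"
  shows "holo_vec smul W g"
  unfolding holo_vec_def
proof (intro allI impI)
  fix \<phi> assume "linear_functional smul \<phi>"
  then have "cp3_holo W (\<lambda>p. \<phi> (f p))"
    using assms(2) by (simp add: holo_vec_def)
  then show "cp3_holo W (\<lambda>p. \<phi> (g p))"
    by (rule cp3_holo_cong[OF assms(1)]) (simp add: assms(3))
qed

text \<open>Expanding \<open>f p\<close> in the basis \<open>B\<close> separates the two
  dependencies on \<open>p\<close>: each summand is a holomorphic coordinate of \<open>f\<close>
  times a matrix coefficient evaluated at \<open>g\<close>.\<close>

lemma holo_vec_rho: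
  assumes fd: "finite_dimensional_vector_space smul B" and \<rho>: "rational_representation G smul \<rho>"
    and G: "G \<subseteq> GL" and W: "cp3_open W" and g: "holo_group G W g" and f: "holo_vec smul W f"
  shows "holo_vec smul W (\<lambda>p. \<rho> (g p) (f p))"
  unfolding holo_vec_def
proof (intro allI impI)
  interpret finite_dimensional_vector_space smul B by (rule fd)
  fix \<phi> assume \<phi>: "linear_functional smul \<phi>"
  have eq: "\<phi> (\<rho> (g p) (f p)) = (\<Sum>b\<in>B. representation B (f p) b * \<phi> (\<rho> (g p) b))" if "p \<in> W" for p
  proof -
    have "Vector_Spaces.linear smul smul (\<rho> (g p))"
      using \<rho> g that unfolding rational_representation_def holo_group_def by blast
    then have "linear_functional smul (\<lambda>v. \<phi> (\<rho> (g p) v))"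
      using \<phi> by (simp add: linear_functional_iff[OF fd] Vector_Spaces.linear_def module_hom_iff)
    from functional_expansion[OF fd this, of "f p"] show ?thesis .
  qed
  have "cp3_holo W (\<lambda>p. \<Sum>b\<in>B. representation B (f p) b * \<phi> (\<rho> (g p) b))"
  proof (intro cp3_holo_sum cp3_holo_mult)
    fix b
    show "cp3_holo W (\<lambda>p. representation B (f p) b)"
      using f linear_functional_coord[OF fd, of b] unfolding holo_vec_def by blast
    have "regular_on GL_gens G (\<lambda>g. \<phi> (\<rho> g b))"
      using \<rho> \<phi> unfolding rational_representation_def by blast
    then show "cp3_holo W (\<lambda>p. \<phi> (\<rho> (g p) b))"
      by (rule cp3_holo_group_regular[OF _ W g G])
  qed
  then show "cp3_holo W (\<lambda>p. \<phi> (\<rho> (g p) (f p)))"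
    by (rule cp3_holo_cong[OF W]) (rule eq)
qed

section \<open>The bundle of nonzero vectors of O(-2)\<close>

lemma pfib_L_Q:
  assumes p: "p \<in> CP3"
  shows "l \<in> pfib (nonzero_vectors L_Q) p \<longleftrightarrow>
    (\<forall>x\<in>p. l x \<noteq> 0 \<and> (\<forall>t. t \<noteq> 0 \<longrightarrow> l (t *s x) = t powi (-2) * l x)) \<and> (\<forall>x. x \<notin> p \<longrightarrow> l x = 0)"
    (is "_ \<longleftrightarrow> ?R")
proof
  assume l: "l \<in> pfib (nonzero_vectors L_Q) p"
  then have h: "\<And>x t. x \<in> p \<Longrightarrow> t \<noteq> 0 \<Longrightarrow> l (t *s x) = t powi (-2) * l x" "\<And>x. x \<notin> p \<Longrightarrow> l x = 0"
    and "l \<noteq> (\<lambda>x. 0)"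
    by (auto simp: nonzero_vectors_def L_Q_def O_bundle_def twisted_bundle_def twisted_fib_def)
  then obtain x where x: "x \<in> p" "l x \<noteq> 0"
    by blast
  \<comment> \<open>Homogeneity propagates one nonzero value to the whole punctured line, so a
    nonzero vector of the fibre vanishes nowhere on \<open>p\<close>.\<close>
  have "l y \<noteq> 0" if y: "y \<in> p" for y
  proof -
    obtain t where "t \<noteq> 0" "y = t *s x"
      using CP3_scale_obtain[OF p x(1) y] by blast
    then show ?thesis
      using h(1)[OF x(1), of t] x(2) by simp
  qed
  then show ?R using h by blast
next
  assume R: ?R
  obtain x where "x \<in> p" using CP3_obtain[OF p] .
  then have "l \<noteq> (\<lambda>x. 0)" using R by auto
  then show "l \<in> pfib (nonzero_vectors L_Q) p"
    using R by (auto simp: nonzero_vectors_def L_Q_def O_bundle_def twisted_bundle_def twisted_fib_def)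
qed

lemma pact_L_Q: "pact (nonzero_vectors L_Q) p l t = (\<lambda>x. t * l x)"
  by (simp add: nonzero_vectors_def L_Q_def O_bundle_def twisted_bundle_def)

lemma linear_functional_complex:
  assumes "linear_functional ((*) :: complex \<Rightarrow> _) \<phi>"
  shows "\<phi> v = v * \<phi> 1"
proof -
  have "\<forall>c w. \<phi> (c * w) = c * \<phi> w"
    using assms by (simp add: linear_functional_def Vector_Spaces.linear_def module_hom_iff)
  from this[rule_format, of v 1] show ?thesis by simp
qed

lemma linear_functional_id: "linear_functional ((*) :: complex \<Rightarrow> _) (\<lambda>v. v)"
proof -
  have "vector_space ((*) :: complex \<Rightarrow> _)"
    by unfold_locales (auto simp: algebra_simps)
  then show ?thesis
    by (simp add: linear_functional_def Vector_Spaces.linear_def module_hom_iff module_iff_vector_space)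
qed

text \<open>\<open>twisted_bundle\<close> tests holomorphy through all linear functionals. On the
  complex numbers these are the multiples of the identity, so for line bundles one condition
  remains.\<close>

lemma holo_functionals_complex:
  "(\<forall>\<phi>. linear_functional ((*) :: complex \<Rightarrow> _) \<phi> \<longrightarrow> holo_on (\<lambda>x. \<phi> (f x)) S) \<longleftrightarrow> holo_on f S"
proof
  assume f: "holo_on f S"
  show "\<forall>\<phi>. linear_functional (*) \<phi> \<longrightarrow> holo_on (\<lambda>x. \<phi> (f x)) S"
  proof (intro allI impI)
    fix \<phi> :: "complex \<Rightarrow> complex" assume "linear_functional (*) \<phi>"
    then have "(\<lambda>x. \<phi> (f x)) = (\<lambda>x. f x * \<phi> 1)"
      using linear_functional_complex by blast
    then show "holo_on (\<lambda>x. \<phi> (f x)) S"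
      using holo_on_mult[OF f holo_on_const] by simp
  qed
qed (use linear_functional_id in blast)

lemma psec_L_Q:
  "psec (nonzero_vectors L_Q) W l \<longleftrightarrow>
     (\<forall>p\<in>W. l p \<in> pfib (nonzero_vectors L_Q) p) \<and> holo_on (\<lambda>x. l (hline x) x) (\<Union>W)"
  by (auto simp: nonzero_vectors_def L_Q_def O_bundle_def twisted_bundle_def holo_functionals_complex)

lemma psec_L_Q_subset:
  "psec (nonzero_vectors L_Q) W l \<Longrightarrow> W' \<subseteq> W \<Longrightarrow> psec (nonzero_vectors L_Q) W' l"
  unfolding psec_L_Q by (blast intro: holo_on_subset)

lemma pfib_L_QD:
  assumes "p \<in> CP3" "l \<in> pfib (nonzero_vectors L_Q) p"
  shows "x \<in> p \<Longrightarrow> l x \<noteq> 0" "x \<in> p \<Longrightarrow> t \<noteq> 0 \<Longrightarrow> l (t *s x) = t powi (-2) * l x"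
    "x \<notin> p \<Longrightarrow> l x = 0"
  using assms(2) unfolding pfib_L_Q[OF assms(1)] by blast+

text \<open>Both vectors are homogeneous of the same degree, so their quotient is constant on the
  punctured line and does not depend on \<open>x\<close>.\<close>

lemma L_Q_ratio:
  assumes p: "p \<in> CP3" and l: "l \<in> pfib (nonzero_vectors L_Q) p" "l' \<in> pfib (nonzero_vectors L_Q) p"
    and x: "x \<in> p"
  shows "l' x / l x \<noteq> 0" "l' = pact (nonzero_vectors L_Q) p l (l' x / l x)"
proof -
  note nz = pfib_L_QD(1)[OF p l(1) x] pfib_L_QD(1)[OF p l(2) x]
  show "l' x / l x \<noteq> 0" using nz by simp
  have "l' y = (l' x / l x) * l y" for y
  proof (cases "y \<in> p")
    case True
    obtain t where t: "t \<noteq> 0" "y = t *s x"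
      by (rule CP3_scale_obtain[OF p x True])
    have "c * l' x = l' x / l x * (c * l x)" for c
      using nz(1) by (simp add: field_simps)
    then show ?thesis
      by (simp only: t(2) pfib_L_QD(2)[OF p l(1) x t(1)] pfib_L_QD(2)[OF p l(2) x t(1)])
  next
    case False
    show ?thesis
      by (simp only: pfib_L_QD(3)[OF p l(1) False] pfib_L_QD(3)[OF p l(2) False] mult_zero_right)
  qed
  then show "l' = pact (nonzero_vectors L_Q) p l (l' x / l x)"
    unfolding pact_L_Q by (rule ext)
qed

lemma psec_L_Q_ratio:
  assumes W: "cp3_open W" and l: "psec (nonzero_vectors L_Q) W l" "psec (nonzero_vectors L_Q) W l'"
  shows "\<exists>t. holo_Cstar W t \<and> (\<forall>p\<in>W. l' p = pact (nonzero_vectors L_Q) p (l p) (t p))"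
proof -
  \<comment> \<open>Any vector of the line serves, as the quotient is constant there. To see
    holomorphy, \<open>eq\<close> below replaces the chosen vector by the variable itself.\<close>
  define t where "t p = l' p (SOME x. x \<in> p) / l p (SOME x. x \<in> p)" for p
  have *: "t p \<noteq> 0 \<and> l' p = pact (nonzero_vectors L_Q) p (l p) (t p)" if p: "p \<in> W" for p
  proof -
    have "p \<in> CP3" using p cp3_openD(1)[OF W] by blast
    then obtain x where "x \<in> p" by (rule CP3_obtain)
    then have x: "(SOME x. x \<in> p) \<in> p" by (rule someI[of "\<lambda>x. x \<in> p"])
    have "l p \<in> pfib (nonzero_vectors L_Q) p" "l' p \<in> pfib (nonzero_vectors L_Q) p"
      using l p unfolding psec_L_Q by blast+
    from L_Q_ratio[OF \<open>p \<in> CP3\<close> this x] show ?thesis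
      unfolding t_def ..
  qed
  have nz: "l (hline x) x \<noteq> 0" if "x \<in> \<Union>W" for x
  proof -
    have h: "hline x \<in> W" using cp3_open_hline[OF W that] .
    then have "l (hline x) \<in> pfib (nonzero_vectors L_Q) (hline x)" "hline x \<in> CP3"
      using l(1) cp3_openD(1)[OF W] by (auto simp: psec_L_Q)
    then show ?thesis using hline_self[of x] pfib_L_QD(1) by blast
  qed
  have eq: "t (hline x) = l' (hline x) x * inverse (l (hline x) x)" if "x \<in> \<Union>W" for x
  proof -
    have "l' (hline x) x = t (hline x) * l (hline x) x"
      using fun_cong[OF conjunct2[OF *[OF cp3_open_hline[OF W that]]], of x] by (simp add: pact_L_Q)
    then show ?thesis using nz[OF that] by simp
  qed
  have "holo_on (\<lambda>x. l' (hline x) x * inverse (l (hline x) x)) (\<Union>W)"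
    using l nz by (intro holo_on_mult holo_on_inverse) (auto simp: psec_L_Q)
  then have "cp3_holo W t"
    unfolding cp3_holo_def by (rule holo_on_cong[OF cp3_openD(2)[OF W]]) (rule eq)
  then show ?thesis
    using * by (auto simp: holo_Cstar_def)
qed

lemma L_Q_local_section:
  assumes p: "p \<in> CP3"
  obtains W l where "cp3_open W" "p \<in> W" "psec (nonzero_vectors L_Q) W l"
proof -
  obtain x where x: "x \<in> p" using CP3_obtain[OF p] .
  then obtain i where i: "x $ i \<noteq> 0"
    using CP3_nonzero[OF p] by (metis vec_eq_iff zero_index)
  define W where "W = {p \<in> CP3. \<forall>y\<in>p. y $ i \<noteq> 0}"
  \<comment> \<open>The reciprocal square of a coordinate has degree -2 and trivializes O(-2) on the
    standard chart where this coordinate is nonzero.\<close>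
  define l where "l p y = (if y \<in> p then (y $ i) powi (-2) else 0)" for p :: point and y
  have eq: "{y. y \<noteq> 0 \<and> hline y \<in> W} = {y. y $ i \<noteq> 0}"
  proof (intro Collect_cong iffI)
    fix y :: "complex^4"
    show "y $ i \<noteq> 0" if "y \<noteq> 0 \<and> hline y \<in> W"
      using that hline_self by (auto simp: W_def)
    show "y \<noteq> 0 \<and> hline y \<in> W" if "y $ i \<noteq> 0"
      using that by (auto simp: W_def hline_mem intro!: hline_CP3)
  qed
  have W: "cp3_open W"
  proof (rule cp3_openI)
    show "open {y. y \<noteq> 0 \<and> hline y \<in> W}"
      unfolding eq by (intro open_Collect_neq continuous_intros)
  qed (auto simp: W_def)
  have "p \<in> W"
    using p x i by (auto simp: W_def elim!: CP3_scale_obtain[OF p x])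
  moreover have "psec (nonzero_vectors L_Q) W l"
    unfolding psec_L_Q
  proof (intro conjI ballI)
    show "l p \<in> pfib (nonzero_vectors L_Q) p" if "p \<in> W" for p
    proof -
      have "p \<in> CP3" "\<forall>y\<in>p. y $ i \<noteq> 0" using that by (auto simp: W_def)
      then show ?thesis
        by (auto simp: pfib_L_Q l_def power_int_mult_distrib CP3_scale)
    qed
    have "holo_on (\<lambda>y. (y $ i) powi (-2)) (\<Union>W)"
      by (intro holo_on_power_int holo_on_coord) (auto simp: W_def)
    then show "holo_on (\<lambda>y. l (hline y) y) (\<Union>W)"
      by (rule holo_on_cong[OF cp3_openD(2)[OF W]]) (simp add: l_def hline_self)
  qed
  ultimately show thesis using that W by blast
qed

section \<open>Associated bundles and frames\<close>

text \<open>The group operations are parameters because two kinds of groups occur: the nonzero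
  numbers acting on the fibre \<open>G\<close> through \<open>lam\<close>, and the matrix group
  \<open>G\<close> acting on \<open>V\<close>. On the minus sheet the two constructions are
  nested.\<close>

locale assoc_action =
  fixes H :: "'h set" and mult :: "'h \<Rightarrow> 'h \<Rightarrow> 'h" and one :: 'h and inv :: "'h \<Rightarrow> 'h"
    and P :: "('h, 'e) pbundle" and act :: "'h \<Rightarrow> 'f \<Rightarrow> 'f" and F :: "'f set"
  assumes one_in: "one \<in> H"
    and mult_in: "g \<in> H \<Longrightarrow> h \<in> H \<Longrightarrow> mult g h \<in> H"
    and inv_in: "h \<in> H \<Longrightarrow> inv h \<in> H"
    and mult_assoc: "g \<in> H \<Longrightarrow> h \<in> H \<Longrightarrow> k \<in> H \<Longrightarrow> mult (mult g h) k = mult g (mult h k)"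
    and mult_one: "h \<in> H \<Longrightarrow> mult h one = h" "h \<in> H \<Longrightarrow> mult one h = h"
    and mult_inv: "h \<in> H \<Longrightarrow> mult h (inv h) = one"
    and inv_mult: "h \<in> H \<Longrightarrow> mult (inv h) h = one"
    and pact_in: "p \<in> CP3 \<Longrightarrow> e \<in> pfib P p \<Longrightarrow> h \<in> H \<Longrightarrow> pact P p e h \<in> pfib P p"
    and pact_one: "p \<in> CP3 \<Longrightarrow> e \<in> pfib P p \<Longrightarrow> pact P p e one = e"
    and pact_mult: "p \<in> CP3 \<Longrightarrow> e \<in> pfib P p \<Longrightarrow> g \<in> H \<Longrightarrow> h \<in> H \<Longrightarrow>
      pact P p e (mult g h) = pact P p (pact P p e g) h"
    and pact_transitive: "p \<in> CP3 \<Longrightarrow> e \<in> pfib P p \<Longrightarrow> e' \<in> pfib P p \<Longrightarrow> \<exists>h\<in>H. e' = pact P p e h"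
    and pact_free: "p \<in> CP3 \<Longrightarrow> e \<in> pfib P p \<Longrightarrow> h \<in> H \<Longrightarrow> pact P p e h = e \<Longrightarrow> h = one"
    and act_in: "h \<in> H \<Longrightarrow> f \<in> F \<Longrightarrow> act h f \<in> F"
    and act_one: "f \<in> F \<Longrightarrow> act one f = f"
    and act_mult: "g \<in> H \<Longrightarrow> h \<in> H \<Longrightarrow> f \<in> F \<Longrightarrow> act (mult g h) f = act g (act h f)"
begin

abbreviation cls :: "point \<Rightarrow> 'e \<Rightarrow> 'f \<Rightarrow> ('e \<times> 'f) set" where
  "cls \<equiv> assoc_class H act F P"

lemma pact_inj:
  assumes p: "p \<in> CP3" "e \<in> pfib P p" and h: "h \<in> H" "k \<in> H" and eq: "pact P p e h = pact P p e k"
  shows "h = k"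
proof -
  have hk: "mult h (inv k) \<in> H" by (rule mult_in[OF h(1) inv_in[OF h(2)]])
  have "pact P p e (mult h (inv k)) = pact P p (pact P p e h) (inv k)"
    by (rule pact_mult[OF p h(1) inv_in[OF h(2)]])
  also have "\<dots> = pact P p e (mult k (inv k))"
    unfolding eq by (rule pact_mult[OF p h(2) inv_in[OF h(2)], symmetric])
  also have "\<dots> = e"
    unfolding mult_inv[OF h(2)] by (rule pact_one[OF p])
  finally have one: "mult h (inv k) = one"
    by (rule pact_free[OF p hk])
  have "h = mult h (mult (inv k) k)"
    unfolding inv_mult[OF h(2)] mult_one(1)[OF h(1)] ..
  also have "\<dots> = k"
    unfolding mult_assoc[OF h(1) inv_in[OF h(2)] h(2), symmetric] one by (rule mult_one(2)[OF h(2)])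
  finally show ?thesis .
qed

lemma pact_bij:
  assumes "p \<in> CP3" "e \<in> pfib P p"
  shows "bij_betw (pact P p e) H (pfib P p)"
proof (rule bij_betw_imageI)
  show "inj_on (pact P p e) H" using pact_inj[OF assms] by (rule inj_onI)
  show "pact P p e ` H = pfib P p" using pact_in[OF assms] pact_transitive[OF assms] by auto
qed

text \<open>Parametrizes the class of \<open>(e, f)\<close> by the group. This makes maps given by
  their effect on representatives computable, as their values on a class become images of
  \<open>H\<close>.\<close>

lemma cls_explicit:
  assumes p: "p \<in> CP3" and e: "e \<in> pfib P p" and f: "f \<in> F"
  shows "cls p e f = (\<lambda>h. (pact P p e h, act (inv h) f)) ` H"
proof (rule set_eqI, rule iffI)
  fix z assume "z \<in> cls p e f"
  then obtain e' f' h where z: "z = (e', f')" "e' \<in> pfib P p" "h \<in> H" "e = pact P p e' h" "f' = act h f"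
    unfolding assoc_class_def assoc_rel_def by auto
  \<comment> \<open>\<open>assoc_rel\<close> moves from \<open>e\<close> to \<open>e'\<close> by the
    inverse of \<open>h\<close>, so the parameter of a member is \<open>inv h\<close> and a double
    inverse appears.\<close>
  have "act (inv (inv h)) f = act h f"
  proof -
    have "act (inv (inv h)) f = act (inv (inv h)) (act (mult (inv h) h) f)"
      using z(3) f by (simp add: inv_mult act_one)
    also have "\<dots> = act (mult (inv (inv h)) (inv h)) (act h f)"
      using z(3) f by (simp add: act_mult inv_in act_in)
    also have "\<dots> = act h f"
      using z(3) f by (simp add: inv_mult inv_in act_one act_in)
    finally show ?thesis .
  qed
  moreover have "pact P p e (inv h) = e'"
    using pact_mult[OF p z(2,3) inv_in[OF z(3)]] z by (simp add: mult_inv pact_one p)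
  ultimately show "z \<in> (\<lambda>h. (pact P p e h, act (inv h) f)) ` H"
    using z inv_in[OF z(3)] by (intro image_eqI[of _ _ "inv h"]) simp_all
next
  fix z assume "z \<in> (\<lambda>h. (pact P p e h, act (inv h) f)) ` H"
  then obtain h where h: "h \<in> H" "z = (pact P p e h, act (inv h) f)" by blast
  have "e = pact P p (pact P p e h) (inv h)"
    using pact_mult[OF p e h(1) inv_in[OF h(1)]] by (simp add: mult_inv h pact_one p e)
  then show "z \<in> cls p e f"
    using h p e f inv_in[OF h(1)] unfolding assoc_class_def assoc_rel_def
    by (auto simp: pact_in act_in intro!: bexI[of _ "inv h"])
qed

text \<open>Freeness leaves exactly one representative whose first entry is \<open>e\<close>. The
  definite descriptions in \<open>plus_iso\<close> and \<open>minus_iso\<close> read it off.\<close>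

lemma cls_mem_same:
  assumes "p \<in> CP3" "e \<in> pfib P p" "f \<in> F"
  shows "(e, f') \<in> cls p e f \<longleftrightarrow> f' = f"
proof
  assume "(e, f') \<in> cls p e f"
  then obtain h where h: "h \<in> H" "e = pact P p e h" "f' = act h f"
    unfolding assoc_class_def assoc_rel_def by auto
  then have "h = one" using pact_free assms by metis
  then show "f' = f" using h assms by (simp add: act_one)
next
  assume "f' = f"
  moreover have "\<exists>h\<in>H. e = pact P p e h \<and> f = act h f"
    using one_in assms by (intro bexI[of _ one]) (simp_all add: pact_one act_one)
  ultimately show "(e, f') \<in> cls p e f"
    using assms unfolding assoc_class_def assoc_rel_def by blast
qed

lemma cls_inj: "p \<in> CP3 \<Longrightarrow> e \<in> pfib P p \<Longrightarrow> f \<in> F \<Longrightarrow> f' \<in> F \<Longrightarrow> cls p e f = cls p e f' \<Longrightarrow> f = f'"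
  using cls_mem_same[of p e f f] cls_mem_same[of p e f' f] by simp

lemma cls_pact:
  assumes p: "p \<in> CP3" and e: "e \<in> pfib P p" and f: "f \<in> F" and h: "h \<in> H"
  shows "cls p (pact P p e h) f = cls p e (act h f)"
proof -
  \<comment> \<open>One inclusion is proved for all data; applied to \<open>pact P p e h\<close> and
    \<open>inv h\<close> it yields the other.\<close>
  have sub: "cls p (pact P p e h) f \<subseteq> cls p e (act h f)"
    if e: "e \<in> pfib P p" and f: "f \<in> F" and h: "h \<in> H" for e f h
  proof (rule subsetI)
    fix z assume "z \<in> cls p (pact P p e h) f"
    then obtain e' f' k where z: "z = (e', f')" "e' \<in> pfib P p" "k \<in> H"
        "pact P p e h = pact P p e' k" "f' = act k f"
      unfolding assoc_class_def assoc_rel_def by auto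
    define k' where "k' = mult k (inv h)"
    have k': "k' \<in> H" using z h by (simp add: k'_def mult_in inv_in)
    have "pact P p e' k' = pact P p (pact P p e h) (inv h)"
      using z h by (simp add: k'_def pact_mult p inv_in)
    also have "\<dots> = pact P p e (mult h (inv h))"
      using e h by (simp add: pact_mult p inv_in)
    also have "\<dots> = e" using e h by (simp add: mult_inv pact_one p)
    finally have 1: "e = pact P p e' k'" ..
    have "act k' (act h f) = act k (act (mult (inv h) h) f)"
      using z h f unfolding k'_def by (simp only: act_mult act_in inv_in)
    also have "\<dots> = f'" using z h f by (simp add: inv_mult act_one)
    finally have 2: "f' = act k' (act h f)" ..
    show "z \<in> cls p e (act h f)"
      unfolding assoc_class_def assoc_rel_def z(1)
      using 1 2 k' z(2) e f h z(3,5) by (auto simp: act_in)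
  qed
  have "cls p e (act h f) = cls p (pact P p (pact P p e h) (inv h)) (act h f)"
    using pact_mult[OF p e h inv_in[OF h]] by (simp add: mult_inv h pact_one p e)
  also have "\<dots> \<subseteq> cls p (pact P p e h) (act (inv h) (act h f))"
    using sub[of "pact P p e h" "act h f" "inv h"] by (simp add: pact_in p e h act_in f inv_in)
  also have "act (inv h) (act h f) = f"
    using act_mult[OF inv_in[OF h] h f] by (simp add: inv_mult h act_one f)
  finally show ?thesis
    using sub[OF e f h] by blast
qed

text \<open>By transitivity every class has a representative over the given \<open>e\<close>, so the
  choice of \<open>e\<close> makes the fibre a copy of \<open>F\<close>.\<close>

lemma assoc_fib_eq:
  assumes p: "p \<in> CP3" and e: "e \<in> pfib P p"
  shows "assoc_fib H act F P p = cls p e ` F"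
proof -
  have "assoc_fib H act F P p = (\<lambda>(e, f). cls p e f) ` (pfib P p \<times> F)"
    by (auto simp: assoc_fib_def quotient_def assoc_class_def)
  also have "\<dots> = cls p e ` F"
  proof (intro equalityI subsetI)
    fix z assume "z \<in> (\<lambda>(e, f). cls p e f) ` (pfib P p \<times> F)"
    then obtain e' f where z: "e' \<in> pfib P p" "f \<in> F" "z = cls p e' f" by auto
    obtain h where "h \<in> H" "e' = pact P p e h"
      using pact_transitive[OF p e z(1)] by blast
    then show "z \<in> cls p e ` F"
      using z cls_pact[OF p e z(2)] act_in by auto
  qed (use e in auto)
  finally show ?thesis .
qed

lemma cls_bij:
  assumes "p \<in> CP3" "e \<in> pfib P p"
  shows "bij_betw (cls p e) F (assoc_fib H act F P p)"
  using assms cls_inj unfolding assoc_fib_eq[OF assms] by (auto simp: bij_betw_def inj_on_def)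

lemma cls_in: "p \<in> CP3 \<Longrightarrow> e \<in> pfib P p \<Longrightarrow> f \<in> F \<Longrightarrow> cls p e f \<in> assoc_fib H act F P p"
  using assoc_fib_eq by auto

text \<open>A section of the associated bundle is only locally of the form [e', g], with varying e'.
  Each e' is \<open>e\<close> times a holomorphic map to the group, which the action moves into the
  second entry, so the fixed section \<open>e\<close> represents everything. The predicates
  \<open>hol\<close> and \<open>holH\<close> stand for holomorphy of maps to the fibre and to the
  group.\<close>

lemma assoc_sec_iff:
  fixes hol :: "point set \<Rightarrow> (point \<Rightarrow> 'f) \<Rightarrow> bool"
    and holH :: "point set \<Rightarrow> (point \<Rightarrow> 'h) \<Rightarrow> bool"
  assumes e: "\<And>x. x \<in> W \<Longrightarrow> e x \<in> pfib P x"
    and sec_e: "\<And>W'. cp3_open W' \<Longrightarrow> W' \<subseteq> W \<Longrightarrow> psec P W' e"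
    and sec: "\<And>W' s. cp3_open W' \<Longrightarrow> W' \<subseteq> W \<Longrightarrow> psec P W' s \<Longrightarrow>
      \<exists>h. holH W' h \<and> (\<forall>x\<in>W'. s x = pact P x (e x) (h x))"
    and holH: "\<And>W' h x. holH W' h \<Longrightarrow> x \<in> W' \<Longrightarrow> h x \<in> H"
    and hol: "\<And>W' f x. hol W' f \<Longrightarrow> x \<in> W' \<Longrightarrow> f x \<in> F"
    and hol_local: "\<And>W' f. cp3_open W' \<Longrightarrow> (\<And>p. p \<in> W' \<Longrightarrow> \<exists>W'' g. cp3_open W'' \<and> p \<in> W'' \<and> W'' \<subseteq> W' \<and>
      hol W'' g \<and> (\<forall>x\<in>W''. f x = g x)) \<Longrightarrow> hol W' f"
    and hol_act: "\<And>W' h f. cp3_open W' \<Longrightarrow> holH W' h \<Longrightarrow> hol W' f \<Longrightarrow> hol W' (\<lambda>x. act (h x) (f x))"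
    and W': "cp3_open W'" "W' \<subseteq> W"
  shows "assoc_sec H act F hol P W' s \<longleftrightarrow> (\<exists>f. hol W' f \<and> (\<forall>x\<in>W'. s x = cls x (e x) (f x)))"
proof
  assume s: "assoc_sec H act F hol P W' s"
  \<comment> \<open>The second entry over \<open>e x\<close> is unique, so the local representatives
    agree with this single function and \<open>hol_local\<close> applies.\<close>
  define f where "f x = (THE w. w \<in> F \<and> s x = cls x (e x) w)" for x
  have f: "f x = w" if "x \<in> W'" "w \<in> F" "s x = cls x (e x) w" for x w
  proof -
    have "x \<in> CP3" "e x \<in> pfib P x" using that(1) W' e cp3_openD(1) by blast+
    then show ?thesis
      unfolding f_def using that cls_inj by (intro the_equality) auto
  qed
  have loc: "\<exists>W'' g. cp3_open W'' \<and> p \<in> W'' \<and> W'' \<subseteq> W' \<and> hol W'' g \<and>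
      (\<forall>x\<in>W''. s x = cls x (e x) (g x))" if p: "p \<in> W'" for p
  proof -
    obtain W'' e' g where W'': "cp3_open W''" "p \<in> W''" "W'' \<subseteq> W'" "psec P W'' e'" "hol W'' g"
        "\<forall>x\<in>W''. s x = cls x (e' x) (g x)"
      using s p unfolding assoc_sec_def by blast
    have "W'' \<subseteq> W" using W''(3) W'(2) by blast
    then obtain h where h: "holH W'' h" "\<forall>x\<in>W''. e' x = pact P x (e x) (h x)"
      using sec[OF W''(1) _ W''(4)] by blast
    have "s x = cls x (e x) (act (h x) (g x))" if x: "x \<in> W''" for x
    proof -
      have "x \<in> CP3" "e x \<in> pfib P x" using x W'' W' e cp3_openD(1) by blast+
      then show ?thesis
        using cls_pact[of x "e x" "g x" "h x"] hol[OF W''(5) x] holH[OF h(1) x] W''(6) h(2) x by simp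
    qed
    then show ?thesis
      using W'' hol_act[OF W''(1) h(1) W''(5)] by blast
  qed
  have "hol W' f"
  proof (rule hol_local[OF W'(1)])
    fix p assume "p \<in> W'"
    then obtain W'' g where g: "cp3_open W''" "p \<in> W''" "W'' \<subseteq> W'" "hol W'' g"
      "\<forall>x\<in>W''. s x = cls x (e x) (g x)"
      using loc by blast
    then have "\<forall>x\<in>W''. f x = g x" using f hol by blast
    then show "\<exists>W'' g. cp3_open W'' \<and> p \<in> W'' \<and> W'' \<subseteq> W' \<and> hol W'' g \<and> (\<forall>x\<in>W''. f x = g x)"
      using g by blast
  qed
  moreover have "s x = cls x (e x) (f x)" if x: "x \<in> W'" for x
  proof -
    obtain W'' g where g: "x \<in> W''" "hol W'' g" "\<forall>x\<in>W''. s x = cls x (e x) (g x)"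
      using loc[OF x] by blast
    then show ?thesis using f[OF x hol[OF g(2,1)]] by simp
  qed
  ultimately show "\<exists>f. hol W' f \<and> (\<forall>x\<in>W'. s x = cls x (e x) (f x))" by blast
next
  assume "\<exists>f. hol W' f \<and> (\<forall>x\<in>W'. s x = cls x (e x) (f x))"
  then show "assoc_sec H act F hol P W' s"
    using W' sec_e[OF W'] unfolding assoc_sec_def by blast
qed

end

section \<open>Gluing and restriction of sections of associated bundles\<close>

lemma assoc_sec_local_condition: "local_condition (assoc_sec H act F hol P)"
  unfolding local_condition_def
proof (intro allI impI iffI ballI)
  fix W s p assume "cp3_open W" "assoc_sec H act F hol P W s" "p \<in> W"
  then show "\<exists>W'. cp3_open W' \<and> p \<in> W' \<and> W' \<subseteq> W \<and> assoc_sec H act F hol P W' s"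
    by blast
next
  fix W s
  assume *: "\<forall>p\<in>W. \<exists>W'. cp3_open W' \<and> p \<in> W' \<and> W' \<subseteq> W \<and> assoc_sec H act F hol P W' s"
  show "assoc_sec H act F hol P W s"
    unfolding assoc_sec_def
  proof
    fix p assume "p \<in> W"
    then obtain W' where W': "p \<in> W'" "W' \<subseteq> W" "assoc_sec H act F hol P W' s"
      using * by blast
    then obtain W'' e f where "cp3_open W''" "p \<in> W''" "W'' \<subseteq> W'" "psec P W'' e" "hol W'' f"
        "\<forall>x\<in>W''. s x = assoc_class H act F P x (e x) (f x)"
      unfolding assoc_sec_def by blast
    then show "\<exists>W' e f. cp3_open W' \<and> p \<in> W' \<and> W' \<subseteq> W \<and> psec P W' e \<and> hol W' f \<and>
        (\<forall>x\<in>W'. s x = assoc_class H act F P x (e x) (f x))"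
      using W'(2) by blast
  qed
qed

lemma assoc_sec_subset:
  assumes s: "assoc_sec H act F hol P W s" and W': "cp3_open W'" "W' \<subseteq> W"
    and psec: "\<And>V V' e. psec P V e \<Longrightarrow> cp3_open V' \<Longrightarrow> V' \<subseteq> V \<Longrightarrow> psec P V' e"
    and hol: "\<And>V V' f. hol V f \<Longrightarrow> V' \<subseteq> V \<Longrightarrow> hol V' f"
  shows "assoc_sec H act F hol P W' s"
  unfolding assoc_sec_def
proof
  fix p assume p: "p \<in> W'"
  then obtain V e f where V: "cp3_open V" "p \<in> V" "V \<subseteq> W" "psec P V e" "hol V f"
      "\<forall>x\<in>V. s x = assoc_class H act F P x (e x) (f x)"
    using s W'(2) unfolding assoc_sec_def by blast
  have "cp3_open (V \<inter> W')" using cp3_open_Int V(1) W'(1) .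
  moreover have "psec P (V \<inter> W') e" "hol (V \<inter> W') f"
    using psec[OF V(4) calculation] hol[OF V(5)] by auto
  ultimately show "\<exists>W'' e f. cp3_open W'' \<and> p \<in> W'' \<and> W'' \<subseteq> W' \<and> psec P W'' e \<and> hol W'' f \<and>
      (\<forall>x\<in>W''. s x = assoc_class H act F P x (e x) (f x))"
    using V p by (intro exI[of _ "V \<inter> W'"] exI[of _ e] exI[of _ f]) auto
qed

text \<open>A frame with fibre V instead of a basis: all bundles below become trivial with the same fibre V,
  so that isomorphisms between them are detected by matching frames.\<close>

definition vframe ::
  "(complex \<Rightarrow> 'v \<Rightarrow> 'v) \<Rightarrow> 'e vbundle \<Rightarrow> point set \<Rightarrow> (point \<Rightarrow> 'v::ab_group_add \<Rightarrow> 'e) \<Rightarrow> bool" where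
  "vframe smul E W \<psi> \<longleftrightarrow>
     (\<forall>p\<in>W. bij_betw (\<psi> p) UNIV (vfib E p) \<and> \<psi> p 0 = vzero E p \<and>
        (\<forall>v w. \<psi> p (v + w) = vadd E p (\<psi> p v) (\<psi> p w)) \<and>
        (\<forall>t v. \<psi> p (smul t v) = vscl E p t (\<psi> p v))) \<and>
     (\<forall>W' s. cp3_open W' \<and> W' \<subseteq> W \<longrightarrow>
        (vsec E W' s \<longleftrightarrow> (\<exists>f. holo_vec smul W' f \<and> (\<forall>p\<in>W'. s p = \<psi> p (f p)))))"

lemma vframe_fibre:
  assumes "vframe smul E W \<psi>" "p \<in> W"
  shows "bij_betw (\<psi> p) UNIV (vfib E p)" "\<psi> p v \<in> vfib E p" "\<psi> p 0 = vzero E p"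
    "\<psi> p (v + w) = vadd E p (\<psi> p v) (\<psi> p w)" "\<psi> p (smul t v) = vscl E p t (\<psi> p v)"
proof -
  have *: "bij_betw (\<psi> p) UNIV (vfib E p)" "\<psi> p 0 = vzero E p"
      "\<forall>v w. \<psi> p (v + w) = vadd E p (\<psi> p v) (\<psi> p w)"
      "\<forall>t v. \<psi> p (smul t v) = vscl E p t (\<psi> p v)"
    using assms unfolding vframe_def by blast+
  show "bij_betw (\<psi> p) UNIV (vfib E p)" "\<psi> p 0 = vzero E p" using * by simp_all
  show "\<psi> p v \<in> vfib E p" using bij_betwE[OF *(1)] by simp
  show "\<psi> p (v + w) = vadd E p (\<psi> p v) (\<psi> p w)" using *(3) by blast
  show "\<psi> p (smul t v) = vscl E p t (\<psi> p v)" using *(4) by blast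
qed

lemma vframe_sec:
  assumes "vframe smul E W \<psi>" "cp3_open W'" "W' \<subseteq> W"
  shows "vsec E W' s \<longleftrightarrow> (\<exists>f. holo_vec smul W' f \<and> (\<forall>p\<in>W'. s p = \<psi> p (f p)))"
  using assms unfolding vframe_def by blast

lemma vframe_obtain:
  assumes "vframe smul E W \<psi>" "p \<in> W" "a \<in> vfib E p"
  obtains v where "a = \<psi> p v"
  using vframe_fibre(1)[OF assms(1,2)] assms(3) by (auto simp: bij_betw_def)

text \<open>A numbering of the basis \<open>B\<close> identifies the model fibre \<open>V\<close>
  with coordinate sequences of length \<open>card B\<close>, which converts frames into the
  trivializations demanded by \<open>vector_bundle\<close>.\<close>

lemma vframe_local_trivialization:
  assumes fd: "finite_dimensional_vector_space smul B" and fr: "vframe smul E W \<psi>" and W: "cp3_open W"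
  shows "\<exists>r \<tau>. local_trivialization E W r \<tau>"
proof -
  interpret finite_dimensional_vector_space smul B by (rule fd)
  obtain b where b: "bij_betw b {..<card B} B"
    using ex_bij_betw_nat_finite[OF finite_Basis] by (auto simp: atLeast0LessThan)
  define r where "r = card B"
  \<comment> \<open>Zero from position \<open>r\<close> on, to match the model fibre in
    \<open>local_trivialization\<close>.\<close>
  define co where "co v i = (if i < r then representation B v (b i) else 0)" for v i
  have lf: "linear_functional smul (\<lambda>v. co v i)" for i
    using linear_functional_coord[OF fd, of "b i"]
    unfolding linear_functional_iff[OF fd] co_def by simp
  have expand: "(\<Sum>i<r. smul (co v i) (b i)) = v" for v
  proof -
    have "(\<Sum>i<r. smul (co v i) (b i)) = (\<Sum>i<r. smul (representation B v (b i)) (b i))"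
      by (intro sum.cong) (auto simp: co_def)
    also have "\<dots> = (\<Sum>x\<in>B. smul (representation B v x) x)"
      using sum.reindex_bij_betw[OF b, of "\<lambda>x. smul (representation B v x) x"] by (simp add: r_def)
    also have "\<dots> = v" using basis_expansion[of v] by simp
    finally show ?thesis .
  qed
  have co_basis: "co (b j) i = (if i = j then 1 else 0)" if "j < r" for i j
  proof -
    have bj: "b j \<in> B" using b that by (auto simp: bij_betw_def r_def)
    have "b i = b j \<longleftrightarrow> i = j" if "i < r"
      using b that \<open>j < r\<close> by (auto simp: bij_betw_def inj_on_def r_def)
    then show ?thesis
      using that bj by (auto simp: co_def representation_basis[OF independent_Basis bj])
  qed
  have co_bij: "bij_betw co UNIV {c. \<forall>i\<ge>r. c i = 0}"
  proof (rule bij_betwI[where g = "\<lambda>c. \<Sum>i<r. smul (c i) (b i)"])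
    show "co \<in> UNIV \<rightarrow> {c. \<forall>i\<ge>r. c i = 0}" by (simp add: co_def)
    show "co (\<Sum>j<r. smul (c j) (b j)) = c" if "c \<in> {c. \<forall>i\<ge>r. c i = 0}" for c
    proof
      fix i
      have "co (\<Sum>j<r. smul (c j) (b j)) i = (\<Sum>j<r. c j * co (b j) i)"
        by (simp add: linear_functional_sum[OF fd lf] linear_functional_scale[OF fd lf])
      also have "\<dots> = (\<Sum>j<r. if i = j then c j else 0)"
        by (intro sum.cong) (auto simp: co_basis)
      also have "\<dots> = c i" using that by auto
      finally show "co (\<Sum>j<r. smul (c j) (b j)) i = c i" .
    qed
  qed (auto simp: expand)
  define \<tau> where "\<tau> p a = co (inv_into UNIV (\<psi> p) a)" for p a
  have \<tau>: "\<tau> p (\<psi> p v) = co v" if "p \<in> W" for p v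
    using vframe_fibre(1)[OF fr that] by (simp add: \<tau>_def bij_betw_def inv_into_f_f)
  have "local_trivialization E W r \<tau>"
    unfolding local_trivialization_def
  proof (intro conjI ballI allI impI)
    fix p assume p: "p \<in> W"
    note fib = vframe_fibre[OF fr p]
    have "bij_betw (co \<circ> inv_into UNIV (\<psi> p)) (vfib E p) {c. \<forall>i\<ge>r. c i = 0}"
      using bij_betw_inv_into[OF fib(1)] co_bij by (rule bij_betw_trans)
    then show "bij_betw (\<tau> p) (vfib E p) {c. \<forall>i\<ge>r. c i = 0}"
      by (simp add: \<tau>_def[abs_def] comp_def)
    show "vzero E p \<in> vfib E p" using fib(2)[of 0] fib(3) by simp
    show "\<tau> p (vzero E p) = (\<lambda>i. 0)"
      using \<tau>[OF p, of 0] fib(3) linear_functional_0[OF fd lf] by auto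
    fix a assume a: "a \<in> vfib E p"
    then obtain v where v: "a = \<psi> p v" using vframe_obtain[OF fr p] by blast
    {
      fix a' assume "a' \<in> vfib E p"
      then obtain w where w: "a' = \<psi> p w" using vframe_obtain[OF fr p] by blast
      have sum: "vadd E p a a' = \<psi> p (v + w)" using fib(4) v w by simp
      show "vadd E p a a' \<in> vfib E p" using fib(2) sum by simp
      show "\<tau> p (vadd E p a a') = (\<lambda>i. \<tau> p a i + \<tau> p a' i)"
        unfolding sum unfolding v w \<tau>[OF p] using linear_functional_add[OF fd lf] by auto
    }
    fix t
    have scl: "vscl E p t a = \<psi> p (smul t v)" using fib(5) v by simp
    show "vscl E p t a \<in> vfib E p" using fib(2) scl by simp
    show "\<tau> p (vscl E p t a) = (\<lambda>i. t * \<tau> p a i)"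
      unfolding scl unfolding v \<tau>[OF p] using linear_functional_scale[OF fd lf] by auto
  next
    fix W' s assume W': "cp3_open W' \<and> W' \<subseteq> W"
    show "vsec E W' s \<longleftrightarrow> (\<forall>p\<in>W'. s p \<in> vfib E p) \<and> (\<forall>i<r. cp3_holo W' (\<lambda>p. \<tau> p (s p) i))"
    proof
      assume "vsec E W' s"
      then obtain f where f: "holo_vec smul W' f" "\<forall>p\<in>W'. s p = \<psi> p (f p)"
        using vframe_sec[OF fr] W' by blast
      have "cp3_holo W' (\<lambda>p. \<tau> p (s p) i)" for i
      proof (rule cp3_holo_cong[of _ "\<lambda>p. co (f p) i"])
        show "cp3_holo W' (\<lambda>p. co (f p) i)"
          using f(1) lf unfolding holo_vec_def by blast
        show "\<tau> p (s p) i = co (f p) i" if "p \<in> W'" for p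
          using \<tau>[of p "f p"] f(2) that W' by auto
      qed (use W' in blast)
      moreover have "s p \<in> vfib E p" if "p \<in> W'" for p
        using vframe_fibre(2)[OF fr, of p] f(2) that W' by auto
      ultimately show "(\<forall>p\<in>W'. s p \<in> vfib E p) \<and> (\<forall>i<r. cp3_holo W' (\<lambda>p. \<tau> p (s p) i))"
        by blast
    next
      assume s: "(\<forall>p\<in>W'. s p \<in> vfib E p) \<and> (\<forall>i<r. cp3_holo W' (\<lambda>p. \<tau> p (s p) i))"
      define f where "f p = inv_into UNIV (\<psi> p) (s p)" for p
      have sf: "s p = \<psi> p (f p)" if "p \<in> W'" for p
      proof -
        have "p \<in> W" "s p \<in> vfib E p" using that W' s by blast+
        then show ?thesis
          using vframe_fibre(1)[OF fr, of p] by (simp add: f_def bij_betw_def f_inv_into_f)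
      qed
      have "holo_vec smul W' f"
        unfolding holo_vec_def
      proof (intro allI impI)
        fix \<phi> assume \<phi>: "linear_functional smul \<phi>"
        have "cp3_holo W' (\<lambda>p. \<Sum>i<r. \<tau> p (s p) i * \<phi> (b i))"
          using s by (intro cp3_holo_sum cp3_holo_mult cp3_holo_const) auto
        then show "cp3_holo W' (\<lambda>p. \<phi> (f p))"
        proof (rule cp3_holo_cong[rotated])
          show "\<phi> (f p) = (\<Sum>i<r. \<tau> p (s p) i * \<phi> (b i))" for p
          proof -
            have "\<phi> (f p) = \<phi> (\<Sum>i<r. smul (co (f p) i) (b i))"
              by (simp only: expand)
            also have "\<dots> = (\<Sum>i<r. co (f p) i * \<phi> (b i))"
              by (simp only: linear_functional_sum[OF fd \<phi>] linear_functional_scale[OF fd \<phi>])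
            finally show ?thesis by (simp only: \<tau>_def f_def)
          qed
        qed (use W' in blast)
      qed
      then show "vsec E W' s"
        using vframe_sec[OF fr] W' sf by blast
    qed
  qed
  then show ?thesis by blast
qed

section \<open>Vector bundles and isomorphisms from local frames\<close>

lemma vector_bundle_of_frames:
  assumes "finite_dimensional_vector_space smul B" and "local_condition (vsec E)"
    and "\<And>p. p \<in> CP3 \<Longrightarrow> \<exists>W \<psi>. cp3_open W \<and> p \<in> W \<and> vframe smul E W \<psi>"
  shows "vector_bundle E"
  unfolding vector_bundle_def
proof (intro conjI ballI assms(2))
  fix p assume "p \<in> CP3"
  then obtain W \<psi> where "cp3_open W" "p \<in> W" "vframe smul E W \<psi>"
    using assms(3) by blast
  then show "\<exists>W r \<tau>. cp3_open W \<and> p \<in> W \<and> local_trivialization E W r \<tau>"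
    using vframe_local_trivialization[OF assms(1)] by blast
qed

text \<open>In \<open>local_condition\<close> the smaller open set may be the whole set, so that
  condition provides gluing but no restriction to smaller sets. Restriction is added here.\<close>

definition presheaf :: "'e vbundle \<Rightarrow> bool" where
  "presheaf E \<longleftrightarrow> local_condition (vsec E) \<and>
     (\<forall>W W' s. vsec E W s \<and> cp3_open W' \<and> W' \<subseteq> W \<longrightarrow> vsec E W' s)"

text \<open>Reduces a statement about sections over \<open>W\<close> to open sets that lie inside
  members of a cover. The property \<open>S\<close> is not assumed to pass to subsets, hence the
  additional \<open>V'\<close>.\<close>

lemma vsec_local:
  assumes E: "presheaf E" and W: "cp3_open W"
    and cover: "\<And>p. p \<in> W \<Longrightarrow> \<exists>V. cp3_open V \<and> p \<in> V \<and> S V"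
  shows "vsec E W s \<longleftrightarrow> (\<forall>p\<in>W. \<exists>V. cp3_open V \<and> p \<in> V \<and> V \<subseteq> W \<and> (\<exists>V'. V \<subseteq> V' \<and> S V') \<and> vsec E V s)"
proof
  assume s: "vsec E W s"
  show "\<forall>p\<in>W. \<exists>V. cp3_open V \<and> p \<in> V \<and> V \<subseteq> W \<and> (\<exists>V'. V \<subseteq> V' \<and> S V') \<and> vsec E V s"
  proof
    fix p assume p: "p \<in> W"
    then obtain V where V: "cp3_open V" "p \<in> V" "S V" using cover by blast
    have "cp3_open (V \<inter> W)" using cp3_open_Int[OF V(1) W] .
    moreover then have "vsec E (V \<inter> W) s"
      using E s unfolding presheaf_def by blast
    ultimately show "\<exists>V. cp3_open V \<and> p \<in> V \<and> V \<subseteq> W \<and> (\<exists>V'. V \<subseteq> V' \<and> S V') \<and> vsec E V s"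
      using V p by (intro exI[of _ "V \<inter> W"]) blast
  qed
next
  assume "\<forall>p\<in>W. \<exists>V. cp3_open V \<and> p \<in> V \<and> V \<subseteq> W \<and> (\<exists>V'. V \<subseteq> V' \<and> S V') \<and> vsec E V s"
  then have "\<forall>p\<in>W. \<exists>V. cp3_open V \<and> p \<in> V \<and> V \<subseteq> W \<and> vsec E V s" by blast
  then show "vsec E W s"
    using E W unfolding presheaf_def local_condition_def by blast
qed

text \<open>If \<open>\<Phi>\<close> carries one frame to the other, a section and its image have
  the same \<open>V\<close>-valued coordinates, so they are holomorphic together over each frame
  domain; locality extends this to every open set.\<close>

lemma vb_iso_of_frames:
  assumes E: "presheaf E" and F: "presheaf F"
    and fr: "\<And>p. p \<in> A \<Longrightarrow> \<exists>W \<psi> \<eta>. cp3_open W \<and> p \<in> W \<and> vframe smul E W \<psi> \<and> vframe smul F W \<eta> \<and>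
      (\<forall>x\<in>W. \<forall>v. \<Phi> x (\<psi> x v) = \<eta> x v)"
  shows "vb_iso A E F \<Phi>"
  unfolding vb_iso_def
proof (intro conjI ballI allI impI)
  fix p assume p: "p \<in> A"
  obtain W \<psi> \<eta> where W': "cp3_open W \<and> p \<in> W \<and> vframe smul E W \<psi> \<and> vframe smul F W \<eta> \<and>
      (\<forall>x\<in>W. \<forall>v. \<Phi> x (\<psi> x v) = \<eta> x v)"
    using fr[OF p] by (elim exE)
  then have W: "p \<in> W" "vframe smul E W \<psi>" "vframe smul F W \<eta>" "\<And>v. \<Phi> p (\<psi> p v) = \<eta> p v"
    by simp_all
  note fE = vframe_fibre[OF W(2,1)] and fF = vframe_fibre[OF W(3,1)]
  show "bij_betw (\<Phi> p) (vfib E p) (vfib F p)"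
  proof -
    have "bij_betw (\<Phi> p \<circ> \<psi> p) UNIV (vfib F p)"
      using fF(1) W(4) by (simp add: comp_def)
    then show ?thesis
      using bij_betw_comp_iff[OF fE(1)] by blast
  qed
  fix a assume "a \<in> vfib E p"
  then obtain v where v: "a = \<psi> p v" using vframe_obtain[OF W(2,1)] by blast
  show "\<Phi> p (vscl E p t a) = vscl F p t (\<Phi> p a)" for t
    unfolding v fE(5)[symmetric] W(4) fF(5)[symmetric] ..
  fix a' assume "a' \<in> vfib E p"
  then obtain w where w: "a' = \<psi> p w" using vframe_obtain[OF W(2,1)] by blast
  show "\<Phi> p (vadd E p a a') = vadd F p (\<Phi> p a) (\<Phi> p a')"
    unfolding v w fE(4)[symmetric] W(4) fF(4)[symmetric] ..
next
  fix W s assume Ws: "cp3_open W \<and> W \<subseteq> A \<and> (\<forall>p\<in>W. s p \<in> vfib E p)"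
  define S where "S V \<longleftrightarrow> (\<exists>\<psi> \<eta>. vframe smul E V \<psi> \<and> vframe smul F V \<eta> \<and>
      (\<forall>x\<in>V. \<forall>v. \<Phi> x (\<psi> x v) = \<eta> x v))" for V
  have W: "cp3_open W" using Ws by blast
  have cover: "\<exists>V. cp3_open V \<and> p \<in> V \<and> S V" if "p \<in> W" for p
    using fr[of p] Ws that unfolding S_def by blast
  have eq: "vsec E V s \<longleftrightarrow> vsec F V (\<lambda>p. \<Phi> p (s p))"
    if V: "cp3_open V" "V \<subseteq> W" "V \<subseteq> V'" "S V'" for V V'
  proof -
    obtain \<psi> \<eta> where f: "vframe smul E V' \<psi>" "vframe smul F V' \<eta>"
        "\<And>x v. x \<in> V' \<Longrightarrow> \<Phi> x (\<psi> x v) = \<eta> x v"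
      using V(4) unfolding S_def by auto
    \<comment> \<open>Both frames are injective, so \<open>s\<close> and its image have the same
      coordinate vector at \<open>p\<close>.\<close>
    have "s p = \<psi> p v \<longleftrightarrow> \<Phi> p (s p) = \<eta> p v" if p: "p \<in> V" for p v
    proof -
      have pV: "p \<in> V'" using p V by blast
      have "s p \<in> vfib E p" using p V Ws by blast
      then obtain w where w: "s p = \<psi> p w" using vframe_obtain[OF f(1) pV] by blast
      show ?thesis
        unfolding w f(3)[OF pV]
        using vframe_fibre(1)[OF f(1) pV] vframe_fibre(1)[OF f(2) pV]
        by (auto simp: bij_betw_def inj_eq)
    qed
    then show ?thesis
      unfolding vframe_sec[OF f(1) V(1,3)] vframe_sec[OF f(2) V(1,3)] by blast
  qed
  show "vsec E W s \<longleftrightarrow> vsec F W (\<lambda>p. \<Phi> p (s p))"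
  proof -
    have eq': "cp3_open V \<and> p \<in> V \<and> V \<subseteq> W \<and> (\<exists>V'. V \<subseteq> V' \<and> S V') \<and> vsec E V s \<longleftrightarrow>
        cp3_open V \<and> p \<in> V \<and> V \<subseteq> W \<and> (\<exists>V'. V \<subseteq> V' \<and> S V') \<and> vsec F V (\<lambda>p. \<Phi> p (s p))" for p V
    proof (intro conj_cong refl)
      assume "cp3_open V" "V \<subseteq> W" "\<exists>V'. V \<subseteq> V' \<and> S V'"
      then show "vsec E V s \<longleftrightarrow> vsec F V (\<lambda>p. \<Phi> p (s p))" using eq[of V] by (elim exE conjE)
    qed
    have "vsec E W s \<longleftrightarrow>
        (\<forall>p\<in>W. \<exists>V. cp3_open V \<and> p \<in> V \<and> V \<subseteq> W \<and> (\<exists>V'. V \<subseteq> V' \<and> S V') \<and> vsec E V s)"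
      by (rule vsec_local[OF E W]) (rule cover)
    also have "\<dots> \<longleftrightarrow> (\<forall>p\<in>W. \<exists>V. cp3_open V \<and> p \<in> V \<and> V \<subseteq> W \<and> (\<exists>V'. V \<subseteq> V' \<and> S V') \<and>
        vsec F V (\<lambda>p. \<Phi> p (s p)))"
      by (rule ball_cong[OF refl], rule ex_cong1, rule eq')
    also have "\<dots> \<longleftrightarrow> vsec F W (\<lambda>p. \<Phi> p (s p))"
      by (rule vsec_local[OF F W, symmetric]) (rule cover)
    finally show ?thesis .
  qed
qed

section \<open>Principal bundles and their associated vector bundles\<close>

text \<open>The local triviality clause of \<open>principal_bundle\<close> for one section, isolated
  because the same section also produces frames of the associated vector bundles.\<close>

definition principal_section ::
  "(complex^'n^'n) set \<Rightarrow> (complex^'n^'n, 'e) pbundle \<Rightarrow> point set \<Rightarrow> (point \<Rightarrow> 'e) \<Rightarrow> bool" where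
  "principal_section G P W e \<longleftrightarrow> (\<forall>x\<in>W. e x \<in> pfib P x) \<and>
     (\<forall>W' s. cp3_open W' \<and> W' \<subseteq> W \<longrightarrow>
        (psec P W' s \<longleftrightarrow> (\<exists>g. holo_group G W' g \<and> (\<forall>x\<in>W'. s x = pact P x (e x) (g x)))))"

lemma principal_bundleI:
  assumes act: "assoc_action G (**) (mat 1) matrix_inv P act F" and "local_condition (psec P)"
    and sec: "\<And>p. p \<in> CP3 \<Longrightarrow> \<exists>W e. cp3_open W \<and> p \<in> W \<and> principal_section G P W e"
  shows "principal_bundle G P"
proof -
  interpret assoc_action G "(**)" "mat 1" matrix_inv P act F by (rule act)
  show ?thesis
    unfolding principal_bundle_def
  proof (intro conjI ballI assms(2))
    fix p assume p: "p \<in> CP3"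
    obtain W e where We: "cp3_open W" "p \<in> W" "principal_section G P W e"
      using sec[OF p] by blast
    then show "\<exists>W e. cp3_open W \<and> p \<in> W \<and> (\<forall>x\<in>W. e x \<in> pfib P x) \<and>
        (\<forall>W' s. cp3_open W' \<and> W' \<subseteq> W \<longrightarrow>
           (psec P W' s \<longleftrightarrow> (\<exists>g. holo_group G W' g \<and> (\<forall>x\<in>W'. s x = pact P x (e x) (g x)))))"
      unfolding principal_section_def by blast
    show "pfib P p \<noteq> {}"
      using We unfolding principal_section_def by blast
    fix f assume f: "f \<in> pfib P p"
    show "bij_betw (pact P p f) G (pfib P p)" by (rule pact_bij[OF p f])
    show "pact P p f (mat 1) = f" by (rule pact_one[OF p f])
    show "pact P p f (g ** h) = pact P p (pact P p f g) h" if "g \<in> G" "h \<in> G" for g h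
      by (rule pact_mult[OF p f that])
  qed
qed

section \<open>Trivial bundles and sums of twisted bundles\<close>

lemma trivial_vframe:
  assumes fd: "finite_dimensional_vector_space smul B"
  shows "vframe smul (trivial_vbundle smul) W (\<lambda>p v. v)"
  unfolding vframe_def
proof (intro conjI ballI allI impI)
  fix W' s assume W': "cp3_open W' \<and> W' \<subseteq> W"
  show "vsec (trivial_vbundle smul) W' s \<longleftrightarrow> (\<exists>f. holo_vec smul W' f \<and> (\<forall>p\<in>W'. s p = f p))"
  proof
    assume "\<exists>f. holo_vec smul W' f \<and> (\<forall>p\<in>W'. s p = f p)"
    then obtain f where f: "holo_vec smul W' f" "\<And>p. p \<in> W' \<Longrightarrow> s p = f p" by blast
    have "holo_vec smul W' s"
      by (rule holo_vec_cong[OF _ f]) (use W' in blast)+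
    then show "vsec (trivial_vbundle smul) W' s"
      by (simp add: trivial_vbundle_def)
  qed (auto simp: trivial_vbundle_def)
qed (auto simp: trivial_vbundle_def bij_betw_def)

lemma trivial_presheaf: "presheaf (trivial_vbundle smul)"
  unfolding presheaf_def local_condition_def
proof (intro conjI allI impI iffI ballI)
  fix W s assume "cp3_open W"
    "\<forall>p\<in>W. \<exists>W'. cp3_open W' \<and> p \<in> W' \<and> W' \<subseteq> W \<and> vsec (trivial_vbundle smul) W' s"
  then show "vsec (trivial_vbundle smul) W s"
    unfolding trivial_vbundle_def vbundle.select_convs by (intro holo_vec_local) blast+
next
  fix W W' s assume "vsec (trivial_vbundle smul) W s \<and> cp3_open W' \<and> W' \<subseteq> W"
  then show "vsec (trivial_vbundle smul) W' s"
    unfolding trivial_vbundle_def vbundle.select_convs using holo_vec_subset by blast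
qed blast

text \<open>Membership in the product of the fibres already contains the fibre condition of every
  summand; what remains is one holomorphy condition for each index and functional.\<close>

lemma vsec_direct_sum_twisted:
  "vsec (direct_sum I (\<lambda>i. twisted_bundle smul (d i) (F i))) W s \<longleftrightarrow> (\<forall>p\<in>W. s p \<in> vfib (direct_sum I (\<lambda>i. twisted_bundle smul (d i) (F i))) p) \<and>
    (\<forall>i\<in>I. \<forall>\<phi>. linear_functional smul \<phi> \<longrightarrow> holo_on (\<lambda>x. \<phi> (s (hline x) i x)) (\<Union>W))"
  (is "?L \<longleftrightarrow> ?R")
proof
  assume ?L
  then show ?R
    unfolding direct_sum_def twisted_bundle_def vbundle.select_convs by simp
next
  assume R: ?R
  have fib: "s p \<in> (\<Pi>\<^sub>E i\<in>I. twisted_fib smul (d i) (F i) p)" if "p \<in> W" for p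
    using R that unfolding direct_sum_def twisted_bundle_def vbundle.select_convs by simp
  show ?L
    unfolding direct_sum_def twisted_bundle_def vbundle.select_convs
  proof (intro conjI ballI)
    show "s p \<in> (\<Pi>\<^sub>E i\<in>I. twisted_fib smul (d i) (F i) p)" if "p \<in> W" for p
      by (rule fib[OF that])
    fix i assume i: "i \<in> I"
    show "s p i \<in> twisted_fib smul (d i) (F i) p" if "p \<in> W" for p
      by (rule PiE_mem[OF fib[OF that] i])
    show "\<forall>\<phi>. linear_functional smul \<phi> \<longrightarrow> holo_on (\<lambda>x. \<phi> (s (hline x) i x)) (\<Union>W)"
      using conjunct2[OF R] i by (rule bspec)
  qed
qed

lemma direct_sum_twisted_presheaf:
  "presheaf (direct_sum I (\<lambda>i. twisted_bundle smul (d i) (F i)))" (is "presheaf ?E")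
proof -
  note sec = vsec_direct_sum_twisted[of I smul d F]
  have sub: "vsec ?E W' s" if "vsec ?E W s" "W' \<subseteq> W" for W W' s
    unfolding sec
  proof (intro conjI ballI allI impI)
    show "s p \<in> vfib ?E p" if "p \<in> W'" for p
      using \<open>vsec ?E W s\<close> \<open>W' \<subseteq> W\<close> that unfolding sec by blast
    fix i \<phi> assume "i \<in> I" "linear_functional smul \<phi>"
    then have "holo_on (\<lambda>x. \<phi> (s (hline x) i x)) (\<Union>W)"
      using \<open>vsec ?E W s\<close> unfolding sec by simp
    then show "holo_on (\<lambda>x. \<phi> (s (hline x) i x)) (\<Union>W')"
      using \<open>W' \<subseteq> W\<close> by (rule holo_on_subset[OF _ Union_mono])
  qed
  have loc: "vsec ?E W s"
    if cover: "\<And>p. p \<in> W \<Longrightarrow> \<exists>W'. cp3_open W' \<and> p \<in> W' \<and> W' \<subseteq> W \<and> vsec ?E W' s" for W s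
    unfolding sec
  proof (intro conjI ballI allI impI)
    show "s p \<in> vfib ?E p" if "p \<in> W" for p
      using cover[OF that] unfolding sec by blast
    fix i \<phi> assume i: "i \<in> I" and \<phi>: "linear_functional smul \<phi>"
    show "holo_on (\<lambda>x. \<phi> (s (hline x) i x)) (\<Union>W)"
      unfolding holo_on_def
    proof
      fix x assume "x \<in> \<Union>W"
      then obtain p where p: "x \<in> p" "p \<in> W" by blast
      obtain W' where W': "p \<in> W'" "vsec ?E W' s" using cover[OF p(2)] by blast
      with p(1) have "x \<in> \<Union>W'" by (intro UnionI)
      moreover have "holo_on (\<lambda>x. \<phi> (s (hline x) i x)) (\<Union>W')"
        using W'(2) i \<phi> unfolding sec by simp
      ultimately show "\<exists>f'. ((\<lambda>x. \<phi> (s (hline x) i x)) has_derivative f') (at x) \<and>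
          (\<forall>c v. f' (c *s v) = c * f' v)"
        unfolding holo_on_def by blast
    qed
  qed
  show ?thesis
    unfolding presheaf_def local_condition_def
  proof (intro conjI allI impI iffI ballI)
    fix W s assume "\<forall>p\<in>W. \<exists>W'. cp3_open W' \<and> p \<in> W' \<and> W' \<subseteq> W \<and> vsec ?E W' s"
    then show "vsec ?E W s" by (intro loc) blast
  next
    fix W W' s assume "vsec ?E W s \<and> cp3_open W' \<and> W' \<subseteq> W"
    then show "vsec ?E W' s" using sub by blast
  qed blast
qed

section \<open>The quadric and the inverse of its section\<close>

lemma smooth_quadric_fibre:
  assumes q: "smooth_quadric Q q" and p: "p \<in> CP3" and x: "x \<in> p"
  shows "t \<noteq> 0 \<Longrightarrow> q p (t *s x) = t powi 2 * q p x" "p \<in> Q \<longleftrightarrow> q p x = 0"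
proof -
  have "q p \<in> twisted_fib (*) 2 UNIV p"
    using q p by (simp add: smooth_quadric_def O_bundle_def twisted_bundle_def)
  then have h: "\<forall>x\<in>p. \<forall>t. t \<noteq> 0 \<longrightarrow> q p (t *s x) = t powi 2 * q p x" "\<forall>x. x \<notin> p \<longrightarrow> q p x = 0"
    unfolding twisted_fib_def by blast+
  show "t \<noteq> 0 \<Longrightarrow> q p (t *s x) = t powi 2 * q p x"
    using h(1) x by blast
  have "p \<in> Q \<longleftrightarrow> q p = (\<lambda>x. 0)"
    using q p by (simp add: smooth_quadric_def O_bundle_def twisted_bundle_def)
  moreover have "q p = (\<lambda>x. 0)" if "q p x = 0"
  proof
    fix y
    show "q p y = 0"
    proof (cases "y \<in> p")
      case True
      obtain t where "t \<noteq> 0" "y = t *s x" by (rule CP3_scale_obtain[OF p x True])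
      then show ?thesis using h(1) x that by simp
    next
      case False
      then show ?thesis using h(2) by blast
    qed
  qed
  ultimately show "p \<in> Q \<longleftrightarrow> q p x = 0" by auto
qed

lemma smooth_quadric_holo:
  assumes "smooth_quadric Q q"
  shows "holo_on (\<lambda>x. q (hline x) x) (- {0})"
proof -
  have "\<Union>CP3 = - {0}"
    using Union_points[OF order_refl] hline_CP3 by blast
  then show ?thesis
    using assms by (simp add: smooth_quadric_def O_bundle_def twisted_bundle_def holo_functionals_complex)
qed

lemma quadric_complement_open:
  assumes "smooth_quadric Q q"
  shows "cp3_open (CP3 - Q)"
proof (rule cp3_openI)
  have "{x. x \<noteq> 0 \<and> hline x \<in> CP3 - Q} = - {0} \<inter> (\<lambda>x. q (hline x) x) -` (- {0})"
    using smooth_quadric_fibre(2)[OF assms hline_CP3 hline_self] by (auto simp: hline_CP3)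
  moreover have "open (- {0} \<inter> (\<lambda>x. q (hline x) x) -` (- {0}))"
    by (rule continuous_open_preimage[OF holo_on_continuous[OF smooth_quadric_holo[OF assms]]])
       (simp_all add: open_Compl)
  ultimately show "open {x. x \<noteq> 0 \<and> hline x \<in> CP3 - Q}" by simp
qed blast

lemma quadric_inverse_section:
  assumes q: "smooth_quadric Q q"
  shows "psec (nonzero_vectors L_Q) (CP3 - Q) (section_power q (-1))"
  unfolding psec_L_Q
proof (intro conjI ballI)
  fix p assume "p \<in> CP3 - Q"
  then have p: "p \<in> CP3" "p \<notin> Q" by auto
  show "section_power q (- 1) p \<in> pfib (nonzero_vectors L_Q) p"
    unfolding pfib_L_Q[OF p(1)]
  proof (intro conjI ballI allI impI)
    fix x assume x: "x \<in> p"
    show "section_power q (- 1) p x \<noteq> 0"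
      using smooth_quadric_fibre(2)[OF q p(1) x] p(2) x by (simp add: section_power_def)
    fix t :: complex assume t: "t \<noteq> 0"
    have tx: "t *s x \<in> p" by (rule CP3_scale[OF p(1) x t])
    show "section_power q (- 1) p (t *s x) = t powi - 2 * section_power q (- 1) p x"
      unfolding section_power_def using x tx smooth_quadric_fibre(1)[OF q p(1) x t]
      by (simp add: power_int_minus)
  qed (simp add: section_power_def)
next
  let ?f = "\<lambda>x. inverse (q (hline x) x)"
  have nz: "q (hline x) x \<noteq> 0" "x \<noteq> 0" if x: "x \<in> \<Union>(CP3 - Q)" for x
  proof -
    have "hline x \<in> CP3 - Q" using cp3_open_hline[OF quadric_complement_open[OF q] x] .
    then show "q (hline x) x \<noteq> 0"
      using smooth_quadric_fibre(2)[OF q _ hline_self] by blast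
    show "x \<noteq> 0" using x CP3_nonzero by blast
  qed
  have "holo_on ?f (\<Union>(CP3 - Q))"
    by (rule holo_on_inverse[OF holo_on_subset[OF smooth_quadric_holo[OF q]]]) (use nz in auto)
  then show "holo_on (\<lambda>x. section_power q (- 1) (hline x) x) (\<Union>(CP3 - Q))"
    by (rule holo_on_cong[OF cp3_openD(2)[OF quadric_complement_open[OF q]]])
       (simp add: section_power_def hline_self power_int_minus)
qed

section \<open>The sourced Ward bundle and its associated vector bundle\<close>

locale ward_data = torus_rep smul B T \<rho>
  for smul :: "complex \<Rightarrow> 'v::ab_group_add \<Rightarrow> 'v" and B :: "'v set"
    and T :: "(complex^'n^'n) set" and \<rho> :: "complex^'n^'n \<Rightarrow> 'v \<Rightarrow> 'v" +
  fixes G :: "(complex^'n^'n) set" and lam :: "complex \<Rightarrow> complex^'n^'n"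
  assumes group_G: "algebraic_group G" and TG: "T \<subseteq> G" and lam: "cocharacter T lam"
    and rep: "rational_representation G smul \<rho>"
begin

lemmas G_closed = algebraic_group_closed[OF group_G]

lemma G_GL: "G \<subseteq> GL" by (rule algebraic_group_GL[OF group_G])

lemma G_inv: "g \<in> G \<Longrightarrow> g ** matrix_inv g = mat 1" "g \<in> G \<Longrightarrow> matrix_inv g ** g = mat 1"
  using matrix_inv_GL G_GL by blast+

lemma lam_T: "t \<noteq> 0 \<Longrightarrow> lam t \<in> T"
  and lam_mult: "s \<noteq> 0 \<Longrightarrow> t \<noteq> 0 \<Longrightarrow> lam (s * t) = lam s ** lam t"
  using lam by (simp_all add: cocharacter_def)

lemma lam_G: "t \<noteq> 0 \<Longrightarrow> lam t \<in> G"
  using lam_T TG by blast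

lemma lam_one: "lam 1 = mat 1"
  by (rule cocharacter_one[OF lam algebraic])

lemma rep_linear:
  assumes "g \<in> G"
  shows "\<rho> g (v + w) = \<rho> g v + \<rho> g w" "\<rho> g (smul t v) = smul t (\<rho> g v)" "\<rho> g 0 = 0"
proof -
  have "Vector_Spaces.linear smul smul (\<rho> g)"
    using rep assms unfolding rational_representation_def by blast
  then show *: "\<rho> g (v + w) = \<rho> g v + \<rho> g w" "\<rho> g (smul t v) = smul t (\<rho> g v)" for v w t
    by (simp_all add: Vector_Spaces.linear_def module_hom_iff)
  show "\<rho> g 0 = 0" using *(2)[of 0 0] by simp
qed

lemma rep_mult: "g \<in> G \<Longrightarrow> h \<in> G \<Longrightarrow> \<rho> (g ** h) v = \<rho> g (\<rho> h v)"
  using rep unfolding rational_representation_def by (metis comp_apply)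

abbreviation "Lx \<equiv> nonzero_vectors L_Q"
abbreviation "lact \<equiv> \<lambda>t a. lam t ** a"
abbreviation "Ext \<equiv> extension_pbundle G lam Lx"

lemma line_action: "assoc_action (- {0}) (*) 1 inverse Lx lact G"
proof
  fix p e h assume p: "p \<in> CP3" and e: "e \<in> pfib Lx p" and h: "h \<in> - {0::complex}"
  note e' = pfib_L_QD[OF p e]
  show "pact Lx p e h \<in> pfib Lx p"
    unfolding pfib_L_Q[OF p] pact_L_Q
  proof (intro conjI ballI allI impI)
    fix x assume x: "x \<in> p"
    show "h * e x \<noteq> 0" using e'(1)[OF x] h by simp
    show "h * e (t *s x) = t powi - 2 * (h * e x)" if "t \<noteq> 0" for t
      unfolding e'(2)[OF x that] by simp
  qed (simp add: e'(3))
  assume eq: "pact Lx p e h = e"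
  obtain x where x: "x \<in> p" by (rule CP3_obtain[OF p])
  have "h * e x = e x" using fun_cong[OF eq[unfolded pact_L_Q], of x] .
  then show "h = 1" using e'(1)[OF x] by simp
next
  fix p e e' assume p: "p \<in> CP3" and e: "e \<in> pfib Lx p" "e' \<in> pfib Lx p"
  obtain x where x: "x \<in> p" by (rule CP3_obtain[OF p])
  show "\<exists>h\<in>- {0}. e' = pact Lx p e h"
    using L_Q_ratio(1)[OF p e x] by (intro bexI[of _ "e' x / e x"] L_Q_ratio(2)[OF p e x]) simp
qed (auto simp: pact_L_Q mult_ac lam_G G_closed lam_one lam_mult matrix_mul_assoc)

interpretation L: assoc_action "- {0}" "(*)" 1 inverse Lx lact G
  by (rule line_action)

lemma pfib_Ext: "pfib Ext p = assoc_fib (- {0}) lact G Lx p"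
  by (simp add: extension_pbundle_def)

lemma Ext_in: "p \<in> CP3 \<Longrightarrow> l \<in> pfib Lx p \<Longrightarrow> a \<in> G \<Longrightarrow> L.cls p l a \<in> pfib Ext p"
  unfolding pfib_Ext by (rule L.cls_in)

text \<open>Right multiplication commutes with the left action through \<open>lam\<close>, hence
  maps classes onto classes. In the parametrized form of the classes this is associativity of the
  matrix product.\<close>

lemma pact_Ext:
  assumes "p \<in> CP3" "l \<in> pfib Lx p" "a \<in> G" "g \<in> G"
  shows "pact Ext p (L.cls p l a) g = L.cls p l (a ** g)"
proof -
  have "pact Ext p (L.cls p l a) g = (\<lambda>(l, a). (l, a ** g)) ` L.cls p l a"
    by (simp add: extension_pbundle_def)
  then show ?thesis
    unfolding L.cls_explicit[OF assms(1-3)] L.cls_explicit[OF assms(1,2) G_closed(2)[OF assms(3,4)]]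
    by (simp add: image_image matrix_mul_assoc)
qed

lemma line_fibre_obtain:
  assumes "p \<in> CP3"
  obtains l where "l \<in> pfib Lx p"
proof -
  obtain W l where "p \<in> W" "psec Lx W l"
    by (rule L_Q_local_section[OF assms])
  then show thesis using that unfolding psec_L_Q by blast
qed

lemma Ext_obtain:
  assumes "p \<in> CP3" "l \<in> pfib Lx p" "e \<in> pfib Ext p"
  obtains a where "a \<in> G" "e = L.cls p l a"
  using assms(3) unfolding pfib_Ext L.assoc_fib_eq[OF assms(1,2)] by blast

text \<open>A choice of \<open>l\<close> identifies the fibre with \<open>G\<close> by sending
  \<open>a\<close> to [l, a], and the axioms reduce to those of right translation on
  \<open>G\<close>.\<close>

lemma Ext_action: "assoc_action G (**) (mat 1) matrix_inv Ext \<rho> UNIV"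
proof
  fix p e assume p: "p \<in> CP3" and e: "e \<in> pfib Ext p"
  obtain l where l: "l \<in> pfib Lx p" by (rule line_fibre_obtain[OF p])
  obtain a where a: "a \<in> G" "e = L.cls p l a" by (rule Ext_obtain[OF p l e])
  show "pact Ext p e (mat 1) = e"
    unfolding a(2) pact_Ext[OF p l a(1) G_closed(1)] by simp
  show "\<exists>h\<in>G. e' = pact Ext p e h" if e': "e' \<in> pfib Ext p" for e'
  proof -
    obtain b where b: "b \<in> G" "e' = L.cls p l b" by (rule Ext_obtain[OF p l e'])
    have h: "matrix_inv a ** b \<in> G" using a b G_closed by blast
    have "a ** (matrix_inv a ** b) = b"
      by (simp add: matrix_mul_assoc G_inv a)
    then have "e' = pact Ext p e (matrix_inv a ** b)"
      unfolding a(2) b(2) pact_Ext[OF p l a(1) h] by simp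
    then show ?thesis using h by blast
  qed
  fix h assume h: "h \<in> G"
  note ah = G_closed(2)[OF a(1) h]
  show "pact Ext p e h \<in> pfib Ext p"
    unfolding a(2) pact_Ext[OF p l a(1) h] by (rule Ext_in[OF p l ah])
  show "pact Ext p e (h ** k) = pact Ext p (pact Ext p e h) k" if k: "k \<in> G" for k
    unfolding a(2) pact_Ext[OF p l a(1) h] pact_Ext[OF p l ah k]
      pact_Ext[OF p l a(1) G_closed(2)[OF h k]] matrix_mul_assoc ..
  assume "pact Ext p e h = e"
  then have "a ** h = a"
    unfolding a(2) pact_Ext[OF p l a(1) h] by (rule L.cls_inj[OF p l ah a(1)])
  then have "matrix_inv a ** a ** h = matrix_inv a ** a"
    by (simp add: matrix_mul_assoc[symmetric])
  then show "h = mat 1" by (simp add: G_inv a)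
qed (auto simp: G_closed G_inv rho_one rep_mult matrix_mul_assoc)

lemma trivial_action: "assoc_action G (**) (mat 1) matrix_inv (trivial_pbundle G) \<rho> UNIV"
proof
  fix p e e' assume "e \<in> pfib (trivial_pbundle G) p" "e' \<in> pfib (trivial_pbundle G) p"
  then have e: "e \<in> G" "e' \<in> G" by (simp_all add: trivial_pbundle_def)
  have "e ** (matrix_inv e ** e') = e'"
    by (simp add: matrix_mul_assoc G_inv e)
  then show "\<exists>h\<in>G. e' = pact (trivial_pbundle G) p e h"
    using e G_closed by (intro bexI[of _ "matrix_inv e ** e'"]) (simp_all add: trivial_pbundle_def)
next
  fix p e h assume "e \<in> pfib (trivial_pbundle G) p" "pact (trivial_pbundle G) p e h = e"
  then have e: "e \<in> G" "e ** h = e" by (simp_all add: trivial_pbundle_def)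
  then have "matrix_inv e ** e ** h = matrix_inv e ** e"
    by (simp add: matrix_mul_assoc[symmetric])
  then show "h = mat 1" by (simp add: G_inv e(1))
qed (auto simp: trivial_pbundle_def G_closed G_inv rho_one rep_mult matrix_mul_assoc)

interpretation M: assoc_action G "(**)" "mat 1" matrix_inv Ext \<rho> UNIV
  by (rule Ext_action)

interpretation P: assoc_action G "(**)" "mat 1" matrix_inv "trivial_pbundle G" \<rho> UNIV
  by (rule trivial_action)

lemma trivial_principal_section: "principal_section G (trivial_pbundle G) W (\<lambda>_. mat 1)"
  unfolding principal_section_def
proof (intro conjI allI impI ballI)
  fix W' s assume W': "cp3_open W' \<and> W' \<subseteq> W"
  show "psec (trivial_pbundle G) W' s \<longleftrightarrow>
    (\<exists>g. holo_group G W' g \<and> (\<forall>x\<in>W'. s x = pact (trivial_pbundle G) x (mat 1) (g x)))"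
  proof
    assume "\<exists>g. holo_group G W' g \<and> (\<forall>x\<in>W'. s x = pact (trivial_pbundle G) x (mat 1) (g x))"
    then obtain g where g: "holo_group G W' g" "\<forall>x\<in>W'. s x = g x"
      by (auto simp: trivial_pbundle_def)
    have "holo_group G W' s"
      by (rule holo_group_local) (use W' g in blast)+
    then show "psec (trivial_pbundle G) W' s" by (simp add: trivial_pbundle_def)
  qed (auto simp: trivial_pbundle_def)
qed (simp add: trivial_pbundle_def G_closed)

lemma psec_Ext_iff:
  assumes W: "cp3_open W" and l: "psec Lx W l"
  shows "psec Ext W s \<longleftrightarrow> (\<exists>g. holo_group G W g \<and> (\<forall>x\<in>W. s x = L.cls x (l x) (g x)))"
proof -
  have "assoc_sec (- {0}) lact G (holo_group G) Lx W s \<longleftrightarrow>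
      (\<exists>g. holo_group G W g \<and> (\<forall>x\<in>W. s x = L.cls x (l x) (g x)))"
  proof (rule L.assoc_sec_iff[where holH = holo_Cstar and W = W])
    show "l x \<in> pfib Lx x" if "x \<in> W" for x using l that unfolding psec_L_Q by blast
    show "psec Lx W' l" if "W' \<subseteq> W" for W' by (rule psec_L_Q_subset[OF l that])
    show "\<exists>h. holo_Cstar W' h \<and> (\<forall>x\<in>W'. s x = pact Lx x (l x) (h x))"
      if "cp3_open W'" "W' \<subseteq> W" "psec Lx W' s" for W' s
      by (rule psec_L_Q_ratio[OF that(1) psec_L_Q_subset[OF l that(2)] that(3)])
    show "h x \<in> - {0}" if "holo_Cstar W' h" "x \<in> W'" for W' h x
      using that unfolding holo_Cstar_def by blast
    show "f x \<in> G" if "holo_group G W' f" "x \<in> W'" for W' f x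
      using that unfolding holo_group_def by blast
    show "holo_group G W' f" if "cp3_open W'" "\<And>p. p \<in> W' \<Longrightarrow> \<exists>W'' g. cp3_open W'' \<and> p \<in> W'' \<and>
      W'' \<subseteq> W' \<and> holo_group G W'' g \<and> (\<forall>x\<in>W''. f x = g x)" for W' f
      by (rule holo_group_local[OF that])
    show "holo_group G W' (\<lambda>x. lam (h x) ** f x)"
      if "cp3_open W'" "holo_Cstar W' h" "holo_group G W' f" for W' h f
      by (rule holo_group_mult[OF holo_group_cochar[OF lam TG that(2,1)] that(3) G_closed(2)])
  qed (use W in auto)
  then show ?thesis by (simp add: extension_pbundle_def)
qed

text \<open>Relative to [l, 1], the right translate by \<open>g\<close> is [l, g], so the maps to
  \<open>G\<close> describing sections are the same as in \<open>psec_Ext_iff\<close>.\<close>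

lemma Ext_principal_section:
  assumes W: "cp3_open W" and l: "psec Lx W l"
  shows "principal_section G Ext W (\<lambda>x. L.cls x (l x) (mat 1))"
  unfolding principal_section_def
proof (intro conjI allI impI ballI)
  have lx: "x \<in> CP3" "l x \<in> pfib Lx x" if "x \<in> W" for x
    using cp3_openD(1)[OF W] l that unfolding psec_L_Q by blast+
  then show "L.cls x (l x) (mat 1) \<in> pfib Ext x" if "x \<in> W" for x
    using that by (intro Ext_in G_closed)
  fix W' s assume W': "cp3_open W' \<and> W' \<subseteq> W"
  have "pact Ext x (L.cls x (l x) (mat 1)) g = L.cls x (l x) g" if "x \<in> W'" "g \<in> G" for x g
    using pact_Ext[of x "l x" "mat 1" g] lx[of x] that W' G_closed(1) by auto
  then have "(\<exists>g. holo_group G W' g \<and> (\<forall>x\<in>W'. s x = L.cls x (l x) (g x))) \<longleftrightarrow>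
      (\<exists>g. holo_group G W' g \<and> (\<forall>x\<in>W'. s x = pact Ext x (L.cls x (l x) (mat 1)) (g x)))"
    unfolding holo_group_def by (intro ex_cong1) auto
  moreover have "psec Ext W' s \<longleftrightarrow> (\<exists>g. holo_group G W' g \<and> (\<forall>x\<in>W'. s x = L.cls x (l x) (g x)))"
    by (rule psec_Ext_iff) (use W' psec_L_Q_subset[OF l] in auto)
  ultimately show "psec Ext W' s \<longleftrightarrow>
      (\<exists>g. holo_group G W' g \<and> (\<forall>x\<in>W'. s x = pact Ext x (L.cls x (l x) (mat 1)) (g x)))"
    by simp
qed

lemma trivial_principal_bundle: "principal_bundle G (trivial_pbundle G)"
proof (rule principal_bundleI[OF trivial_action])
  show "local_condition (psec (trivial_pbundle G))"
    unfolding local_condition_def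
  proof (intro allI impI iffI)
    fix W s assume "cp3_open W"
      "\<forall>p\<in>W. \<exists>W'. cp3_open W' \<and> p \<in> W' \<and> W' \<subseteq> W \<and> psec (trivial_pbundle G) W' s"
    then show "psec (trivial_pbundle G) W s"
      unfolding trivial_pbundle_def pbundle.select_convs by (intro holo_group_local) blast+
  qed blast
qed (use trivial_principal_section cp3_open_CP3 in blast)

lemma Ext_principal_bundle: "principal_bundle G Ext"
proof (rule principal_bundleI[OF Ext_action])
  show "local_condition (psec Ext)"
    unfolding extension_pbundle_def pbundle.select_convs by (rule assoc_sec_local_condition)
  fix p assume p: "p \<in> CP3"
  obtain W l where "cp3_open W" "p \<in> W" "psec Lx W l" by (rule L_Q_local_section[OF p])
  then show "\<exists>W e. cp3_open W \<and> p \<in> W \<and> principal_section G Ext W e"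
    using Ext_principal_section by blast
qed

text \<open>The operations of \<open>assoc_vbundle\<close> are sets of representatives over all
  points of the principal fibre, so they are compared through the parametrization of classes by
  \<open>G\<close>.\<close>

lemma assoc_vframe:
  assumes act: "assoc_action G (**) (mat 1) matrix_inv R \<rho> UNIV"
    and W: "cp3_open W" and e: "principal_section G R W e"
  shows "vframe smul (assoc_vbundle G smul \<rho> R) W (\<lambda>p. assoc_class G \<rho> UNIV R p (e p))"
proof -
  interpret A: assoc_action G "(**)" "mat 1" matrix_inv R \<rho> UNIV by (rule act)
  show ?thesis
    unfolding vframe_def
  proof (intro conjI ballI allI impI)
    fix p assume "p \<in> W"
    then have p: "p \<in> CP3" and ep: "e p \<in> pfib R p"
      using cp3_openD(1)[OF W] e unfolding principal_section_def by blast+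
    have cls: "A.cls p (e p) v = (\<lambda>h. (pact R p (e p) h, \<rho> (matrix_inv h) v)) ` G" for v
      by (rule A.cls_explicit[OF p ep]) simp
    show "bij_betw (A.cls p (e p)) UNIV (vfib (assoc_vbundle G smul \<rho> R) p)"
      unfolding assoc_vbundle_def vbundle.select_convs by (rule A.cls_bij[OF p ep])
    have fib: "pfib R p = pact R p (e p) ` G"
      using A.pact_bij[OF p ep] by (simp add: bij_betw_def)
    show "A.cls p (e p) 0 = vzero (assoc_vbundle G smul \<rho> R) p"
      unfolding cls fib assoc_vbundle_def vbundle.select_convs by (auto simp: rep_linear G_closed)
    fix v w
    show "A.cls p (e p) (v + w) = vadd (assoc_vbundle G smul \<rho> R) p (A.cls p (e p) v) (A.cls p (e p) w)"
    proof -
      have "z \<in> vadd (assoc_vbundle G smul \<rho> R) p (A.cls p (e p) v) (A.cls p (e p) w) \<longleftrightarrow>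
          (\<exists>h\<in>G. z = (pact R p (e p) h, \<rho> (matrix_inv h) (v + w)))" (is "?L \<longleftrightarrow> ?R") for z
      proof
        assume ?L
        then obtain h k where hk: "h \<in> G" "k \<in> G" "pact R p (e p) h = pact R p (e p) k"
            "z = (pact R p (e p) h, \<rho> (matrix_inv h) v + \<rho> (matrix_inv k) w)"
          unfolding cls assoc_vbundle_def vbundle.select_convs by auto
        \<comment> \<open>Representatives may be added only over the same point; freeness then makes
          the two group elements equal, and linearity of \<open>\<rho>\<close> finishes.\<close>
        then have "h = k" using A.pact_inj[OF p ep hk(1-3)] by simp
        then show ?R
          using hk by (intro bexI[of _ h]) (simp_all add: rep_linear G_closed)
      next
        assume ?R
        then obtain h where h: "h \<in> G" "z = (pact R p (e p) h, \<rho> (matrix_inv h) v + \<rho> (matrix_inv h) w)"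
          by (auto simp: rep_linear G_closed)
        then show ?L
          unfolding cls assoc_vbundle_def vbundle.select_convs by blast
      qed
      then show ?thesis unfolding cls by blast
    qed
    fix t
    show "A.cls p (e p) (smul t v) = vscl (assoc_vbundle G smul \<rho> R) p t (A.cls p (e p) v)"
      unfolding cls assoc_vbundle_def vbundle.select_convs by (auto simp: rep_linear G_closed)
  next
    fix W' s assume W': "cp3_open W' \<and> W' \<subseteq> W"
    have "assoc_sec G \<rho> UNIV (holo_vec smul) R W' s \<longleftrightarrow>
        (\<exists>f. holo_vec smul W' f \<and> (\<forall>x\<in>W'. s x = A.cls x (e x) (f x)))"
    proof (rule A.assoc_sec_iff[where holH = "holo_group G" and W = W])
      show "e x \<in> pfib R x" if "x \<in> W" for x
        using e that unfolding principal_section_def by blast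
      show "psec R V e" if V: "cp3_open V" "V \<subseteq> W" for V
      proof -
        have "e x = pact R x (e x) (mat 1)" if "x \<in> V" for x
        proof -
          have "x \<in> CP3" "e x \<in> pfib R x"
            using that V(2) cp3_openD(1)[OF W] e unfolding principal_section_def by blast+
          then show ?thesis by (simp add: A.pact_one)
        qed
        moreover have "holo_group G V (\<lambda>_. mat 1)" by (rule holo_group_const[OF G_closed(1)])
        ultimately show ?thesis
          using e V unfolding principal_section_def by blast
      qed
      show "\<exists>h. holo_group G V h \<and> (\<forall>x\<in>V. s x = pact R x (e x) (h x))"
        if "cp3_open V" "V \<subseteq> W" "psec R V s" for V s
        using e that unfolding principal_section_def by blast
      show "h x \<in> G" if "holo_group G V h" "x \<in> V" for V h x
        using that unfolding holo_group_def by blast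
      show "holo_vec smul V f" if "cp3_open V" "\<And>p. p \<in> V \<Longrightarrow> \<exists>W'' g. cp3_open W'' \<and> p \<in> W'' \<and>
        W'' \<subseteq> V \<and> holo_vec smul W'' g \<and> (\<forall>x\<in>W''. f x = g x)" for V f
        by (rule holo_vec_local[OF that])
      show "holo_vec smul V (\<lambda>x. \<rho> (h x) (f x))"
        if "cp3_open V" "holo_group G V h" "holo_vec smul V f" for V h f
        by (rule holo_vec_rho[OF fdvs rep G_GL that])
    qed (use W' in auto)
    then show "vsec (assoc_vbundle G smul \<rho> R) W' s \<longleftrightarrow>
        (\<exists>f. holo_vec smul W' f \<and> (\<forall>p\<in>W'. s p = A.cls p (e p) (f p)))"
      by (simp add: assoc_vbundle_def)
  qed
qed

lemma assoc_presheaf: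
  assumes "\<And>V V' e. psec R V e \<Longrightarrow> cp3_open V' \<Longrightarrow> V' \<subseteq> V \<Longrightarrow> psec R V' e"
  shows "presheaf (assoc_vbundle G smul \<rho> R)"
  unfolding presheaf_def assoc_vbundle_def vbundle.select_convs
proof (intro conjI allI impI)
  fix W W' s
  assume s: "assoc_sec G \<rho> UNIV (holo_vec smul) R W s \<and> cp3_open W' \<and> W' \<subseteq> W"
  show "assoc_sec G \<rho> UNIV (holo_vec smul) R W' s"
    by (rule assoc_sec_subset[OF conjunct1[OF s]]) (use s assms holo_vec_subset in blast)+
qed (rule assoc_sec_local_condition)

lemma trivial_assoc_presheaf: "presheaf (assoc_vbundle G smul \<rho> (trivial_pbundle G))"
  by (rule assoc_presheaf) (simp add: trivial_pbundle_def holo_group_subset)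

lemma Ext_assoc_presheaf: "presheaf (assoc_vbundle G smul \<rho> Ext)"
proof (rule assoc_presheaf)
  fix V V' e assume e: "psec Ext V e" and V': "cp3_open V'" "V' \<subseteq> V"
  have "assoc_sec (- {0}) lact G (holo_group G) Lx V e"
    using e by (simp add: extension_pbundle_def)
  then have "assoc_sec (- {0}) lact G (holo_group G) Lx V' e"
    by (rule assoc_sec_subset[OF _ V']) (blast intro: psec_L_Q_subset holo_group_subset)+
  then show "psec Ext V' e" by (simp add: extension_pbundle_def)
qed

end

section \<open>The weight-decomposed bundle\<close>

context ward_data
begin

interpretation L: assoc_action "- {0}" "(*)" 1 inverse Lx lact G
  by (rule line_action)

interpretation M: assoc_action G "(**)" "mat 1" matrix_inv Ext \<rho> UNIV
  by (rule Ext_action)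

interpretation P: assoc_action G "(**)" "mat 1" matrix_inv "trivial_pbundle G" \<rho> UNIV
  by (rule trivial_action)

abbreviation "wts \<equiv> weights T smul \<rho>"
abbreviation "wcomp \<equiv> weight_components T smul \<rho>"
abbreviation "wspace \<equiv> weight_space T smul \<rho>"
abbreviation "wt \<mu> \<equiv> pairing \<mu> lam"

abbreviation minus_bundle :: "((complex^'n^'n \<Rightarrow> complex) \<Rightarrow> complex^4 \<Rightarrow> 'v) vbundle" where
  "minus_bundle \<equiv> direct_sum wts (\<lambda>\<mu>. twisted_bundle smul (- 2 * wt \<mu>) (wspace \<mu>))"

text \<open>The vector \<open>\<Sum> l\<^bsup>k\<^esup> \<otimes> v\<^sub>\<mu>\<close> with \<open>k = \<langle>\<mu>, \<lambda>\<rangle>\<close>, the image of \<open>[[l, 1], v]\<close>.\<close>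

definition weight_vec :: "point \<Rightarrow> (complex^4 \<Rightarrow> complex) \<Rightarrow> 'v \<Rightarrow> (complex^'n^'n \<Rightarrow> complex) \<Rightarrow> complex^4 \<Rightarrow> 'v"
  where "weight_vec p l v = (\<lambda>\<mu>\<in>wts. pure_tensor smul (section_power (\<lambda>_. l) (wt \<mu>) p) (wcomp v \<mu>))"

lemma weight_vec_apply:
  "\<mu> \<in> wts \<Longrightarrow> weight_vec p l v \<mu> x = (if x \<in> p then smul (l x powi wt \<mu>) (wcomp v \<mu>) else 0)"
  by (simp add: weight_vec_def pure_tensor_def section_power_def)

lemma weight_vec_extensional: "weight_vec p l v \<in> extensional wts"
  by (simp add: weight_vec_def)

lemma weight_vec_eqI:
  assumes "\<And>\<mu> x. \<mu> \<in> wts \<Longrightarrow> weight_vec p l v \<mu> x = f \<mu> x" and "f \<in> extensional wts"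
  shows "weight_vec p l v = f"
  using weight_vec_extensional assms(2) by (rule extensionalityI) (rule ext, rule assms(1))

text \<open>Source of the twist: \<open>l\<close> has degree -2, so its power with exponent
  \<open>k\<close> has degree -2k.\<close>

lemma line_power_scale:
  assumes p: "p \<in> CP3" and l: "l \<in> pfib Lx p" and x: "x \<in> p" and t: "t \<noteq> 0"
  shows "l (t *s x) powi k = t powi (- 2 * k) * l x powi k"
  unfolding pfib_L_QD(2)[OF p l x t] power_int_mult_distrib power_int_mult ..

lemma weight_vec_fibre:
  assumes p: "p \<in> CP3" and l: "l \<in> pfib Lx p"
  shows "weight_vec p l v \<in> vfib minus_bundle p"
proof -
  have "weight_vec p l v \<mu> \<in> twisted_fib smul (- 2 * wt \<mu>) (wspace \<mu>) p" if \<mu>: "\<mu> \<in> wts" for \<mu>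
    unfolding twisted_fib_def
  proof (intro CollectI conjI ballI allI impI)
    fix x assume x: "x \<in> p"
    show "weight_vec p l v \<mu> x \<in> wspace \<mu>"
      using x by (simp add: weight_vec_apply \<mu> weight_space_scale weight_components_in)
    fix t :: complex assume t: "t \<noteq> 0"
    show "weight_vec p l v \<mu> (t *s x) = smul (t powi (- 2 * wt \<mu>)) (weight_vec p l v \<mu> x)"
      unfolding weight_vec_apply[OF \<mu>] line_power_scale[OF p l x t]
      using x CP3_scale[OF p x t] by simp
  qed (simp add: weight_vec_apply \<mu>)
  then have "weight_vec p l v \<in> (\<Pi>\<^sub>E \<mu>\<in>wts. twisted_fib smul (- 2 * wt \<mu>) (wspace \<mu>) p)"
    using weight_vec_extensional by (intro PiE_I) (auto simp: extensional_def)
  then show ?thesis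
    unfolding direct_sum_def twisted_bundle_def vbundle.select_convs .
qed

lemma weight_vec_bij:
  assumes p: "p \<in> CP3" and l: "l \<in> pfib Lx p"
  shows "bij_betw (weight_vec p l) UNIV (vfib minus_bundle p)"
proof (rule bij_betwI')
  obtain x where x: "x \<in> p" by (rule CP3_obtain[OF p])
  have lx: "l x \<noteq> 0" by (rule pfib_L_QD(1)[OF p l x])
  fix v w
  show "weight_vec p l v = weight_vec p l w \<longleftrightarrow> v = w"
  proof
    assume eq: "weight_vec p l v = weight_vec p l w"
    have "wcomp v \<mu> = wcomp w \<mu>" if \<mu>: "\<mu> \<in> wts" for \<mu>
    proof -
      have "smul (l x powi wt \<mu>) (wcomp v \<mu>) = smul (l x powi wt \<mu>) (wcomp w \<mu>)"
        using fun_cong[OF fun_cong[OF eq, of \<mu>], of x] x by (simp add: weight_vec_apply \<mu>)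
      then show ?thesis using lx by simp
    qed
    then have "(\<Sum>\<mu>\<in>wts. wcomp v \<mu>) = (\<Sum>\<mu>\<in>wts. wcomp w \<mu>)" by (rule sum.cong[OF refl])
    then show "v = w" unfolding weight_components_sum .
  qed simp
next
  fix v show "weight_vec p l v \<in> vfib minus_bundle p" by (rule weight_vec_fibre[OF p l])
next
  obtain x where x: "x \<in> p" by (rule CP3_obtain[OF p])
  have lx: "l x \<noteq> 0" by (rule pfib_L_QD(1)[OF p l x])
  fix f assume "f \<in> vfib minus_bundle p"
  then have f: "f \<in> (\<Pi>\<^sub>E \<mu>\<in>wts. twisted_fib smul (- 2 * wt \<mu>) (wspace \<mu>) p)"
    unfolding direct_sum_def twisted_bundle_def vbundle.select_convs .
  have f1: "f \<mu> x \<in> wspace \<mu>" "t \<noteq> 0 \<Longrightarrow> f \<mu> (t *s x) = smul (t powi (- 2 * wt \<mu>)) (f \<mu> x)"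
      "y \<notin> p \<Longrightarrow> f \<mu> y = 0" if \<mu>: "\<mu> \<in> wts" for \<mu> t y
    using PiE_mem[OF f \<mu>] x unfolding twisted_fib_def by blast+
  \<comment> \<open>Each component of \<open>f\<close> is divided by the power of \<open>l\<close>
    at the one vector \<open>x\<close>; homogeneity makes the answer correct on the rest of the
    line.\<close>
  define v where "v = (\<Sum>\<mu>\<in>wts. smul (l x powi - wt \<mu>) (f \<mu> x))"
  have v: "wcomp v \<mu> = smul (l x powi - wt \<mu>) (f \<mu> x)" if \<mu>: "\<mu> \<in> wts" for \<mu>
    by (rule weight_components_eqI[where c = "\<lambda>\<mu>. smul (l x powi - wt \<mu>) (f \<mu> x)", OF _ v_def[symmetric] \<mu>])
       (rule weight_space_scale[OF f1(1)])
  have "weight_vec p l v = f"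
  proof (rule weight_vec_eqI)
    fix \<mu> y assume \<mu>: "\<mu> \<in> wts"
    show "weight_vec p l v \<mu> y = f \<mu> y"
    proof (cases "y \<in> p")
      case True
      obtain t where t: "t \<noteq> 0" "y = t *s x" by (rule CP3_scale_obtain[OF p x True])
      have "l x powi wt \<mu> * l x powi - wt \<mu> = 1"
        using lx by (simp add: power_int_minus)
      then have "smul (l y powi wt \<mu>) (wcomp v \<mu>) = smul (t powi (- 2 * wt \<mu>)) (f \<mu> x)"
        unfolding v[OF \<mu>] t(2) line_power_scale[OF p l x t(1)] scale_scale mult.assoc by simp
      then show ?thesis
        using True unfolding weight_vec_apply[OF \<mu>] t(2) f1(2)[OF \<mu> t(1)] by simp
    next
      case False
      then show ?thesis using f1(3)[OF \<mu> False] by (simp add: weight_vec_apply \<mu>)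
    qed
  next
    show "f \<in> extensional wts" using f by (simp add: PiE_def)
  qed
  then show "\<exists>v\<in>UNIV. f = weight_vec p l v" by blast
qed

lemma weight_vec_linear:
  shows "weight_vec p l (v + w) = vadd minus_bundle p (weight_vec p l v) (weight_vec p l w)"
    and "weight_vec p l (smul t v) = vscl minus_bundle p t (weight_vec p l v)"
  unfolding direct_sum_def twisted_bundle_def vbundle.select_convs
  by (rule weight_vec_eqI;
      simp add: weight_vec_apply weight_components_add weight_components_scale scale_right_distrib mult.commute)+

lemma weight_vec_zero: "weight_vec p l 0 = vzero minus_bundle p"
proof -
  have "wcomp 0 \<mu> = 0" if "\<mu> \<in> wts" for \<mu>
    using weight_components_scale[OF that, of 0 0] by simp
  then show ?thesis
    unfolding direct_sum_def twisted_bundle_def vbundle.select_convs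
    by (intro weight_vec_eqI) (simp_all add: weight_vec_apply)
qed

text \<open>Since \<open>holo_vec\<close> tests arbitrary linear functionals, this passes holomorphy
  of a \<open>V\<close>-valued map to its weight components.\<close>

lemma functional_wcomp:
  assumes "linear_functional smul \<phi>" "\<mu> \<in> wts"
  shows "linear_functional smul (\<lambda>v. \<phi> (wcomp v \<mu>))"
  using assms by (simp add: linear_functional_iff[OF fdvs] weight_components_add weight_components_scale)

text \<open>The component of a section at \<open>\<mu>\<close> has degree -2k. Multiplied by the
  power of \<open>l\<close> with exponent -k it has degree 0 and descends to projective space; the
  sum over the weights recovers the \<open>V\<close>-valued coordinate. The converse multiplies the
  components by the opposite powers.\<close>

lemma weight_vframe:
  assumes W: "cp3_open W" and l: "psec Lx W l"
  shows "vframe smul minus_bundle W (\<lambda>p. weight_vec p (l p))"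
proof -
  have lp: "p \<in> CP3" "l p \<in> pfib Lx p" if "p \<in> W" for p
    using cp3_openD(1)[OF W] l that unfolding psec_L_Q by blast+
  have nz: "l (hline x) x \<noteq> 0" if "x \<in> \<Union>W" for x
    by (rule pfib_L_QD(1)[OF lp hline_self]) (rule cp3_open_hline[OF W that])+
  show ?thesis
    unfolding vframe_def
  proof (intro conjI ballI allI impI)
    fix p assume "p \<in> W"
    then show "bij_betw (weight_vec p (l p)) UNIV (vfib minus_bundle p)"
      by (intro weight_vec_bij lp)
  next
    fix W' s assume W': "cp3_open W' \<and> W' \<subseteq> W"
    have hl: "hline x \<in> W'" "x \<in> \<Union>W" if "x \<in> \<Union>W'" for x
      using cp3_open_hline[OF conjunct1[OF W'] that] W' that by auto
    have lW': "holo_on (\<lambda>x. l (hline x) x powi k) (\<Union>W')" for k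
    proof (rule holo_on_power_int)
      show "holo_on (\<lambda>x. l (hline x) x) (\<Union>W')"
        using l W' unfolding psec_L_Q by (elim conjE) (rule holo_on_subset[OF _ Union_mono])
      show "l (hline x) x \<noteq> 0" if "x \<in> \<Union>W'" for x
        by (rule nz[OF hl(2)[OF that]])
    qed
    show "vsec minus_bundle W' s \<longleftrightarrow>
        (\<exists>f. holo_vec smul W' f \<and> (\<forall>p\<in>W'. s p = weight_vec p (l p) (f p)))"
    proof
      assume s: "vsec minus_bundle W' s"
      define f where "f p = inv_into UNIV (weight_vec p (l p)) (s p)" for p
      have sf: "s p = weight_vec p (l p) (f p)" if p: "p \<in> W'" for p
      proof -
        have "p \<in> W" using p W' by blast
        then have "bij_betw (weight_vec p (l p)) UNIV (vfib minus_bundle p)"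
          by (intro weight_vec_bij lp)
        moreover have "s p \<in> vfib minus_bundle p"
          using s p unfolding vsec_direct_sum_twisted by blast
        ultimately show ?thesis
          by (simp add: f_def bij_betw_inv_into_right)
      qed
      have "holo_vec smul W' f"
        unfolding holo_vec_def cp3_holo_def
      proof (intro allI impI)
        fix \<phi> assume \<phi>: "linear_functional smul \<phi>"
        have "holo_on (\<lambda>x. \<Sum>\<mu>\<in>wts. l (hline x) x powi - wt \<mu> * \<phi> (s (hline x) \<mu> x)) (\<Union>W')"
        proof (intro holo_on_sum holo_on_mult lW')
          fix \<mu> assume "\<mu> \<in> wts"
          then show "holo_on (\<lambda>x. \<phi> (s (hline x) \<mu> x)) (\<Union>W')"
            using s \<phi> unfolding vsec_direct_sum_twisted by simp
        qed
        then show "holo_on (\<lambda>x. \<phi> (f (hline x))) (\<Union>W')"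
        proof (rule holo_on_cong[OF cp3_openD(2)[OF conjunct1[OF W']]])
          fix x assume x: "x \<in> \<Union>W'"
          have "l (hline x) x powi - wt \<mu> * \<phi> (s (hline x) \<mu> x) = \<phi> (wcomp (f (hline x)) \<mu>)"
            if \<mu>: "\<mu> \<in> wts" for \<mu>
          proof -
            have "\<phi> (s (hline x) \<mu> x) = l (hline x) x powi wt \<mu> * \<phi> (wcomp (f (hline x)) \<mu>)"
              unfolding sf[OF hl(1)[OF x]] weight_vec_apply[OF \<mu>]
              by (simp add: hline_self linear_functional_scale[OF fdvs \<phi>])
            moreover have "l (hline x) x powi - wt \<mu> * l (hline x) x powi wt \<mu> = 1"
              using nz[OF hl(2)[OF x]] by (simp add: power_int_minus)
            ultimately show ?thesis by (simp only: mult.assoc[symmetric] mult_1)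
          qed
          then have "(\<Sum>\<mu>\<in>wts. l (hline x) x powi - wt \<mu> * \<phi> (s (hline x) \<mu> x)) =
              (\<Sum>\<mu>\<in>wts. \<phi> (wcomp (f (hline x)) \<mu>))"
            by (rule sum.cong[OF refl])
          then show "\<phi> (f (hline x)) =
              (\<Sum>\<mu>\<in>wts. l (hline x) x powi - wt \<mu> * \<phi> (s (hline x) \<mu> x))"
            unfolding linear_functional_sum[OF fdvs \<phi>, symmetric] weight_components_sum by simp
        qed
      qed
      then show "\<exists>f. holo_vec smul W' f \<and> (\<forall>p\<in>W'. s p = weight_vec p (l p) (f p))"
        using sf by (intro exI[of _ f]) simp
    next
      assume "\<exists>f. holo_vec smul W' f \<and> (\<forall>p\<in>W'. s p = weight_vec p (l p) (f p))"
      then obtain f where f: "holo_vec smul W' f" "\<forall>p\<in>W'. s p = weight_vec p (l p) (f p)" by blast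
      show "vsec minus_bundle W' s"
        unfolding vsec_direct_sum_twisted
      proof (intro conjI ballI allI impI)
        fix p assume p: "p \<in> W'"
        then have "p \<in> W" using W' by blast
        then have "weight_vec p (l p) (f p) \<in> vfib minus_bundle p"
          by (intro weight_vec_fibre lp)
        then show "s p \<in> vfib minus_bundle p" using f(2) p by simp
      next
        fix \<mu> \<phi> assume \<mu>: "\<mu> \<in> wts" and \<phi>: "linear_functional smul \<phi>"
        have "holo_on (\<lambda>x. l (hline x) x powi wt \<mu> * \<phi> (wcomp (f (hline x)) \<mu>)) (\<Union>W')"
        proof (intro holo_on_mult lW')
          show "holo_on (\<lambda>x. \<phi> (wcomp (f (hline x)) \<mu>)) (\<Union>W')"
            using f(1)[unfolded holo_vec_def cp3_holo_def, rule_format, OF functional_wcomp[OF \<phi> \<mu>]] .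
        qed
        then show "holo_on (\<lambda>x. \<phi> (s (hline x) \<mu> x)) (\<Union>W')"
        proof (rule holo_on_cong[OF cp3_openD(2)[OF conjunct1[OF W']]])
          fix x assume x: "x \<in> \<Union>W'"
          have "s (hline x) \<mu> x = smul (l (hline x) x powi wt \<mu>) (wcomp (f (hline x)) \<mu>)"
            unfolding bspec[OF f(2) hl(1)[OF x]] weight_vec_apply[OF \<mu>] by (simp add: hline_self)
          then show "\<phi> (s (hline x) \<mu> x) = l (hline x) x powi wt \<mu> * \<phi> (wcomp (f (hline x)) \<mu>)"
            by (simp add: linear_functional_scale[OF fdvs \<phi>])
        qed
      qed
    qed
  qed (simp_all add: weight_vec_linear weight_vec_zero)
qed

text \<open>On the component of weight \<open>\<mu>\<close> the scalar contributes its power with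
  exponent \<open>wt \<mu>\<close> on the left and \<open>\<mu> (lam t)\<close> on the right; the
  pairing is defined so that they coincide.\<close>

lemma weight_vec_line_scale:
  assumes "t \<noteq> 0"
  shows "weight_vec p (pact Lx p l t) v = weight_vec p l (\<rho> (lam t) v)"
proof (rule weight_vec_eqI)
  fix \<mu> x assume \<mu>: "\<mu> \<in> wts"
  have "\<mu> (lam t) = t powi wt \<mu>"
    by (rule pairing_powi[OF algebraic lam subsetD[OF weights_characters \<mu>] assms])
  then have "wcomp (\<rho> (lam t) v) \<mu> = smul (t powi wt \<mu>) (wcomp v \<mu>)"
    by (simp add: weight_components_rho[OF \<mu> lam_T[OF assms]])
  then show "weight_vec p (pact Lx p l t) v \<mu> x = weight_vec p l (\<rho> (lam t) v) \<mu> x"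
    unfolding weight_vec_apply[OF \<mu>] by (simp add: pact_L_Q power_int_mult_distrib mult.commute)
qed (rule weight_vec_extensional)

text \<open>Reads off the representative over the unit matrix, the constant section of the trivial
  bundle.\<close>

definition plus_iso :: "point \<Rightarrow> ((complex^'n^'n) \<times> 'v) set \<Rightarrow> 'v" where
  "plus_iso p c = (THE v. (mat 1, v) \<in> c)"

text \<open>O(-2) has no nowhere vanishing global section, so the reference vector is chosen at each
  point without any continuity; \<open>minus_iso_cls\<close> removes the choice.\<close>

definition minus_iso ::
  "point \<Rightarrow> (((complex^4 \<Rightarrow> complex) \<times> (complex^'n^'n)) set \<times> 'v) set \<Rightarrow>
     (complex^'n^'n \<Rightarrow> complex) \<Rightarrow> complex^4 \<Rightarrow> 'v" where
  "minus_iso p c = (let l = SOME l. l \<in> pfib Lx p in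
     weight_vec p l (THE v. (L.cls p l (mat 1), v) \<in> c))"

lemma plus_iso_cls:
  assumes p: "p \<in> CP3" and g: "g \<in> G"
  shows "plus_iso p (P.cls p g v) = \<rho> g v"
proof -
  have one: "mat 1 \<in> pfib (trivial_pbundle G) p"
    by (simp add: trivial_pbundle_def G_closed)
  have "P.cls p g v = P.cls p (pact (trivial_pbundle G) p (mat 1) g) v"
    by (simp add: trivial_pbundle_def)
  also have "\<dots> = P.cls p (mat 1) (\<rho> g v)"
    by (rule P.cls_pact[OF p one UNIV_I g])
  finally show ?thesis
    unfolding plus_iso_def by (simp add: P.cls_mem_same[OF p one])
qed

text \<open>If \<open>l\<close> is \<open>t\<close> times the chosen vector, the scalar crosses the
  inner quotient as \<open>lam t\<close> and the outer one as \<open>\<rho> (lam t)\<close>. The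
  weight vector changes in the same way, so the choice disappears.\<close>

lemma minus_iso_cls:
  assumes p: "p \<in> CP3" and l: "l \<in> pfib Lx p"
  shows "minus_iso p (M.cls p (L.cls p l (mat 1)) v) = weight_vec p l v"
proof -
  define m where "m = (SOME l. l \<in> pfib Lx p)"
  have m: "m \<in> pfib Lx p"
    unfolding m_def using l by (rule someI[of "\<lambda>l. l \<in> pfib Lx p"])
  obtain t where t: "t \<in> - {0}" "l = pact Lx p m t"
    using L.pact_transitive[OF p m l] by blast
  have lt: "lam t \<in> G" using t(1) lam_G by simp
  have e: "L.cls p m (mat 1) \<in> pfib Ext p" by (rule Ext_in[OF p m G_closed(1)])
  have "L.cls p l (mat 1) = L.cls p m (lam t ** mat 1)"
    unfolding t(2) by (rule L.cls_pact[OF p m G_closed(1) t(1)])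
  also have "\<dots> = pact Ext p (L.cls p m (mat 1)) (lam t)"
    unfolding pact_Ext[OF p m G_closed(1) lt] by simp
  finally have "M.cls p (L.cls p l (mat 1)) v = M.cls p (L.cls p m (mat 1)) (\<rho> (lam t) v)"
    using M.cls_pact[OF p e UNIV_I lt] by simp
  then have "minus_iso p (M.cls p (L.cls p l (mat 1)) v) = weight_vec p m (\<rho> (lam t) v)"
    unfolding minus_iso_def m_def[symmetric] Let_def by (simp add: M.cls_mem_same[OF p e])
  then show ?thesis
    using t weight_vec_line_scale[of t p m v] by simp
qed

text \<open>The power with exponent k of the inverse of \<open>q\<close> is the power of
  \<open>q\<close> with exponent -k; this is the origin of the sign in the gluing.\<close>

lemma glue_weight_vec:
  "weight_vec p (section_power q (-1) p) v = vglue (weight_bundle T smul \<rho> lam q) p v"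
proof (rule weight_vec_eqI)
  fix \<mu> x assume \<mu>: "\<mu> \<in> wts"
  show "weight_vec p (section_power q (-1) p) v \<mu> x = vglue (weight_bundle T smul \<rho> lam q) p v \<mu> x"
    unfolding weight_vec_apply[OF \<mu>]
    by (simp add: weight_bundle_def \<mu> pure_tensor_def section_power_def power_int_minus power_int_inverse)
qed (simp add: weight_bundle_def)

section \<open>Compatibility with the gluings over the complement of the quadric\<close>

context
  fixes Q q assumes q: "smooth_quadric Q q"
begin

lemma complement:
  assumes "p \<in> CP3 - Q"
  shows "p \<in> CP3" "section_power q (-1) p \<in> pfib Lx p"
  using assms quadric_inverse_section[OF q] unfolding psec_L_Q by blast+

text \<open>Over the complement the inverse of \<open>q\<close> is a global reference section, so
  the gluing map identifies a map to \<open>G\<close> with the section of the minus sheet that it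
  describes.\<close>

lemma ward_pb_iso: "pb_iso G (CP3 - Q) (trivial_pbundle G) Ext (pglue (ward_bundle G lam q))"
  unfolding pb_iso_def
proof (intro conjI ballI allI impI)
  have glue: "pglue (ward_bundle G lam q) p g = L.cls p (section_power q (-1) p) g" for p g
    by (simp add: ward_bundle_def)
  fix p assume "p \<in> CP3 - Q"
  note pl = complement[OF this]
  show "bij_betw (pglue (ward_bundle G lam q) p) (pfib (trivial_pbundle G) p) (pfib Ext p)"
    using L.cls_bij[OF pl] unfolding glue[abs_def] pfib_Ext by (simp add: trivial_pbundle_def)
  fix e g assume "e \<in> pfib (trivial_pbundle G) p" and g: "g \<in> G"
  then have e: "e \<in> G" by (simp add: trivial_pbundle_def)
  show "pglue (ward_bundle G lam q) p (pact (trivial_pbundle G) p e g) =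
      pact Ext p (pglue (ward_bundle G lam q) p e) g"
    unfolding glue pact_Ext[OF pl e g] by (simp add: trivial_pbundle_def)
next
  fix W s assume W: "cp3_open W \<and> W \<subseteq> CP3 - Q \<and> (\<forall>p\<in>W. s p \<in> pfib (trivial_pbundle G) p)"
  have sG: "s p \<in> G" if "p \<in> W" for p
    using W that by (simp add: trivial_pbundle_def)
  have Wo: "cp3_open W" and WU: "W \<subseteq> CP3 - Q" using W by blast+
  have ext: "psec Ext W (\<lambda>p. pglue (ward_bundle G lam q) p (s p)) \<longleftrightarrow>
      (\<exists>g. holo_group G W g \<and>
        (\<forall>x\<in>W. L.cls x (section_power q (-1) x) (s x) = L.cls x (section_power q (-1) x) (g x)))"
    unfolding psec_Ext_iff[OF Wo psec_L_Q_subset[OF quadric_inverse_section[OF q] WU]]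
    by (simp add: ward_bundle_def)
  show "psec (trivial_pbundle G) W s \<longleftrightarrow> psec Ext W (\<lambda>p. pglue (ward_bundle G lam q) p (s p))"
  proof
    assume "psec (trivial_pbundle G) W s"
    then have "holo_group G W s" by (simp add: trivial_pbundle_def)
    then show "psec Ext W (\<lambda>p. pglue (ward_bundle G lam q) p (s p))"
      unfolding ext by blast
  next
    assume "psec Ext W (\<lambda>p. pglue (ward_bundle G lam q) p (s p))"
    then obtain g where g: "holo_group G W g"
        "\<forall>x\<in>W. L.cls x (section_power q (-1) x) (s x) = L.cls x (section_power q (-1) x) (g x)"
      unfolding ext by blast
    \<comment> \<open>The second entry of a class over a fixed line vector is unique, so the
      holomorphic representative is \<open>s\<close> itself.\<close>
    have eq: "s x = g x" if x: "x \<in> W" for x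
    proof (rule L.cls_inj[OF complement])
      show "x \<in> CP3 - Q" "x \<in> CP3 - Q" using WU x by blast+
      show "s x \<in> G" by (rule sG[OF x])
      show "g x \<in> G" using g(1) x by (simp add: holo_group_def)
      show "L.cls x (section_power q (-1) x) (s x) = L.cls x (section_power q (-1) x) (g x)"
        using g(2) x by blast
    qed
    have "holo_group G W s"
    proof (rule holo_group_local[OF Wo])
      fix p assume "p \<in> W"
      then show "\<exists>W' h. cp3_open W' \<and> p \<in> W' \<and> W' \<subseteq> W \<and> holo_group G W' h \<and> (\<forall>x\<in>W'. s x = h x)"
        using Wo g(1) eq by (intro exI[of _ W] exI[of _ g]) simp
    qed
    then show "psec (trivial_pbundle G) W s" by (simp add: trivial_pbundle_def)
  qed
qed

lemma ward_glued_principal_bundle: "glued_principal_bundle G Q (ward_bundle G lam q)"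
  using trivial_principal_bundle Ext_principal_bundle ward_pb_iso
  by (simp add: glued_principal_bundle_def ward_bundle_def)

abbreviation "assoc_ward \<equiv> assoc_glued G smul \<rho> (ward_bundle G lam q)"
abbreviation "weight_ward \<equiv> weight_bundle T smul \<rho> lam q"

lemma ward_sides:
  "vplus assoc_ward = assoc_vbundle G smul \<rho> (trivial_pbundle G)"
  "vminus assoc_ward = assoc_vbundle G smul \<rho> Ext"
  "vplus weight_ward = trivial_vbundle smul"
  "vminus weight_ward = minus_bundle"
  by (simp_all add: assoc_glued_def ward_bundle_def weight_bundle_def)

lemma plus_vframe: "cp3_open W \<Longrightarrow>
    vframe smul (assoc_vbundle G smul \<rho> (trivial_pbundle G)) W (\<lambda>p. P.cls p (mat 1))"
  by (rule assoc_vframe[OF trivial_action _ trivial_principal_section])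

lemma minus_vframe: "cp3_open W \<Longrightarrow> psec Lx W l \<Longrightarrow>
    vframe smul (assoc_vbundle G smul \<rho> Ext) W (\<lambda>p. M.cls p (L.cls p (l p) (mat 1)))"
  by (rule assoc_vframe[OF Ext_action _ Ext_principal_section])

text \<open>\<open>assoc_glued\<close> moves the representatives of a class one by one. With both
  classes parametrized by \<open>G\<close>, their images are seen to fill exactly one class on the
  minus sheet.\<close>

lemma assoc_glue:
  assumes "p \<in> CP3 - Q"
  shows "vglue assoc_ward p (P.cls p (mat 1) v) = M.cls p (L.cls p (section_power q (-1) p) (mat 1)) v"
proof -
  note pl = complement[OF assms]
  let ?l = "section_power q (-1) p"
  have one: "mat 1 \<in> pfib (trivial_pbundle G) p"
    by (simp add: trivial_pbundle_def G_closed)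
  have e: "L.cls p ?l (mat 1) \<in> pfib Ext p" by (rule Ext_in[OF pl G_closed(1)])
  have "vglue assoc_ward p (P.cls p (mat 1) v) = (\<lambda>(e, v). (L.cls p ?l e, v)) ` P.cls p (mat 1) v"
    by (simp add: assoc_glued_def ward_bundle_def)
  also have "\<dots> = (\<lambda>h. (L.cls p ?l h, \<rho> (matrix_inv h) v)) ` G"
    unfolding P.cls_explicit[OF pl(1) one UNIV_I] image_image by (simp add: trivial_pbundle_def)
  also have "\<dots> = (\<lambda>h. (pact Ext p (L.cls p ?l (mat 1)) h, \<rho> (matrix_inv h) v)) ` G"
    by (rule image_cong[OF refl]) (simp add: pact_Ext[OF pl G_closed(1)])
  also have "\<dots> = M.cls p (L.cls p ?l (mat 1)) v"
    by (rule M.cls_explicit[OF pl(1) e UNIV_I, symmetric])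
  finally show ?thesis .
qed

lemma glued_bundles: "glued_vector_bundle Q assoc_ward" "glued_vector_bundle Q weight_ward"
proof -
  have U: "cp3_open (CP3 - Q)" by (rule quadric_complement_open[OF q])
  have qs: "psec Lx (CP3 - Q) (section_power q (-1))" by (rule quadric_inverse_section[OF q])
  have local: "\<exists>W l. cp3_open W \<and> p \<in> W \<and> psec Lx W l" if "p \<in> CP3" for p
    using L_Q_local_section[OF that] by blast
  have "vector_bundle (assoc_vbundle G smul \<rho> (trivial_pbundle G))"
  proof (rule vector_bundle_of_frames[OF fdvs])
    show "local_condition (vsec (assoc_vbundle G smul \<rho> (trivial_pbundle G)))"
      using trivial_assoc_presheaf unfolding presheaf_def by (rule conjunct1)
    fix p assume "p \<in> CP3"
    then show "\<exists>W \<psi>. cp3_open W \<and> p \<in> W \<and>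
        vframe smul (assoc_vbundle G smul \<rho> (trivial_pbundle G)) W \<psi>"
      using plus_vframe[OF cp3_open_CP3] cp3_open_CP3 by blast
  qed
  moreover have "vector_bundle (assoc_vbundle G smul \<rho> Ext)"
  proof (rule vector_bundle_of_frames[OF fdvs])
    show "local_condition (vsec (assoc_vbundle G smul \<rho> Ext))"
      using Ext_assoc_presheaf unfolding presheaf_def by (rule conjunct1)
    fix p assume "p \<in> CP3"
    then obtain W l where "cp3_open W" "p \<in> W" "psec Lx W l" using local by blast
    then show "\<exists>W \<psi>. cp3_open W \<and> p \<in> W \<and> vframe smul (assoc_vbundle G smul \<rho> Ext) W \<psi>"
      using minus_vframe by blast
  qed
  moreover have "vb_iso (CP3 - Q) (assoc_vbundle G smul \<rho> (trivial_pbundle G))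
      (assoc_vbundle G smul \<rho> Ext) (vglue assoc_ward)"
  proof (rule vb_iso_of_frames[OF trivial_assoc_presheaf Ext_assoc_presheaf])
    fix p assume p: "p \<in> CP3 - Q"
    show "\<exists>W \<psi> \<eta>. cp3_open W \<and> p \<in> W \<and>
        vframe smul (assoc_vbundle G smul \<rho> (trivial_pbundle G)) W \<psi> \<and>
        vframe smul (assoc_vbundle G smul \<rho> Ext) W \<eta> \<and> (\<forall>x\<in>W. \<forall>v. vglue assoc_ward x (\<psi> x v) = \<eta> x v)"
      by (rule exI[of _ "CP3 - Q"], rule exI[of _ "\<lambda>p. P.cls p (mat 1)"],
          rule exI[of _ "\<lambda>p. M.cls p (L.cls p (section_power q (-1) p) (mat 1))"])
         (intro conjI ballI allI U p plus_vframe minus_vframe qs assoc_glue)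
  qed
  ultimately show "glued_vector_bundle Q assoc_ward"
    by (simp only: glued_vector_bundle_def ward_sides)
  have "vector_bundle (trivial_vbundle smul)"
  proof (rule vector_bundle_of_frames[OF fdvs])
    show "local_condition (vsec (trivial_vbundle smul))"
      using trivial_presheaf unfolding presheaf_def by (rule conjunct1)
    fix p assume "p \<in> CP3"
    then show "\<exists>W \<psi>. cp3_open W \<and> p \<in> W \<and> vframe smul (trivial_vbundle smul) W \<psi>"
      using trivial_vframe[OF fdvs] cp3_open_CP3 by blast
  qed
  moreover have "vector_bundle minus_bundle"
  proof (rule vector_bundle_of_frames[OF fdvs])
    show "local_condition (vsec minus_bundle)"
      using direct_sum_twisted_presheaf unfolding presheaf_def by (rule conjunct1)
    fix p assume "p \<in> CP3"
    then obtain W l where "cp3_open W" "p \<in> W" "psec Lx W l" using local by blast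
    then show "\<exists>W \<psi>. cp3_open W \<and> p \<in> W \<and> vframe smul minus_bundle W \<psi>"
      using weight_vframe by blast
  qed
  moreover have "vb_iso (CP3 - Q) (trivial_vbundle smul) minus_bundle (vglue weight_ward)"
  proof (rule vb_iso_of_frames[OF trivial_presheaf direct_sum_twisted_presheaf])
    fix p assume p: "p \<in> CP3 - Q"
    show "\<exists>W \<psi> \<eta>. cp3_open W \<and> p \<in> W \<and> vframe smul (trivial_vbundle smul) W \<psi> \<and>
        vframe smul minus_bundle W \<eta> \<and> (\<forall>x\<in>W. \<forall>v. vglue weight_ward x (\<psi> x v) = \<eta> x v)"
      by (rule exI[of _ "CP3 - Q"], rule exI[of _ "\<lambda>p v. v"],
          rule exI[of _ "\<lambda>p. weight_vec p (section_power q (-1) p)"])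
         (intro conjI ballI allI U p trivial_vframe[OF fdvs] weight_vframe qs glue_weight_vec[symmetric])
  qed
  ultimately show "glued_vector_bundle Q weight_ward"
    by (simp only: glued_vector_bundle_def ward_sides)
qed

text \<open>The frames over the unit section and over the inverse of \<open>q\<close> exhaust the
  fibres over the complement, so compatibility with the gluings is checked on frame vectors, where
  both sides are the same weight vector.\<close>

lemma ward_glued_vb_iso: "glued_vb_iso Q assoc_ward weight_ward plus_iso minus_iso"
  unfolding glued_vb_iso_def ward_sides
proof (intro conjI ballI glued_bundles)
  show "vb_iso CP3 (assoc_vbundle G smul \<rho> (trivial_pbundle G)) (trivial_vbundle smul) plus_iso"
  proof (rule vb_iso_of_frames[OF trivial_assoc_presheaf trivial_presheaf])
    fix p assume p: "p \<in> CP3"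
    have "plus_iso x (P.cls x (mat 1) v) = v" if "x \<in> CP3" for x v
      by (simp add: plus_iso_cls[OF that G_closed(1)] rho_one)
    then show "\<exists>W \<psi> \<eta>. cp3_open W \<and> p \<in> W \<and>
        vframe smul (assoc_vbundle G smul \<rho> (trivial_pbundle G)) W \<psi> \<and>
        vframe smul (trivial_vbundle smul) W \<eta> \<and> (\<forall>x\<in>W. \<forall>v. plus_iso x (\<psi> x v) = \<eta> x v)"
      by (intro exI[of _ CP3] exI[of _ "\<lambda>p. P.cls p (mat 1)"] exI[of _ "\<lambda>p v. v"] conjI
            cp3_open_CP3 p plus_vframe trivial_vframe[OF fdvs]) simp
  qed
  show "vb_iso CP3 (assoc_vbundle G smul \<rho> Ext) minus_bundle minus_iso"
  proof (rule vb_iso_of_frames[OF Ext_assoc_presheaf direct_sum_twisted_presheaf])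
    fix p assume p: "p \<in> CP3"
    obtain W l where W: "cp3_open W" "p \<in> W" and l: "psec Lx W l" by (rule L_Q_local_section[OF p])
    have "minus_iso x (M.cls x (L.cls x (l x) (mat 1)) v) = weight_vec x (l x) v" if "x \<in> W" for x v
    proof (rule minus_iso_cls)
      show "x \<in> CP3" using cp3_openD(1)[OF W(1)] that by blast
      show "l x \<in> pfib Lx x" using l that unfolding psec_L_Q by blast
    qed
    then show "\<exists>W \<psi> \<eta>. cp3_open W \<and> p \<in> W \<and> vframe smul (assoc_vbundle G smul \<rho> Ext) W \<psi> \<and>
        vframe smul minus_bundle W \<eta> \<and> (\<forall>x\<in>W. \<forall>v. minus_iso x (\<psi> x v) = \<eta> x v)"
      by (intro exI[of _ W] exI[of _ "\<lambda>p. M.cls p (L.cls p (l p) (mat 1))"]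
            exI[of _ "\<lambda>p. weight_vec p (l p)"] conjI W minus_vframe weight_vframe l) simp
  qed
  fix p a assume p: "p \<in> CP3 - Q" and a: "a \<in> vfib (assoc_vbundle G smul \<rho> (trivial_pbundle G)) p"
  note pl = complement[OF p]
  obtain v where v: "a = P.cls p (mat 1) v"
    by (rule vframe_obtain[OF plus_vframe[OF cp3_open_CP3] pl(1) a])
  show "minus_iso p (vglue assoc_ward p a) = vglue weight_ward p (plus_iso p a)"
    unfolding v assoc_glue[OF p] minus_iso_cls[OF pl] plus_iso_cls[OF pl(1) G_closed(1)] rho_one
    by (rule glue_weight_vec)
qed

end

end

text \<open>The last conjunct normalizes the isomorphism on the plus sheet to the canonical map from
  [g, v] to \<open>\<rho> g v\<close>. As the gluing maps are bijective on fibres, compatibility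
  then determines the isomorphism on the minus sheet over the complement of
  \<open>Q\<close>.\<close>

theorem proposition9p4:
  fixes G T :: "(complex^'n^'n) set"
    and lam :: "complex \<Rightarrow> complex^'n^'n"
    and smul :: "complex \<Rightarrow> 'v::ab_group_add \<Rightarrow> 'v"
    and B :: "'v set"
    and \<rho> :: "complex^'n^'n \<Rightarrow> 'v \<Rightarrow> 'v"
    and Q :: "point set"
    and q :: "point \<Rightarrow> complex^4 \<Rightarrow> complex"
  assumes "connected_reductive_group G"
    and "maximal_torus G T"
    and "cocharacter T lam"
    and "finite_dimensional_vector_space smul B"
    and "rational_representation G smul \<rho>"
    and "smooth_quadric Q q"
  shows "glued_principal_bundle G Q (ward_bundle G lam q) \<and>
    (\<exists>\<Phi>p \<Phi>m.
       glued_vb_iso Q (assoc_glued G smul \<rho> (ward_bundle G lam q))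
         (weight_bundle T smul \<rho> lam q) \<Phi>p \<Phi>m \<and>
       (\<forall>p\<in>CP3. \<forall>g\<in>G. \<forall>v. \<Phi>p p (assoc_class G \<rho> UNIV (trivial_pbundle G) p g v) = \<rho> g v))"
proof -
  have G: "algebraic_group G"
    using assms(1) by (simp add: connected_reductive_group_def)
  have T: "torus T" "T \<subseteq> G"
    using assms(2) by (simp_all add: maximal_torus_def)
  have lin: "Vector_Spaces.linear smul smul (\<rho> a)" if "a \<in> T" for a
    using assms(5) that T(2) unfolding rational_representation_def by blast
  have mult: "\<rho> (a ** b) v = \<rho> a (\<rho> b v)" if "a \<in> T" "b \<in> T" for a b v
  proof -
    have "\<rho> (a ** b) = \<rho> a \<circ> \<rho> b"
      using assms(5) that T(2) unfolding rational_representation_def by blast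
    then show ?thesis by simp
  qed
  have one: "\<rho> (mat 1) v = v" for v
    using assms(5) unfolding rational_representation_def by simp
  have reg: "regular_on GL_gens T (\<lambda>a. \<phi> (\<rho> a v))" if "linear_functional smul \<phi>" for \<phi> v
    by (rule regular_on_subset[OF _ T(2)]) (use assms(5) that in \<open>simp add: rational_representation_def\<close>)
  interpret ward_data smul B T \<rho> G lam
    by (intro ward_data.intro torus_rep.intro torus_rep_axioms.intro ward_data_axioms.intro)
       (fact assms(4) T lin one mult reg G assms(3) assms(5))+
  show ?thesis
    using ward_glued_principal_bundle[OF assms(6)] ward_glued_vb_iso[OF assms(6)] plus_iso_cls by blast
qed

end
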